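(* Let $k$ be a field, $n\ge2$, $\rho\colon F_n\rtimes B_n\to\mathrm{GL}(V)$ a representation on a finite-dimensional $k$-vector space, $g_i=\rho(x_i)$, $s_i=\rho(\sigma_i)$, $1\le i\le n-1$, and $\lambda\in k^\times\setminus\{1\}$. Assume that the minimal polynomials of $s_i$ and $s_ig_i$ split over $k$. Suppose $s_i$ and $s_ig_i$ are semisimple, and for an operator $A$ let $\Pi^A_\nu$ denote its spectral projection onto the eigenvalue $\nu$. Then $\rho^{\mathrm{LM}}_\lambda(\sigma_i)$ is semisimple if and only if $$\Pi^{s_i}_\nu\,\Pi^{-s_ig_i}_\nu=0\qquad\text{for every }\nu\in\mathrm{spec}(s_i)\cap\bigl(-\mathrm{spec}(s_ig_i)\bigr).$$ If this holds, then $\rho^{\mathrm{KLM}}_\lambda(\sigma_i)$ is semisimple for every $\lambda\in k^\times\setminus\{1\}$.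
   Context: $B_n$ is the Artin braid group with standard generators $\sigma_1,\dots,\sigma_{n-1}$; $F_n$ is the free group on $x_1,\dots,x_n$. The Artin action $\theta\colon B_n\to\mathrm{Aut}(F_n)$ is $\theta_{\sigma_i}(x_i)=x_{i+1}$, $\theta_{\sigma_i}(x_{i+1})=x_{i+1}^{-1}x_ix_{i+1}$, $\theta_{\sigma_i}(x_j)=x_j$ for $j\ne i,i+1$. $F_n\rtimes B_n$ is the corresponding semidirect product, in which $\sigma x\sigma^{-1}=\theta_\sigma(x)$. Put $N=\dim V$. Twisted Long--Moody construction: for $\lambda\in k^\times$, $\rho^{\mathrm{LM}}_\lambda\colon F_n\rtimes B_n\to\mathrm{GL}(V^{\oplus n})$ is the representation given on generators as follows, in $n\times n$ block form with $N\times N$ blocks. $\rho^{\mathrm{LM}}_\lambda(x_i)$ is the identity matrix except in the $i$-th block row, which equals $(\lambda(g_1-1),\dots,\lambda(g_{i-1}-1),\lambda g_i,g_{i+1}-1,\dots,g_n-1)$. $\rho^{\mathrm{LM}}_\lambda(\sigma_i)=s_i^{\oplus n}\cdot\mathrm{diag}(I_{N(i-1)},R_i,I_{N(n-i-1)})$ with $R_i=\begin{pmatrix}O&g_i\\ I_N&I_N-g_{i+1}\end{pmatrix}$ in block rows and columns $i,i+1$ (in particular it does not depend on $\lambda$). Katz--Long--Moody (KLM) construction: let $K=\{(w_1,\dots,w_n)^T: w_j\in\mathrm{Ker}(g_j-1)\}$ and $L=\bigcap_{j=1}^n\mathrm{Ker}(\rho^{\mathrm{LM}}_\lambda(x_j)-I)$.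 The subspace $K+L$ is $\rho^{\mathrm{LM}}_\lambda$-invariant, and $\rho^{\mathrm{KLM}}_\lambda$ is the induced representation of $F_n\rtimes B_n$ on $V^{\oplus n}/(K+L)$. $\mathrm{spec}$ denotes the set of eigenvalues and $-\mathrm{spec}(A)=\{-\nu:\nu\in\mathrm{spec}(A)\}$. For a diagonalizable $A$, $\Pi^A_\nu$ is the projection onto $\mathrm{Ker}(A-\nu)$ along the sum of the other eigenspaces. *)

theory Defs
  imports "Jordan_Normal_Form.VS_Connect" "HOL-Algebra.Bij" "HOL-Algebra.AbelCoset"
begin

section \<open>Groups given by generators and relations\<close>

text \<open>The letter \<open>(a, True)\<close> stands for the generator \<open>a\<close>, the letter \<open>(a, False)\<close> for its inverse.\<close>

type_synonym 'g word = "('g \<times> bool) list"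

abbreviation words :: "'g set \<Rightarrow> 'g word set" where
  "words S \<equiv> {w. set w \<subseteq> S \<times> UNIV}"

inductive pres_cong :: "'g set \<Rightarrow> ('g word \<times> 'g word) set \<Rightarrow> 'g word \<Rightarrow> 'g word \<Rightarrow> bool"
  for S R where
  refl: "w \<in> words S \<Longrightarrow> pres_cong S R w w"
| sym: "pres_cong S R v w \<Longrightarrow> pres_cong S R w v"
| trans: "pres_cong S R u v \<Longrightarrow> pres_cong S R v w \<Longrightarrow> pres_cong S R u w"
| cancel: "u \<in> words S \<Longrightarrow> v \<in> words S \<Longrightarrow> a \<in> S \<Longrightarrow>
    pres_cong S R (u @ [(a, e), (a, \<not> e)] @ v) (u @ v)"
| relation: "(l, r) \<in> R \<Longrightarrow> l \<in> words S \<Longrightarrow> r \<in> words S \<Longrightarrow> u \<in> words S \<Longrightarrow> v \<in> words S \<Longrightarrow>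
    pres_cong S R (u @ l @ v) (u @ r @ v)"

definition pres_rel :: "'g set \<Rightarrow> ('g word \<times> 'g word) set \<Rightarrow> 'g word rel" where
  "pres_rel S R = {(u, v). pres_cong S R u v}"

definition presented_group :: "'g set \<Rightarrow> ('g word \<times> 'g word) set \<Rightarrow> 'g word set monoid" where
  "presented_group S R =
    \<lparr>carrier = words S // pres_rel S R,
     mult = (\<lambda>X Y. \<Union>u\<in>X. \<Union>v\<in>Y. pres_rel S R `` {u @ v}),
     one = pres_rel S R `` {[]}\<rparr>"

definition pres_gen :: "'g set \<Rightarrow> ('g word \<times> 'g word) set \<Rightarrow> 'g \<Rightarrow> 'g word set" where
  "pres_gen S R a = pres_rel S R `` {[(a, True)]}"

lemma pres_cong_words:
  assumes "pres_cong S R u v" shows "u \<in> words S" "v \<in> words S"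
  using assms by (induction) auto

lemma equiv_pres_rel: "equiv (words S) (pres_rel S R)"
  by (rule equivI)
    (auto simp: pres_rel_def refl_on_def sym_def trans_def
      intro: pres_cong.intros dest: pres_cong_words)

lemma pres_cong_append:
  assumes "pres_cong S R u v" "p \<in> words S" "q \<in> words S"
  shows "pres_cong S R (p @ u @ q) (p @ v @ q)"
  using assms
proof (induction)
  case (refl w)
  then show ?case by (intro pres_cong.refl) simp
next
  case (sym v w)
  then show ?case by (auto intro: pres_cong.sym)
next
  case (trans u v w)
  then show ?case by (blast intro: pres_cong.trans)
next
  case (cancel u v a e)
  then show ?case using pres_cong.cancel[of "p @ u" S "v @ q" a R e] by simp
next
  case (relation l r u v)
  then show ?case using pres_cong.relation[of l r R S "p @ u" "v @ q"] by simp
qed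

lemma pres_cong_append2:
  assumes "pres_cong S R u v" "pres_cong S R u' v'"
  shows "pres_cong S R (u @ u') (v @ v')"
proof -
  have "pres_cong S R (u @ u') (v @ u')"
    using pres_cong_append[OF assms(1), of "[]" u'] pres_cong_words[OF assms(2)] by simp
  moreover have "pres_cong S R (v @ u') (v @ v')"
    using pres_cong_append[OF assms(2), of v "[]"] pres_cong_words[OF assms(1)] by simp
  ultimately show ?thesis by (rule pres_cong.trans)
qed

lemma pres_class_eq_iff:
  assumes "u \<in> words S" "v \<in> words S"
  shows "pres_rel S R `` {u} = pres_rel S R `` {v} \<longleftrightarrow> pres_cong S R u v"
  using eq_equiv_class_iff[OF equiv_pres_rel assms] by (simp add: pres_rel_def)

lemma pres_mult:
  assumes "u \<in> words S" "v \<in> words S"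
  shows "(pres_rel S R `` {u}) \<otimes>\<^bsub>presented_group S R\<^esub> (pres_rel S R `` {v}) = pres_rel S R `` {u @ v}"
proof -
  have "congruent2 (pres_rel S R) (pres_rel S R) (\<lambda>u v. pres_rel S R `` {u @ v})"
  proof (rule congruent2I')
    fix u u' v v' assume "(u, u') \<in> pres_rel S R" "(v, v') \<in> pres_rel S R"
    then have "(u @ v, u' @ v') \<in> pres_rel S R"
      unfolding pres_rel_def by (simp add: pres_cong_append2)
    then show "pres_rel S R `` {u @ v} = pres_rel S R `` {u' @ v'}"
      by (rule equiv_class_eq[OF equiv_pres_rel])
  qed
  from UN_equiv_class2[OF equiv_pres_rel equiv_pres_rel this assms] show ?thesis
    by (simp only: presented_group_def monoid.simps)
qed

lemma carrier_presented_group: "carrier (presented_group S R) = (\<lambda>w. pres_rel S R `` {w}) ` words S"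
  by (auto simp: presented_group_def quotient_def)

lemma one_presented_group: "\<one>\<^bsub>presented_group S R\<^esub> = pres_rel S R `` {[]}"
  by (simp add: presented_group_def)

definition inv_word :: "'g word \<Rightarrow> 'g word" where
  "inv_word w = rev (map (\<lambda>(a, e). (a, \<not> e)) w)"

lemma inv_word_words: "w \<in> words S \<Longrightarrow> inv_word w \<in> words S"
  by (auto simp: inv_word_def)

lemma inv_word_cancel: "w \<in> words S \<Longrightarrow> pres_cong S R (inv_word w @ w) []"
proof (induction w)
  case Nil
  then show ?case by (auto simp: inv_word_def intro: pres_cong.refl)
next
  case (Cons x w)
  obtain a e where x: "x = (a, e)" by (cases x)
  have w: "w \<in> words S" "a \<in> S" using Cons.prems x by auto
  have "inv_word (x # w) @ x # w = inv_word w @ [(a, \<not> e), (a, \<not> \<not> e)] @ w"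
    by (simp add: inv_word_def x)
  moreover have "pres_cong S R (inv_word w @ [(a, \<not> e), (a, \<not> \<not> e)] @ w) (inv_word w @ w)"
    using w by (intro pres_cong.cancel inv_word_words)
  ultimately show ?case using Cons.IH[OF w(1)] by (metis pres_cong.trans)
qed

lemma pres_class_closed: "w \<in> words S \<Longrightarrow> pres_rel S R `` {w} \<in> carrier (presented_group S R)"
  unfolding carrier_presented_group by (rule imageI)

lemma pres_class_cases:
  assumes "x \<in> carrier (presented_group S R)"
  obtains w where "w \<in> words S" "x = pres_rel S R `` {w}"
  using assms unfolding carrier_presented_group by (elim imageE)

lemma group_presented_group: "group (presented_group S R)" (is "group ?G")
proof (rule groupI)
  fix x y assume x: "x \<in> carrier ?G" and y: "y \<in> carrier ?G"
  from x obtain u where u: "u \<in> words S" "x = pres_rel S R `` {u}" by (rule pres_class_cases)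
  from y obtain v where v: "v \<in> words S" "y = pres_rel S R `` {v}" by (rule pres_class_cases)
  show "x \<otimes>\<^bsub>?G\<^esub> y \<in> carrier ?G"
    unfolding u(2) v(2) pres_mult[OF u(1) v(1)] by (rule pres_class_closed) (use u v in simp)
  fix z assume "z \<in> carrier ?G"
  then obtain w where w: "w \<in> words S" "z = pres_rel S R `` {w}" by (rule pres_class_cases)
  have "u @ v \<in> words S" "v @ w \<in> words S" using u v w by simp_all
  then show "x \<otimes>\<^bsub>?G\<^esub> y \<otimes>\<^bsub>?G\<^esub> z = x \<otimes>\<^bsub>?G\<^esub> (y \<otimes>\<^bsub>?G\<^esub> z)"
    unfolding u(2) v(2) w(2) using u(1) v(1) w(1) by (simp only: pres_mult append_assoc)
next
  show "\<one>\<^bsub>?G\<^esub> \<in> carrier ?G"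
    unfolding one_presented_group by (rule pres_class_closed) simp
next
  fix x assume "x \<in> carrier ?G"
  then obtain w where w: "w \<in> words S" "x = pres_rel S R `` {w}" by (rule pres_class_cases)
  have "[] \<in> words S" by simp
  then show "\<one>\<^bsub>?G\<^esub> \<otimes>\<^bsub>?G\<^esub> x = x"
    unfolding w(2) one_presented_group using w(1) by (simp only: pres_mult append_Nil)
next
  fix x assume "x \<in> carrier ?G"
  then obtain w where w: "w \<in> words S" "x = pres_rel S R `` {w}" by (rule pres_class_cases)
  note i = inv_word_words[OF w(1)]
  have "inv_word w @ w \<in> words S" "[] \<in> words S" using w(1) i by simp_all
  then have "pres_rel S R `` {inv_word w} \<otimes>\<^bsub>?G\<^esub> x = \<one>\<^bsub>?G\<^esub>"
    unfolding w(2) one_presented_group pres_mult[OF i w(1)]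
    using inv_word_cancel[OF w(1), of R] by (simp only: pres_class_eq_iff)
  then show "\<exists>y\<in>carrier ?G. y \<otimes>\<^bsub>?G\<^esub> x = \<one>\<^bsub>?G\<^esub>"
    by (intro bexI[of _ "pres_rel S R `` {inv_word w}"] pres_class_closed i)
qed

lemma pres_gen_closed [simp]: "a \<in> S \<Longrightarrow> pres_gen S R a \<in> carrier (presented_group S R)"
  unfolding pres_gen_def by (rule pres_class_closed) simp

primrec word_eval :: "('h, 'm) monoid_scheme \<Rightarrow> ('g \<Rightarrow> 'h) \<Rightarrow> 'g word \<Rightarrow> 'h" where
  "word_eval H f [] = \<one>\<^bsub>H\<^esub>"
| "word_eval H f (x # w) = (if snd x then f (fst x) else inv\<^bsub>H\<^esub> f (fst x)) \<otimes>\<^bsub>H\<^esub> word_eval H f w"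

lemma word_eval_closed:
  assumes "group H" "f \<in> S \<rightarrow> carrier H" "w \<in> words S"
  shows "word_eval H f w \<in> carrier H"
proof -
  interpret H: group H by fact
  show ?thesis using assms(3)
  proof (induction w)
    case (Cons x w)
    obtain a e where x: "x = (a, e)" by (cases x)
    then have "f a \<in> carrier H" using Cons.prems assms(2) by auto
    then show ?case using Cons by (simp add: x)
  qed simp
qed

lemma word_eval_append:
  assumes "group H" "f \<in> S \<rightarrow> carrier H" "v \<in> words S" "w \<in> words S"
  shows "word_eval H f (v @ w) = word_eval H f v \<otimes>\<^bsub>H\<^esub> word_eval H f w"
proof -
  interpret H: group H by fact
  note cl = word_eval_closed[OF assms(1,2)]
  show ?thesis using assms(3)
  proof (induction v)
    case Nil
    then show ?case using cl[OF assms(4)] by simp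
  next
    case (Cons x v)
    obtain a e where x: "x = (a, e)" by (cases x)
    then have "f a \<in> carrier H" "v \<in> words S" using Cons.prems assms(2) by auto
    then show ?case using Cons.IH cl[of v] cl[OF assms(4)] by (simp add: x H.m_assoc)
  qed
qed

lemma word_eval_cong:
  assumes "group H" "f \<in> S \<rightarrow> carrier H"
    and rel: "\<And>l r. (l, r) \<in> R \<Longrightarrow> word_eval H f l = word_eval H f r"
    and "pres_cong S R u v"
  shows "word_eval H f u = word_eval H f v"
proof -
  interpret H: group H by fact
  note ap = word_eval_append[OF assms(1,2)] and cl = word_eval_closed[OF assms(1,2)]
  show ?thesis using assms(4)
  proof (induction)
    case (cancel u v a e)
    then have a: "f a \<in> carrier H" using assms(2) by auto
    have w: "[(a, e), (a, \<not> e)] \<in> words S" using cancel by auto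
    have "word_eval H f [(a, e), (a, \<not> e)] = \<one>\<^bsub>H\<^esub>" using a by simp
    moreover have "word_eval H f (u @ [(a, e), (a, \<not> e)] @ v)
      = word_eval H f u \<otimes>\<^bsub>H\<^esub> (word_eval H f [(a, e), (a, \<not> e)] \<otimes>\<^bsub>H\<^esub> word_eval H f v)"
      using cancel w ap[of u "[(a, e), (a, \<not> e)] @ v"] ap[of "[(a, e), (a, \<not> e)]" v] by simp
    ultimately show ?case using cancel cl by (simp add: ap)
  next
    case (relation l r u v)
    then show ?case using rel[of l r] by (simp add: ap)
  qed auto
qed

text \<open>The universal property of a presented group.\<close>

lemma pres_hom_exists:
  assumes "group H" "f \<in> S \<rightarrow> carrier H"
    and "\<And>l r. (l, r) \<in> R \<Longrightarrow> word_eval H f l = word_eval H f r"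
  shows "\<exists>h \<in> hom (presented_group S R) H. \<forall>a\<in>S. h (pres_gen S R a) = f a"
proof -
  interpret H: group H by fact
  define h where "h X = word_eval H f (SOME w. w \<in> X)" for X
  have h: "h (pres_rel S R `` {w}) = word_eval H f w" if "w \<in> words S" for w
  proof -
    have "w \<in> pres_rel S R `` {w}" using that by (auto simp: pres_rel_def intro: pres_cong.refl)
    then have "(SOME v. v \<in> pres_rel S R `` {w}) \<in> pres_rel S R `` {w}" by (rule someI)
    then have "pres_cong S R w (SOME v. v \<in> pres_rel S R `` {w})" by (simp add: pres_rel_def)
    from word_eval_cong[OF assms this] show ?thesis by (simp add: h_def)
  qed
  have "h \<in> hom (presented_group S R) H"
    unfolding hom_def carrier_presented_group
    using word_eval_closed[OF assms(1,2)] word_eval_append[OF assms(1,2)]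
    by (auto simp: h pres_mult)
  moreover have "h (pres_gen S R a) = f a" if "a \<in> S" for a
  proof -
    have "f a \<in> carrier H" using that assms(2) by auto
    then show ?thesis using that h[of "[(a, True)]"] by (simp add: pres_gen_def)
  qed
  ultimately show ?thesis by blast
qed

lemma pres_induct [consumes 1, case_names one gen inv mult]:
  assumes "x \<in> carrier (presented_group S R)"
    and "P \<one>\<^bsub>presented_group S R\<^esub>"
    and "\<And>a. a \<in> S \<Longrightarrow> P (pres_gen S R a)"
    and "\<And>x. x \<in> carrier (presented_group S R) \<Longrightarrow> P x \<Longrightarrow> P (inv\<^bsub>presented_group S R\<^esub> x)"
    and "\<And>x y. x \<in> carrier (presented_group S R) \<Longrightarrow> y \<in> carrier (presented_group S R) \<Longrightarrow>
      P x \<Longrightarrow> P y \<Longrightarrow> P (x \<otimes>\<^bsub>presented_group S R\<^esub> y)"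
  shows "P x"
proof -
  interpret G: group "presented_group S R" by (rule group_presented_group)
  have "P (pres_rel S R `` {w})" if "w \<in> words S" for w
    using that
  proof (induction w)
    case Nil
    then show ?case using assms(2) by (simp add: one_presented_group)
  next
    case (Cons x w)
    obtain a e where x: "x = (a, e)" by (cases x)
    have w: "w \<in> words S" "a \<in> S" using Cons.prems x by auto
    have inv: "pres_rel S R `` {[(a, False)]} = inv\<^bsub>presented_group S R\<^esub> pres_gen S R a"
    proof (rule G.inv_equality[symmetric])
      have "pres_cong S R ([] @ [(a, False), (a, \<not> False)] @ []) ([] @ [])"
        using w by (intro pres_cong.cancel) auto
      then show "pres_rel S R `` {[(a, False)]} \<otimes>\<^bsub>presented_group S R\<^esub> pres_gen S R a
          = \<one>\<^bsub>presented_group S R\<^esub>"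
        using w by (simp add: pres_gen_def pres_mult one_presented_group pres_class_eq_iff)
    qed (use w in \<open>auto simp: carrier_presented_group pres_gen_def\<close>)
    have l: "P (pres_rel S R `` {[x]})" "pres_rel S R `` {[x]} \<in> carrier (presented_group S R)"
      using assms(3)[OF w(2)] assms(4)[of "pres_gen S R a"] inv w
      by (cases e; auto simp: x pres_gen_def carrier_presented_group)+
    have "pres_rel S R `` {x # w}
        = (pres_rel S R `` {[x]}) \<otimes>\<^bsub>presented_group S R\<^esub> (pres_rel S R `` {w})"
      using w by (subst pres_mult) (auto simp: x)
    then show ?case using assms(5)[OF l(2) _ l(1)] w Cons.IH by (auto simp: carrier_presented_group)
  qed
  then show ?thesis using assms(1) by (auto simp: carrier_presented_group)
qed

lemma pres_hom_unique:
  assumes "group H" "h \<in> hom (presented_group S R) H" "h' \<in> hom (presented_group S R) H"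
    and "\<And>a. a \<in> S \<Longrightarrow> h (pres_gen S R a) = h' (pres_gen S R a)"
    and "x \<in> carrier (presented_group S R)"
  shows "h x = h' x"
proof -
  interpret G: group "presented_group S R" by (rule group_presented_group)
  interpret H: group H by fact
  interpret h: group_hom "presented_group S R" H h by (standard) fact
  interpret h': group_hom "presented_group S R" H h' by (standard) fact
  show ?thesis using assms(5)
  proof (induction x rule: pres_induct)
    case (gen a)
    then show ?case by (rule assms(4))
  next
    case (inv x)
    then show ?case by (simp only: h.hom_inv h'.hom_inv)
  next
    case (mult x y)
    then show ?case by (simp only: h.hom_mult h'.hom_mult)
  qed (simp only: h.hom_one h'.hom_one)
qed


section \<open>The group \<open>F\<^sub>n \<rtimes> B\<^sub>n\<close>\<close>

definition free_group :: "nat \<Rightarrow> nat word set monoid" where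
  "free_group n = presented_group {1..n} {}"

definition free_gen :: "nat \<Rightarrow> nat \<Rightarrow> nat word set" where
  "free_gen n j = pres_gen {1..n} {} j"

definition braid_relations :: "nat \<Rightarrow> (nat word \<times> nat word) set" where
  "braid_relations n =
    {([(i, True), (Suc i, True), (i, True)], [(Suc i, True), (i, True), (Suc i, True)]) | i.
      1 \<le> i \<and> Suc i < n} \<union>
    {([(i, True), (j, True)], [(j, True), (i, True)]) | i j. 1 \<le> i \<and> Suc i < j \<and> j < n}"

definition braid_group :: "nat \<Rightarrow> nat word set monoid" where
  "braid_group n = presented_group {1..<n} (braid_relations n)"

definition braid_gen :: "nat \<Rightarrow> nat \<Rightarrow> nat word set" where
  "braid_gen n i = pres_gen {1..<n} (braid_relations n) i"

definition artin_image :: "nat \<Rightarrow> nat \<Rightarrow> nat \<Rightarrow> nat word set" where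
  "artin_image n i j =
    (if j = i then free_gen n (Suc i)
     else if j = Suc i then inv\<^bsub>free_group n\<^esub> free_gen n (Suc i) \<otimes>\<^bsub>free_group n\<^esub> free_gen n i
            \<otimes>\<^bsub>free_group n\<^esub> free_gen n (Suc i)
     else free_gen n j)"

definition artin_action :: "nat \<Rightarrow> nat word set \<Rightarrow> nat word set \<Rightarrow> nat word set" where
  "artin_action n = (THE \<theta>. \<theta> \<in> hom (braid_group n) (AutoGroup (free_group n)) \<and>
     \<theta> \<in> extensional (carrier (braid_group n)) \<and>
     (\<forall>i\<in>{1..<n}. \<forall>j\<in>{1..n}. \<theta> (braid_gen n i) (free_gen n j) = artin_image n i j))"

definition semidirect_product ::
  "('a, 'm) monoid_scheme \<Rightarrow> ('b, 'p) monoid_scheme \<Rightarrow> ('b \<Rightarrow> 'a \<Rightarrow> 'a) \<Rightarrow> ('a \<times> 'b) monoid" where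
  "semidirect_product G H \<phi> =
    \<lparr>carrier = carrier G \<times> carrier H,
     mult = (\<lambda>(a, b) (c, d). (a \<otimes>\<^bsub>G\<^esub> \<phi> b c, b \<otimes>\<^bsub>H\<^esub> d)),
     one = (\<one>\<^bsub>G\<^esub>, \<one>\<^bsub>H\<^esub>)\<rparr>"

definition free_braid_group :: "nat \<Rightarrow> (nat word set \<times> nat word set) monoid" where
  "free_braid_group n = semidirect_product (free_group n) (braid_group n) (artin_action n)"

definition gen_x :: "nat \<Rightarrow> nat \<Rightarrow> nat word set \<times> nat word set" where
  "gen_x n j = (free_gen n j, \<one>\<^bsub>braid_group n\<^esub>)"

definition gen_\<sigma> :: "nat \<Rightarrow> nat \<Rightarrow> nat word set \<times> nat word set" where
  "gen_\<sigma> n i = (\<one>\<^bsub>free_group n\<^esub>, braid_gen n i)"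

lemma group_free_group: "group (free_group n)"
  and group_braid_group: "group (braid_group n)"
  unfolding free_group_def braid_group_def by (rule group_presented_group)+

lemma free_gen_closed: "j \<in> {1..n} \<Longrightarrow> free_gen n j \<in> carrier (free_group n)"
  unfolding free_group_def free_gen_def by (rule pres_gen_closed)

lemma braid_gen_closed: "i \<in> {1..<n} \<Longrightarrow> braid_gen n i \<in> carrier (braid_group n)"
  unfolding braid_group_def braid_gen_def by (rule pres_gen_closed)

lemma artin_image_closed:
  assumes "i \<in> {1..<n}" "j \<in> {1..n}" shows "artin_image n i j \<in> carrier (free_group n)"
proof -
  interpret F: group "free_group n" by (rule group_free_group)
  have "free_gen n i \<in> carrier (free_group n)" "free_gen n (Suc i) \<in> carrier (free_group n)"
    "free_gen n j \<in> carrier (free_group n)"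
    using assms by (intro free_gen_closed; simp)+
  then show ?thesis unfolding artin_image_def by simp
qed

lemma free_group_hom_exists:
  assumes "group H" "\<And>j. j \<in> {1..n} \<Longrightarrow> f j \<in> carrier H"
  shows "\<exists>h \<in> hom (free_group n) H. \<forall>j\<in>{1..n}. h (free_gen n j) = f j"
  unfolding free_group_def free_gen_def using assms by (intro pres_hom_exists) auto

lemma free_group_hom_unique:
  assumes "group H" "h \<in> hom (free_group n) H" "h' \<in> hom (free_group n) H"
    and "\<And>j. j \<in> {1..n} \<Longrightarrow> h (free_gen n j) = h' (free_gen n j)" "x \<in> carrier (free_group n)"
  shows "h x = h' x"
  using assms unfolding free_group_def free_gen_def by (rule pres_hom_unique)

lemma braid_group_hom_unique:
  assumes "group H" "h \<in> hom (braid_group n) H" "h' \<in> hom (braid_group n) H"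
    and "\<And>i. i \<in> {1..<n} \<Longrightarrow> h (braid_gen n i) = h' (braid_gen n i)" "x \<in> carrier (braid_group n)"
  shows "h x = h' x"
  using assms unfolding braid_group_def braid_gen_def by (rule pres_hom_unique)

lemma braid_group_induct [consumes 1, case_names one gen inv mult]:
  assumes "x \<in> carrier (braid_group n)"
    and "P \<one>\<^bsub>braid_group n\<^esub>"
    and "\<And>i. i \<in> {1..<n} \<Longrightarrow> P (braid_gen n i)"
    and "\<And>x. x \<in> carrier (braid_group n) \<Longrightarrow> P x \<Longrightarrow> P (inv\<^bsub>braid_group n\<^esub> x)"
    and "\<And>x y. x \<in> carrier (braid_group n) \<Longrightarrow> y \<in> carrier (braid_group n) \<Longrightarrow>
      P x \<Longrightarrow> P y \<Longrightarrow> P (x \<otimes>\<^bsub>braid_group n\<^esub> y)"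
  shows "P x"
  using assms unfolding braid_group_def braid_gen_def by (rule pres_induct)

lemma (in group) inv_cancel_assoc:
  "x \<in> carrier G \<Longrightarrow> y \<in> carrier G \<Longrightarrow> x \<otimes> (inv x \<otimes> y) = y"
  "x \<in> carrier G \<Longrightarrow> y \<in> carrier G \<Longrightarrow> inv x \<otimes> (x \<otimes> y) = y"
  by (simp_all add: m_assoc[symmetric])

lemma artin_aut_exists:
  assumes i: "i \<in> {1..<n}"
  shows "\<exists>a \<in> auto (free_group n). \<forall>j\<in>{1..n}. a (free_gen n j) = artin_image n i j"
proof -
  let ?F = "free_group n" and ?x = "free_gen n"
  interpret F: group ?F by (rule group_free_group)
  note x = free_gen_closed[of _ n]
  have xi: "?x i \<in> carrier ?F" "?x (Suc i) \<in> carrier ?F" using i by (intro x; simp)+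
  have "\<exists>h\<in>hom ?F ?F. \<forall>j\<in>{1..n}. h (?x j) = artin_image n i j"
    using group_free_group artin_image_closed[OF i] by (rule free_group_hom_exists)
  then obtain h where h: "h \<in> hom ?F ?F" and "\<forall>j\<in>{1..n}. h (?x j) = artin_image n i j" ..
  then have hx: "h (?x j) = artin_image n i j" if "j \<in> {1..n}" for j using that by (rule_tac bspec)
  define f where "f j = (if j = i then ?x i \<otimes>\<^bsub>?F\<^esub> ?x (Suc i) \<otimes>\<^bsub>?F\<^esub> inv\<^bsub>?F\<^esub> ?x i
    else if j = Suc i then ?x i else ?x j)" for j
  have fc: "f j \<in> carrier ?F" if "j \<in> {1..n}" for j using xi x[OF that] by (simp add: f_def)
  have "\<exists>h\<in>hom ?F ?F. \<forall>j\<in>{1..n}. h (?x j) = f j"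
    using group_free_group fc by (rule free_group_hom_exists)
  then obtain h' where h': "h' \<in> hom ?F ?F" and "\<forall>j\<in>{1..n}. h' (?x j) = f j" ..
  then have hx': "h' (?x j) = f j" if "j \<in> {1..n}" for j using that by (rule_tac bspec)
  interpret h: group_hom ?F ?F h by standard (rule h)
  interpret h': group_hom ?F ?F h' by standard (rule h')
  have i': "i \<in> {1..n}" "Suc i \<in> {1..n}" using i by auto
  have hi: "h (?x i) = ?x (Suc i)"
    "h (?x (Suc i)) = inv\<^bsub>?F\<^esub> ?x (Suc i) \<otimes>\<^bsub>?F\<^esub> ?x i \<otimes>\<^bsub>?F\<^esub> ?x (Suc i)"
    "h' (?x i) = ?x i \<otimes>\<^bsub>?F\<^esub> ?x (Suc i) \<otimes>\<^bsub>?F\<^esub> inv\<^bsub>?F\<^esub> ?x i" "h' (?x (Suc i)) = ?x i"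
    using hx[OF i'(1)] hx[OF i'(2)] hx'[OF i'(1)] hx'[OF i'(2)]
    by (simp_all add: artin_image_def f_def)
  have hj: "h (?x j) = ?x j" "h' (?x j) = ?x j" if "j \<in> {1..n}" "j \<noteq> i" "j \<noteq> Suc i" for j
    using hx[OF that(1)] hx'[OF that(1)] that(2,3) by (simp_all add: artin_image_def f_def)
  have idh: "(\<lambda>x. x) \<in> hom ?F ?F" by (simp add: hom_def)
  have c: "(\<lambda>x. h (h' x)) \<in> hom ?F ?F" "(\<lambda>x. h' (h x)) \<in> hom ?F ?F" by (auto simp: hom_def)
  have inv_r: "h (h' x) = x" if "x \<in> carrier ?F" for x
  proof (rule free_group_hom_unique[where h = "\<lambda>x. h (h' x)" and h' = "\<lambda>x. x", OF group_free_group c(1) idh _ that])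
    fix j assume j: "j \<in> {1..n}"
    show "h (h' (?x j)) = ?x j"
      by (cases "j = i"; cases "j = Suc i") (use xi in \<open>simp_all add: hi hj[OF j] F.m_assoc F.inv_cancel_assoc\<close>)
  qed
  have inv_l: "h' (h x) = x" if "x \<in> carrier ?F" for x
  proof (rule free_group_hom_unique[OF group_free_group c(2) idh _ that])
    fix j assume j: "j \<in> {1..n}"
    show "h' (h (?x j)) = ?x j"
      by (cases "j = i"; cases "j = Suc i") (use xi in \<open>simp_all add: hi hj[OF j] F.m_assoc F.inv_mult_group F.inv_cancel_assoc\<close>)
  qed
  have "bij_betw h (carrier ?F) (carrier ?F)"
    by (rule bij_betw_byWitness[where f' = h']) (use inv_r inv_l in auto)
  then have "restrict h (carrier ?F) \<in> Bij (carrier ?F)"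
    by (simp add: Bij_def bij_betw_restrict_eq)
  moreover have "restrict h (carrier ?F) \<in> hom ?F ?F" using h by (auto simp: hom_def)
  moreover have "\<forall>j\<in>{1..n}. restrict h (carrier ?F) (?x j) = artin_image n i j"
    using hx x by simp
  ultimately show ?thesis
    unfolding auto_def by (intro bexI[of _ "restrict h (carrier ?F)"] IntI)
qed

lemma AutoGroup_mult:
  "g \<in> auto G \<Longrightarrow> f \<in> auto G \<Longrightarrow> g \<otimes>\<^bsub>AutoGroup G\<^esub> f = compose (carrier G) g f"
  by (simp add: AutoGroup_def BijGroup_def auto_def)

lemma AutoGroup_carrier: "carrier (AutoGroup G) = auto G"
  by (simp add: AutoGroup_def)

lemma auto_free_group_eqI:
  assumes "a \<in> auto (free_group n)" "b \<in> auto (free_group n)"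
    and "\<And>j. j \<in> {1..n} \<Longrightarrow> a (free_gen n j) = b (free_gen n j)"
  shows "a = b"
proof (rule extensionalityI)
  show "a \<in> extensional (carrier (free_group n))" "b \<in> extensional (carrier (free_group n))"
    using assms(1,2) by (auto simp: auto_def Bij_def)
  show "a x = b x" if "x \<in> carrier (free_group n)" for x
  proof (rule free_group_hom_unique[where h = a and h' = b and n = n])
    show "a \<in> hom (free_group n) (free_group n)" "b \<in> hom (free_group n) (free_group n)"
      using assms(1,2) by (simp_all add: auto_def)
  qed (use assms(3) that group_free_group in simp_all)
qed

lemma braid_relations_cases:
  assumes "(l, r) \<in> braid_relations n"
  obtains (braid) i where "1 \<le> i" "Suc i < n" "l = [(i, True), (Suc i, True), (i, True)]"
      "r = [(Suc i, True), (i, True), (Suc i, True)]"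
    | (comm) i j where "1 \<le> i" "Suc i < j" "j < n" "l = [(i, True), (j, True)]"
      "r = [(j, True), (i, True)]"
proof -
  have "(\<exists>i. 1 \<le> i \<and> Suc i < n \<and> l = [(i, True), (Suc i, True), (i, True)] \<and>
      r = [(Suc i, True), (i, True), (Suc i, True)]) \<or>
    (\<exists>i j. 1 \<le> i \<and> Suc i < j \<and> j < n \<and> l = [(i, True), (j, True)] \<and> r = [(j, True), (i, True)])"
    using assms unfolding braid_relations_def by auto
  then show thesis by (elim disjE exE conjE) (rule braid comm; assumption)+
qed

lemma artin_action_ex1:
  "\<exists>!\<theta>. \<theta> \<in> hom (braid_group n) (AutoGroup (free_group n)) \<and>
     \<theta> \<in> extensional (carrier (braid_group n)) \<and>
     (\<forall>i\<in>{1..<n}. \<forall>j\<in>{1..n}. \<theta> (braid_gen n i) (free_gen n j) = artin_image n i j)"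
proof -
  let ?F = "free_group n" and ?x = "free_gen n" and ?B = "braid_group n"
  interpret F: group ?F by (rule group_free_group)
  interpret A: group "AutoGroup ?F" by (rule F.AutoGroup)
  note x = free_gen_closed[of _ n]
  have "\<forall>i\<in>{1..<n}. \<exists>a. a \<in> auto ?F \<and> (\<forall>j\<in>{1..n}. a (?x j) = artin_image n i j)"
    using artin_aut_exists by blast
  then obtain a where a: "\<And>i. i \<in> {1..<n} \<Longrightarrow> a i \<in> auto ?F"
    "\<And>i j. i \<in> {1..<n} \<Longrightarrow> j \<in> {1..n} \<Longrightarrow> a i (?x j) = artin_image n i j"
    by metis
  have ah: "group_hom ?F ?F (a i)" if "i \<in> {1..<n}" for i
    using a(1)[OF that] by unfold_locales (simp add: auto_def)
  note cl = x artin_image_closed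
  have comp: "compose (carrier ?F) f g \<in> auto ?F" if "f \<in> auto ?F" "g \<in> auto ?F" for f g
    using A.m_closed[of f g] that by (simp add: AutoGroup_mult AutoGroup_carrier)
  have eval2: "word_eval (AutoGroup ?F) a [(i, True), (j, True)] = compose (carrier ?F) (a i) (a j)"
    if "i \<in> {1..<n}" "j \<in> {1..<n}" for i j
    using a(1)[OF that(1)] a(1)[OF that(2)]
    by (simp add: AutoGroup_mult flip: AutoGroup_carrier)
  have eval3: "word_eval (AutoGroup ?F) a [(i, True), (j, True), (k, True)]
      = compose (carrier ?F) (a i) (compose (carrier ?F) (a j) (a k))"
    if "i \<in> {1..<n}" "j \<in> {1..<n}" "k \<in> {1..<n}" for i j k
  proof -
    have "word_eval (AutoGroup ?F) a [(i, True), (j, True), (k, True)]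
      = a i \<otimes>\<^bsub>AutoGroup ?F\<^esub> word_eval (AutoGroup ?F) a [(j, True), (k, True)]" by simp
    then show ?thesis unfolding eval2[OF that(2,3)] using a(1) that
      by (simp add: AutoGroup_mult comp)
  qed
  have rel: "word_eval (AutoGroup ?F) a l = word_eval (AutoGroup ?F) a r" if "(l, r) \<in> braid_relations n" for l r
  proof -
    from that show ?thesis
    proof (cases rule: braid_relations_cases)
      case (braid i)
      then have i: "i \<in> {1..<n}" "Suc i \<in> {1..<n}" by auto
      interpret a: group_hom ?F ?F "a i" by (rule ah[OF i(1)])
      interpret b: group_hom ?F ?F "a (Suc i)" by (rule ah[OF i(2)])
      have j: "i \<in> {1..n}" "Suc i \<in> {1..n}" "Suc (Suc i) \<in> {1..n}" using braid by auto
      note xs = x[OF j(1)] x[OF j(2)] x[OF j(3)]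
      note vals = a(2)[OF i(1) j(1)] a(2)[OF i(1) j(2)] a(2)[OF i(1) j(3)]
        a(2)[OF i(2) j(1)] a(2)[OF i(2) j(2)] a(2)[OF i(2) j(3)]
      have "compose (carrier ?F) (a i) (compose (carrier ?F) (a (Suc i)) (a i))
          = compose (carrier ?F) (a (Suc i)) (compose (carrier ?F) (a i) (a (Suc i)))"
      proof (rule auto_free_group_eqI)
        fix k assume k: "k \<in> {1..n}"
        consider "k = i" | "k = Suc i" | "k = Suc (Suc i)" | "k \<noteq> i" "k \<noteq> Suc i" "k \<noteq> Suc (Suc i)" by blast
        then have "a i (a (Suc i) (a i (?x k))) = a (Suc i) (a i (a (Suc i) (?x k)))"
        proof cases
          case 4
          then show ?thesis using a(2)[OF i(1) k] a(2)[OF i(2) k] by (simp add: artin_image_def)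
        qed (use vals xs in \<open>simp_all add: artin_image_def F.m_assoc F.inv_mult_group F.inv_cancel_assoc\<close>)
        then show "compose (carrier ?F) (a i) (compose (carrier ?F) (a (Suc i)) (a i)) (?x k)
          = compose (carrier ?F) (a (Suc i)) (compose (carrier ?F) (a i) (a (Suc i))) (?x k)"
          using x[OF k] by (simp add: compose_def)
      qed (use a(1) i in \<open>simp_all add: comp\<close>)
      then show ?thesis using braid eval3 i by simp
    next
      case (comm i j)
      then have i: "i \<in> {1..<n}" "j \<in> {1..<n}" by auto
      interpret a: group_hom ?F ?F "a i" by (rule ah[OF i(1)])
      interpret b: group_hom ?F ?F "a j" by (rule ah[OF i(2)])
      have m: "i \<in> {1..n}" "Suc i \<in> {1..n}" "j \<in> {1..n}" "Suc j \<in> {1..n}" using comm by auto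
      note xs = x[OF m(1)] x[OF m(2)] x[OF m(3)] x[OF m(4)]
      note vals = a(2)[OF i(1) m(1)] a(2)[OF i(1) m(2)] a(2)[OF i(1) m(3)] a(2)[OF i(1) m(4)]
        a(2)[OF i(2) m(1)] a(2)[OF i(2) m(2)] a(2)[OF i(2) m(3)] a(2)[OF i(2) m(4)]
      have "compose (carrier ?F) (a i) (a j) = compose (carrier ?F) (a j) (a i)"
      proof (rule auto_free_group_eqI)
        fix k assume k: "k \<in> {1..n}"
        consider "k = i" | "k = Suc i" | "k = j" | "k = Suc j" | "k \<noteq> i" "k \<noteq> Suc i" "k \<noteq> j" "k \<noteq> Suc j" by blast
        then have "a i (a j (?x k)) = a j (a i (?x k))"
        proof cases
          case 5
          then show ?thesis using a(2)[OF i(1) k] a(2)[OF i(2) k] by (simp add: artin_image_def)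
        qed (use vals xs comm in \<open>simp_all add: artin_image_def\<close>)
        then show "compose (carrier ?F) (a i) (a j) (?x k) = compose (carrier ?F) (a j) (a i) (?x k)"
          using x[OF k] by (simp add: compose_def)
      qed (use a(1) i in \<open>simp_all add: comp\<close>)
      then show ?thesis using comm eval2 i by simp
    qed
  qed
  have "\<exists>\<theta>\<in>hom ?B (AutoGroup ?F). \<forall>i\<in>{1..<n}. \<theta> (braid_gen n i) = a i"
    unfolding braid_group_def braid_gen_def
    using rel a(1) by (intro pres_hom_exists A.is_group) (auto simp: AutoGroup_carrier)
  then obtain \<theta> where \<theta>: "\<theta> \<in> hom ?B (AutoGroup ?F)" "\<And>i. i \<in> {1..<n} \<Longrightarrow> \<theta> (braid_gen n i) = a i" by blast
  show ?thesis
  proof (rule ex1I[of _ "restrict \<theta> (carrier ?B)"], intro conjI)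
    interpret B: group ?B by (rule group_braid_group)
    show "restrict \<theta> (carrier ?B) \<in> hom ?B (AutoGroup ?F)" using \<theta>(1) by (auto simp: hom_def)
    show "\<forall>i\<in>{1..<n}. \<forall>j\<in>{1..n}. restrict \<theta> (carrier ?B) (braid_gen n i) (?x j) = artin_image n i j"
      using \<theta>(2) a(2) by (simp add: braid_gen_closed)
  next
    fix \<eta> assume \<eta>: "\<eta> \<in> hom ?B (AutoGroup ?F) \<and> \<eta> \<in> extensional (carrier ?B) \<and>
      (\<forall>i\<in>{1..<n}. \<forall>j\<in>{1..n}. \<eta> (braid_gen n i) (?x j) = artin_image n i j)"
    show "\<eta> = restrict \<theta> (carrier ?B)"
    proof (rule extensionalityI[of _ "carrier ?B"])
      fix b assume b: "b \<in> carrier ?B"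
      have "\<eta> b = \<theta> b"
      proof (rule braid_group_hom_unique[where h = \<eta> and h' = \<theta>, OF A.is_group])
        fix i assume i: "i \<in> {1..<n}"
        have "\<eta> (braid_gen n i) \<in> auto ?F"
          using \<eta> braid_gen_closed[OF i] by (auto simp: hom_def AutoGroup_carrier)
        then show "\<eta> (braid_gen n i) = \<theta> (braid_gen n i)"
          using a \<theta>(2) \<eta> i by (intro auto_free_group_eqI) auto
      qed (use \<eta> \<theta> b in auto)
      then show "\<eta> b = restrict \<theta> (carrier ?B) b" using b by simp
    qed (use \<eta> in auto)
  qed simp
qed

lemma artin_action:
  "artin_action n \<in> hom (braid_group n) (AutoGroup (free_group n))"
  "i \<in> {1..<n} \<Longrightarrow> j \<in> {1..n} \<Longrightarrow> artin_action n (braid_gen n i) (free_gen n j) = artin_image n i j"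
  using theI'[OF artin_action_ex1[of n]] unfolding artin_action_def by blast+


lemma AutoGroup_apply:
  "g \<in> auto G \<Longrightarrow> f \<in> auto G \<Longrightarrow> x \<in> carrier G \<Longrightarrow> (g \<otimes>\<^bsub>AutoGroup G\<^esub> f) x = g (f x)"
  by (simp add: AutoGroup_mult compose_def)

lemma auto_closed: "f \<in> auto G \<Longrightarrow> x \<in> carrier G \<Longrightarrow> f x \<in> carrier G"
  by (auto simp: auto_def hom_def)

lemma group_semidirect_product:
  assumes "group G" "group H" "\<phi> \<in> hom H (AutoGroup G)"
  shows "group (semidirect_product G H \<phi>)"
proof -
  interpret G: group G by fact
  interpret H: group H by fact
  interpret A: group "AutoGroup G" by (rule G.AutoGroup)
  interpret \<phi>: group_hom H "AutoGroup G" \<phi> by standard fact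
  note \<phi>.hom_inv [simp del] \<phi>.hom_mult [simp del] \<phi>.hom_one [simp del]
  have au: "\<phi> b \<in> auto G" if "b \<in> carrier H" for b
    using \<phi>.hom_closed[OF that] by (simp add: AutoGroup_carrier)
  note cl = auto_closed[OF au]
  have m: "\<phi> b (x \<otimes>\<^bsub>G\<^esub> y) = \<phi> b x \<otimes>\<^bsub>G\<^esub> \<phi> b y"
    if "b \<in> carrier H" "x \<in> carrier G" "y \<in> carrier G" for b x y
    using au[OF that(1)] that by (simp add: auto_def hom_def)
  have c: "\<phi> (b \<otimes>\<^bsub>H\<^esub> d) x = \<phi> b (\<phi> d x)"
    if "b \<in> carrier H" "d \<in> carrier H" "x \<in> carrier G" for b d x
    using that au by (simp add: \<phi>.hom_mult AutoGroup_apply)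
  have one: "\<phi> \<one>\<^bsub>H\<^esub> x = x" if "x \<in> carrier G" for x
    using that \<phi>.hom_one by (simp add: AutoGroup_def BijGroup_def)
  show ?thesis
  proof (rule groupI)
    fix x assume x: "x \<in> carrier (semidirect_product G H \<phi>)"
    then obtain a b where [simp]: "x = (a, b)" and ab: "a \<in> carrier G" "b \<in> carrier H"
      by (auto simp: semidirect_product_def)
    let ?y = "(inv\<^bsub>G\<^esub> \<phi> (inv\<^bsub>H\<^esub> b) a, inv\<^bsub>H\<^esub> b)"
    have "?y \<in> carrier (semidirect_product G H \<phi>)"
      using ab cl by (simp add: semidirect_product_def)
    moreover have "?y \<otimes>\<^bsub>semidirect_product G H \<phi>\<^esub> x = \<one>\<^bsub>semidirect_product G H \<phi>\<^esub>"
      using ab cl by (simp add: semidirect_product_def)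
    ultimately show "\<exists>y\<in>carrier (semidirect_product G H \<phi>).
        y \<otimes>\<^bsub>semidirect_product G H \<phi>\<^esub> x = \<one>\<^bsub>semidirect_product G H \<phi>\<^esub>"
      by (intro bexI[of _ ?y])
  qed (auto simp: semidirect_product_def cl m c one G.m_assoc H.m_assoc)
qed

lemma group_free_braid_group: "group (free_braid_group n)"
  unfolding free_braid_group_def
  by (intro group_semidirect_product group_free_group group_braid_group artin_action)

text \<open>The universal property of \<open>F\<^sub>n \<rtimes> B\<^sub>n\<close>.\<close>

lemma free_braid_hom_exists:
  assumes "group H"
    and X: "\<And>j. j \<in> {1..n} \<Longrightarrow> X j \<in> carrier H"
    and S: "\<And>i. i \<in> {1..<n} \<Longrightarrow> S i \<in> carrier H"
    and braid: "\<And>i. 1 \<le> i \<Longrightarrow> Suc i < n \<Longrightarrow>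
      S i \<otimes>\<^bsub>H\<^esub> (S (Suc i) \<otimes>\<^bsub>H\<^esub> S i) = S (Suc i) \<otimes>\<^bsub>H\<^esub> (S i \<otimes>\<^bsub>H\<^esub> S (Suc i))"
    and comm: "\<And>i j. 1 \<le> i \<Longrightarrow> Suc i < j \<Longrightarrow> j < n \<Longrightarrow> S i \<otimes>\<^bsub>H\<^esub> S j = S j \<otimes>\<^bsub>H\<^esub> S i"
    and SX1: "\<And>i. i \<in> {1..<n} \<Longrightarrow> S i \<otimes>\<^bsub>H\<^esub> X i = X (Suc i) \<otimes>\<^bsub>H\<^esub> S i"
    and SX2: "\<And>i. i \<in> {1..<n} \<Longrightarrow>
      X (Suc i) \<otimes>\<^bsub>H\<^esub> (S i \<otimes>\<^bsub>H\<^esub> X (Suc i)) = X i \<otimes>\<^bsub>H\<^esub> (X (Suc i) \<otimes>\<^bsub>H\<^esub> S i)"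
    and SX3: "\<And>i j. i \<in> {1..<n} \<Longrightarrow> j \<in> {1..n} \<Longrightarrow> j \<noteq> i \<Longrightarrow> j \<noteq> Suc i \<Longrightarrow>
      S i \<otimes>\<^bsub>H\<^esub> X j = X j \<otimes>\<^bsub>H\<^esub> S i"
  shows "\<exists>R \<in> hom (free_braid_group n) H.
    (\<forall>j\<in>{1..n}. R (gen_x n j) = X j) \<and> (\<forall>i\<in>{1..<n}. R (gen_\<sigma> n i) = S i)"
proof -
  let ?F = "free_group n" and ?B = "braid_group n" and ?\<theta> = "artin_action n"
  interpret H: group H by fact
  interpret F: group ?F by (rule group_free_group)
  interpret B: group ?B by (rule group_braid_group)
  interpret A: group "AutoGroup ?F" by (rule F.AutoGroup)
  interpret \<theta>: group_hom ?B "AutoGroup ?F" ?\<theta> by standard (rule artin_action)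
  note \<theta>.hom_inv [simp del] \<theta>.hom_mult [simp del] \<theta>.hom_one [simp del]
  have "\<exists>h\<in>hom ?F H. \<forall>j\<in>{1..n}. h (free_gen n j) = X j"
    using H.is_group X by (rule free_group_hom_exists)
  then obtain f where f: "f \<in> hom ?F H" and "\<forall>j\<in>{1..n}. f (free_gen n j) = X j" ..
  then have fx: "f (free_gen n j) = X j" if "j \<in> {1..n}" for j using that by (rule_tac bspec)
  have ev: "word_eval H S l = word_eval H S r" if "(l, r) \<in> braid_relations n" for l r
    using that
  proof (cases rule: braid_relations_cases)
    case (braid i)
    then show ?thesis using assms(4)[of i] S[of i] S[of "Suc i"] by simp
  next
    case (comm i j)
    then show ?thesis using assms(5)[of i j] S[of i] S[of j] by simp
  qed
  have "\<exists>h\<in>hom ?B H. \<forall>i\<in>{1..<n}. h (braid_gen n i) = S i"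
    unfolding braid_group_def braid_gen_def
    using ev S by (intro pres_hom_exists H.is_group) auto
  then obtain g where g: "g \<in> hom ?B H" and "\<forall>i\<in>{1..<n}. g (braid_gen n i) = S i" ..
  then have gs: "g (braid_gen n i) = S i" if "i \<in> {1..<n}" for i using that by (rule_tac bspec)
  interpret f: group_hom ?F H f by standard fact
  interpret g: group_hom ?B H g by standard fact
  have au: "?\<theta> b \<in> auto ?F" if "b \<in> carrier ?B" for b
    using \<theta>.hom_closed[OF that] by (simp add: AutoGroup_carrier)
  note cl = auto_closed[OF au]
  have key: "\<forall>a\<in>carrier ?F. f (?\<theta> b a) = g b \<otimes>\<^bsub>H\<^esub> f a \<otimes>\<^bsub>H\<^esub> inv\<^bsub>H\<^esub> g b" if "b \<in> carrier ?B" for b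
    using that
  proof (induction b rule: braid_group_induct)
    case one
    have "?\<theta> \<one>\<^bsub>?B\<^esub> a = a" if "a \<in> carrier ?F" for a
      using that \<theta>.hom_one by (simp add: AutoGroup_def BijGroup_def)
    then show ?case by simp
  next
    case (gen i)
    have i: "braid_gen n i \<in> carrier ?B" by (rule braid_gen_closed) fact
    have hm: "group_hom ?F H (\<lambda>a. f (?\<theta> (braid_gen n i) a))"
      using au[OF i] cl[OF i] by unfold_locales (auto simp: hom_def auto_def)
    have hm2: "(\<lambda>a. S i \<otimes>\<^bsub>H\<^esub> f a \<otimes>\<^bsub>H\<^esub> inv\<^bsub>H\<^esub> S i) \<in> hom ?F H"
      using S[OF gen] by (auto simp: hom_def H.m_assoc H.inv_cancel_assoc)
    have si: "S i \<in> carrier H" "X i \<in> carrier H" "X (Suc i) \<in> carrier H"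
      using S[of i] X[of i] X[of "Suc i"] gen by auto
    have "f (?\<theta> (braid_gen n i) a) = S i \<otimes>\<^bsub>H\<^esub> f a \<otimes>\<^bsub>H\<^esub> inv\<^bsub>H\<^esub> S i" if a: "a \<in> carrier ?F" for a
    proof (rule free_group_hom_unique[where h = "\<lambda>a. f (?\<theta> (braid_gen n i) a)"
          and h' = "\<lambda>a. S i \<otimes>\<^bsub>H\<^esub> f a \<otimes>\<^bsub>H\<^esub> inv\<^bsub>H\<^esub> S i",
          OF H.is_group group_hom.homh[OF hm] hm2 _ a])
      fix j assume j: "j \<in> {1..n}"
      have xj: "free_gen n j \<in> carrier ?F" "free_gen n i \<in> carrier ?F" "free_gen n (Suc i) \<in> carrier ?F"
        using j gen by (intro free_gen_closed; simp)+
      have "f (?\<theta> (braid_gen n i) (free_gen n j)) = f (artin_image n i j)"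
        using artin_action(2)[OF gen j] by simp
      also have "\<dots> = S i \<otimes>\<^bsub>H\<^esub> X j \<otimes>\<^bsub>H\<^esub> inv\<^bsub>H\<^esub> S i"
      proof -
        consider "j = i" | "j = Suc i" | "j \<noteq> i" "j \<noteq> Suc i" by blast
        then show ?thesis
        proof cases
          case 1
          have "f (artin_image n i j) = X (Suc i)"
            using fx[of "Suc i"] gen 1 by (simp add: artin_image_def)
          also have "\<dots> = X (Suc i) \<otimes>\<^bsub>H\<^esub> S i \<otimes>\<^bsub>H\<^esub> inv\<^bsub>H\<^esub> S i" using si by (simp add: H.m_assoc)
          finally show ?thesis using SX1[OF gen] 1 by simp
        next
          case 2
          have "f (artin_image n i j) = inv\<^bsub>H\<^esub> X (Suc i) \<otimes>\<^bsub>H\<^esub> X i \<otimes>\<^bsub>H\<^esub> X (Suc i)"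
            using fx[of "Suc i"] fx[of i] gen 2 xj by (simp add: artin_image_def)
          also have "\<dots> = inv\<^bsub>H\<^esub> X (Suc i) \<otimes>\<^bsub>H\<^esub> (X i \<otimes>\<^bsub>H\<^esub> (X (Suc i) \<otimes>\<^bsub>H\<^esub> S i)) \<otimes>\<^bsub>H\<^esub> inv\<^bsub>H\<^esub> S i"
            using si by (simp add: H.m_assoc)
          also have "\<dots> = S i \<otimes>\<^bsub>H\<^esub> X (Suc i) \<otimes>\<^bsub>H\<^esub> inv\<^bsub>H\<^esub> S i"
            using si by (simp add: SX2[OF gen, symmetric] H.m_assoc H.inv_cancel_assoc)
          finally show ?thesis using 2 by simp
        next
          case 3
          have "X j \<in> carrier H" by (rule X) fact
          then show ?thesis using SX3[OF gen j 3] fx[OF j] 3 si by (simp add: artin_image_def H.m_assoc)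
        qed
      qed
      finally show "f (?\<theta> (braid_gen n i) (free_gen n j)) = S i \<otimes>\<^bsub>H\<^esub> f (free_gen n j) \<otimes>\<^bsub>H\<^esub> inv\<^bsub>H\<^esub> S i"
        using fx[OF j] by simp
    qed
    then show ?case using gs[OF gen] by simp
  next
    case (inv b)
    show ?case
    proof
      fix a assume a: "a \<in> carrier ?F"
      let ?c = "?\<theta> (inv\<^bsub>?B\<^esub> b) a"
      have c: "?c \<in> carrier ?F" using inv(1) a by (intro cl) auto
      have "?\<theta> b ?c = (?\<theta> b \<otimes>\<^bsub>AutoGroup ?F\<^esub> ?\<theta> (inv\<^bsub>?B\<^esub> b)) a"
        using au inv(1) a by (simp only: AutoGroup_apply B.inv_closed)
      also have "\<dots> = ?\<theta> (b \<otimes>\<^bsub>?B\<^esub> inv\<^bsub>?B\<^esub> b) a"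
        using inv(1) by (simp only: \<theta>.hom_mult B.inv_closed)
      also have "\<dots> = a" using inv(1) a \<theta>.hom_one by (simp add: AutoGroup_def BijGroup_def)
      finally have "f a = g b \<otimes>\<^bsub>H\<^esub> f ?c \<otimes>\<^bsub>H\<^esub> inv\<^bsub>H\<^esub> g b" using bspec[OF inv(2) c] by simp
      then show "f ?c = g (inv\<^bsub>?B\<^esub> b) \<otimes>\<^bsub>H\<^esub> f a \<otimes>\<^bsub>H\<^esub> inv\<^bsub>H\<^esub> g (inv\<^bsub>?B\<^esub> b)"
        using f.hom_closed[OF c] g.hom_closed[OF inv(1)] inv(1)
        by (simp add: H.m_assoc H.inv_cancel_assoc)
    qed
  next
    case (mult b d)
    show ?case
    proof
      fix a assume a: "a \<in> carrier ?F"
      have "?\<theta> (b \<otimes>\<^bsub>?B\<^esub> d) a = ?\<theta> b (?\<theta> d a)"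
        using au mult(1,2) a by (simp add: \<theta>.hom_mult AutoGroup_apply)
      then show "f (?\<theta> (b \<otimes>\<^bsub>?B\<^esub> d) a) = g (b \<otimes>\<^bsub>?B\<^esub> d) \<otimes>\<^bsub>H\<^esub> f a \<otimes>\<^bsub>H\<^esub> inv\<^bsub>H\<^esub> g (b \<otimes>\<^bsub>?B\<^esub> d)"
        using bspec[OF mult(3) cl[OF mult(2) a]] bspec[OF mult(4) a] a mult(1,2)
        by (simp add: H.m_assoc H.inv_mult_group)
    qed
  qed
  define R where "R = (\<lambda>(a, b). f a \<otimes>\<^bsub>H\<^esub> g b)"
  have "R \<in> hom (free_braid_group n) H"
  proof (rule homI)
    fix p q assume "p \<in> carrier (free_braid_group n)" "q \<in> carrier (free_braid_group n)"
    then obtain a b c d where pq: "p = (a, b)" "q = (c, d)" "a \<in> carrier ?F" "b \<in> carrier ?B"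
      "c \<in> carrier ?F" "d \<in> carrier ?B"
      by (auto simp: free_braid_group_def semidirect_product_def)
    then show "R p \<in> carrier H" by (simp add: R_def)
    show "R (p \<otimes>\<^bsub>free_braid_group n\<^esub> q) = R p \<otimes>\<^bsub>H\<^esub> R q"
      using pq bspec[OF key[OF pq(4)] pq(5)] cl[OF pq(4,5)]
      by (simp add: R_def free_braid_group_def semidirect_product_def H.m_assoc H.inv_cancel_assoc)
  qed
  moreover have "R (gen_x n j) = X j" if "j \<in> {1..n}" for j
    using that X[OF that] by (simp add: R_def gen_x_def fx g.hom_one)
  moreover have "R (gen_\<sigma> n i) = S i" if "i \<in> {1..<n}" for i
    using that S[OF that] by (simp add: R_def gen_\<sigma>_def gs f.hom_one)
  ultimately show ?thesis by blast
qed

lemma free_braid_hom_unique: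
  assumes "group H" "R \<in> hom (free_braid_group n) H" "R' \<in> hom (free_braid_group n) H"
    and x: "\<And>j. j \<in> {1..n} \<Longrightarrow> R (gen_x n j) = R' (gen_x n j)"
    and s: "\<And>i. i \<in> {1..<n} \<Longrightarrow> R (gen_\<sigma> n i) = R' (gen_\<sigma> n i)"
    and p: "p \<in> carrier (free_braid_group n)"
  shows "R p = R' p"
proof -
  let ?F = "free_group n" and ?B = "braid_group n" and ?\<theta> = "artin_action n" and ?G = "free_braid_group n"
  interpret H: group H by fact
  interpret F: group ?F by (rule group_free_group)
  interpret B: group ?B by (rule group_braid_group)
  interpret A: group "AutoGroup ?F" by (rule F.AutoGroup)
  interpret \<theta>: group_hom ?B "AutoGroup ?F" ?\<theta> by standard (rule artin_action)
  note \<theta>.hom_inv [simp del] \<theta>.hom_mult [simp del] \<theta>.hom_one [simp del]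
  have au: "?\<theta> b \<in> auto ?F" if "b \<in> carrier ?B" for b
    using \<theta>.hom_closed[OF that] by (simp add: AutoGroup_carrier)
  have one: "?\<theta> \<one>\<^bsub>?B\<^esub> a = a" if "a \<in> carrier ?F" for a
    using that \<theta>.hom_one by (simp add: AutoGroup_def BijGroup_def)
  have one': "?\<theta> b \<one>\<^bsub>?F\<^esub> = \<one>\<^bsub>?F\<^esub>" if "b \<in> carrier ?B" for b
  proof -
    interpret group_hom ?F ?F "?\<theta> b" by standard (use au[OF that] in \<open>simp add: auto_def\<close>)
    show ?thesis by (rule hom_one)
  qed
  have emb: "(\<lambda>a. (a, \<one>\<^bsub>?B\<^esub>)) \<in> hom ?F ?G" "(\<lambda>b. (\<one>\<^bsub>?F\<^esub>, b)) \<in> hom ?B ?G"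
    by (auto simp: hom_def free_braid_group_def semidirect_product_def one one')
  obtain a b where ab: "p = (a, b)" "a \<in> carrier ?F" "b \<in> carrier ?B"
    using p by (auto simp: free_braid_group_def semidirect_product_def)
  have h: "(\<lambda>a. T (a, \<one>\<^bsub>?B\<^esub>)) \<in> hom ?F H" "(\<lambda>b. T (\<one>\<^bsub>?F\<^esub>, b)) \<in> hom ?B H"
    if "T \<in> hom ?G H" for T
    using hom_compose[OF emb(1) that] hom_compose[OF emb(2) that] by (simp_all add: comp_def)
  have 1: "R (a, \<one>\<^bsub>?B\<^esub>) = R' (a, \<one>\<^bsub>?B\<^esub>)"
    by (rule free_group_hom_unique[where h = "\<lambda>a. R (a, \<one>\<^bsub>?B\<^esub>)" and h' = "\<lambda>a. R' (a, \<one>\<^bsub>?B\<^esub>)",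
        OF H.is_group h(1)[OF assms(2)] h(1)[OF assms(3)] _ ab(2)]) (use x in \<open>simp add: gen_x_def\<close>)
  have 2: "R (\<one>\<^bsub>?F\<^esub>, b) = R' (\<one>\<^bsub>?F\<^esub>, b)"
    by (rule braid_group_hom_unique[where h = "\<lambda>b. R (\<one>\<^bsub>?F\<^esub>, b)" and h' = "\<lambda>b. R' (\<one>\<^bsub>?F\<^esub>, b)",
        OF H.is_group h(2)[OF assms(2)] h(2)[OF assms(3)] _ ab(3)]) (use s in \<open>simp add: gen_\<sigma>_def\<close>)
  have c: "(a, \<one>\<^bsub>?B\<^esub>) \<in> carrier ?G" "(\<one>\<^bsub>?F\<^esub>, b) \<in> carrier ?G"
    using ab by (simp_all add: free_braid_group_def semidirect_product_def)
  have "p = (a, \<one>\<^bsub>?B\<^esub>) \<otimes>\<^bsub>?G\<^esub> (\<one>\<^bsub>?F\<^esub>, b)"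
    using ab by (simp add: free_braid_group_def semidirect_product_def one)
  then show ?thesis using hom_mult[OF assms(2) c] hom_mult[OF assms(3) c] 1 2 by simp
qed

section \<open>Vector spaces and operators\<close>

text \<open>Vector spaces over the field \<open>'k\<close> are \<^term>\<open>vectorspace class_ring V\<close>; the ring components
  \<open>mult\<close> and \<open>one\<close> of the record \<open>V\<close> play no role.\<close>

definition GL :: "('k::field, 'v, 'm) module_scheme \<Rightarrow> ('v \<Rightarrow> 'v) monoid" where
  "GL V = BijGroup (carrier V)
     \<lparr>carrier := {f \<in> Bij (carrier V). f \<in> LinearCombinations.module_hom class_ring V V}\<rparr>"

definition power_space :: "nat \<Rightarrow> ('k, 'v, 'm) module_scheme \<Rightarrow> ('k, nat \<Rightarrow> 'v) module" where
  "power_space n V =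
    \<lparr>carrier = {1..n} \<rightarrow>\<^sub>E carrier V,
     mult = (\<lambda>v w. \<lambda>j\<in>{1..n}. \<zero>\<^bsub>V\<^esub>),
     one = (\<lambda>j\<in>{1..n}. \<zero>\<^bsub>V\<^esub>),
     zero = (\<lambda>j\<in>{1..n}. \<zero>\<^bsub>V\<^esub>),
     add = (\<lambda>v w. \<lambda>j\<in>{1..n}. v j \<oplus>\<^bsub>V\<^esub> w j),
     smult = (\<lambda>c w. \<lambda>j\<in>{1..n}. c \<odot>\<^bsub>V\<^esub> w j)\<rparr>"

definition quotient_space :: "('k, 'v, 'm) module_scheme \<Rightarrow> 'v set \<Rightarrow> ('k, 'v set) module" where
  "quotient_space V U =
    \<lparr>carrier = a_rcosets\<^bsub>V\<^esub> U,
     mult = (\<lambda>X Y. U),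
     one = U,
     zero = U,
     add = (\<lambda>X Y. X <+>\<^bsub>V\<^esub> Y),
     smult = (\<lambda>c X. \<Union>v\<in>X. U +>\<^bsub>V\<^esub> (c \<odot>\<^bsub>V\<^esub> v))\<rparr>"

definition quotient_map :: "('k, 'v, 'm) module_scheme \<Rightarrow> 'v set \<Rightarrow> ('v \<Rightarrow> 'v) \<Rightarrow> 'v set \<Rightarrow> 'v set" where
  "quotient_map V U A = (\<lambda>X \<in> a_rcosets\<^bsub>V\<^esub> U. \<Union>v\<in>X. U +>\<^bsub>V\<^esub> A v)"

definition semisimple_op :: "('k::field, 'v, 'm) module_scheme \<Rightarrow> ('v \<Rightarrow> 'v) \<Rightarrow> bool" where
  "semisimple_op V A \<longleftrightarrow>
    (\<forall>U. subspace class_ring U V \<and> A ` U \<subseteq> U \<longrightarrow>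
      (\<exists>W. subspace class_ring W V \<and> A ` W \<subseteq> W \<and>
        U \<inter> W = {\<zero>\<^bsub>V\<^esub>} \<and> U <+>\<^bsub>V\<^esub> W = carrier V))"

definition poly_op :: "('k::field, 'v, 'm) module_scheme \<Rightarrow> 'k poly \<Rightarrow> ('v \<Rightarrow> 'v) \<Rightarrow> 'v \<Rightarrow> 'v" where
  "poly_op V p A v = (\<Oplus>\<^bsub>V\<^esub>i\<in>{..degree p}. coeff p i \<odot>\<^bsub>V\<^esub> (A ^^ i) v)"

definition annihilates :: "('k::field, 'v, 'm) module_scheme \<Rightarrow> 'k poly \<Rightarrow> ('v \<Rightarrow> 'v) \<Rightarrow> bool" where
  "annihilates V p A \<longleftrightarrow> (\<forall>v\<in>carrier V. poly_op V p A v = \<zero>\<^bsub>V\<^esub>)"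

definition min_poly :: "('k::field, 'v, 'm) module_scheme \<Rightarrow> ('v \<Rightarrow> 'v) \<Rightarrow> 'k poly" where
  "min_poly V A = (THE p. lead_coeff p = 1 \<and> annihilates V p A \<and>
     (\<forall>q. q \<noteq> 0 \<and> annihilates V q A \<longrightarrow> degree p \<le> degree q))"

definition splits :: "'k::field poly \<Rightarrow> bool" where
  "splits p \<longleftrightarrow> (\<exists>as. p = Polynomial.smult (lead_coeff p) (\<Prod>a\<leftarrow>as. [:- a, 1:]))"

definition eigenspace :: "('k, 'v, 'm) module_scheme \<Rightarrow> ('v \<Rightarrow> 'v) \<Rightarrow> 'k \<Rightarrow> 'v set" where
  "eigenspace V A \<nu> = {v \<in> carrier V. A v = \<nu> \<odot>\<^bsub>V\<^esub> v}"

definition spec :: "('k, 'v, 'm) module_scheme \<Rightarrow> ('v \<Rightarrow> 'v) \<Rightarrow> 'k set" where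
  "spec V A = {\<nu>. \<exists>v\<in>carrier V. v \<noteq> \<zero>\<^bsub>V\<^esub> \<and> A v = \<nu> \<odot>\<^bsub>V\<^esub> v}"

definition spectral_proj :: "('k::field, 'v, 'm) module_scheme \<Rightarrow> ('v \<Rightarrow> 'v) \<Rightarrow> 'k \<Rightarrow> 'v \<Rightarrow> 'v" where
  "spectral_proj V A \<nu> v = (THE u. u \<in> eigenspace V A \<nu> \<and>
     v \<ominus>\<^bsub>V\<^esub> u \<in> LinearCombinations.module.span class_ring V (\<Union>\<mu>\<in>spec V A - {\<nu>}. eigenspace V A \<mu>))"


section \<open>The twisted Long-Moody and the Katz-Long-Moody constructions\<close>

text \<open>The operator on \<open>V\<^sup>n\<close> given by an \<open>n \<times> n\<close> matrix \<open>M\<close> of operators on \<open>V\<close>,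
  acting on column vectors; \<open>M r c\<close> is the block in row \<open>r\<close> and column \<open>c\<close>.\<close>

definition block_op ::
  "nat \<Rightarrow> ('k, 'v, 'm) module_scheme \<Rightarrow> (nat \<Rightarrow> nat \<Rightarrow> 'v \<Rightarrow> 'v) \<Rightarrow> (nat \<Rightarrow> 'v) \<Rightarrow> (nat \<Rightarrow> 'v)" where
  "block_op n V M = (\<lambda>w\<in>carrier (power_space n V). \<lambda>r\<in>{1..n}. \<Oplus>\<^bsub>V\<^esub>c\<in>{1..n}. M r c (w c))"

type_synonym 'v free_braid_rep = "nat word set \<times> nat word set \<Rightarrow> 'v \<Rightarrow> 'v"

definition LM_x ::
  "nat \<Rightarrow> ('k, 'v, 'm) module_scheme \<Rightarrow> 'v free_braid_rep \<Rightarrow> 'k \<Rightarrow> nat \<Rightarrow> (nat \<Rightarrow> 'v) \<Rightarrow> (nat \<Rightarrow> 'v)" where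
  "LM_x n V \<rho> lam i = (let g = (\<lambda>j. \<rho> (gen_x n j)) in
     block_op n V (\<lambda>r c v.
       if r = i then
         (if c < i then lam \<odot>\<^bsub>V\<^esub> (g c v \<ominus>\<^bsub>V\<^esub> v) else if c = i then lam \<odot>\<^bsub>V\<^esub> g i v else g c v \<ominus>\<^bsub>V\<^esub> v)
       else if r = c then v else \<zero>\<^bsub>V\<^esub>))"

definition LM_\<sigma> ::
  "nat \<Rightarrow> ('k, 'v, 'm) module_scheme \<Rightarrow> 'v free_braid_rep \<Rightarrow> nat \<Rightarrow> (nat \<Rightarrow> 'v) \<Rightarrow> (nat \<Rightarrow> 'v)" where
  "LM_\<sigma> n V \<rho> i = (let g = (\<lambda>j. \<rho> (gen_x n j)); s = \<rho> (gen_\<sigma> n i) in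
     compose (carrier (power_space n V))
       (block_op n V (\<lambda>r c v. if r = c then s v else \<zero>\<^bsub>V\<^esub>))
       (block_op n V (\<lambda>r c v.
          if r = i \<and> c = i then \<zero>\<^bsub>V\<^esub>
          else if r = i \<and> c = i + 1 then g i v
          else if r = i + 1 \<and> c = i then v
          else if r = i + 1 \<and> c = i + 1 then v \<ominus>\<^bsub>V\<^esub> g (i + 1) v
          else if r = c then v else \<zero>\<^bsub>V\<^esub>)))"

definition long_moody ::
  "nat \<Rightarrow> ('k::field, 'v, 'm) module_scheme \<Rightarrow> 'v free_braid_rep \<Rightarrow> 'k \<Rightarrow> (nat \<Rightarrow> 'v) free_braid_rep" where
  "long_moody n V \<rho> lam = (THE R. R \<in> hom (free_braid_group n) (GL (power_space n V)) \<and>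
     R \<in> extensional (carrier (free_braid_group n)) \<and>
     (\<forall>j\<in>{1..n}. R (gen_x n j) = LM_x n V \<rho> lam j) \<and>
     (\<forall>i\<in>{1..<n}. R (gen_\<sigma> n i) = LM_\<sigma> n V \<rho> i))"

definition KLM_K :: "nat \<Rightarrow> ('k, 'v, 'm) module_scheme \<Rightarrow> 'v free_braid_rep \<Rightarrow> (nat \<Rightarrow> 'v) set" where
  "KLM_K n V \<rho> = {w \<in> carrier (power_space n V). \<forall>j\<in>{1..n}. \<rho> (gen_x n j) (w j) = w j}"

definition KLM_L :: "nat \<Rightarrow> ('k::field, 'v, 'm) module_scheme \<Rightarrow> 'v free_braid_rep \<Rightarrow> 'k \<Rightarrow> (nat \<Rightarrow> 'v) set" where
  "KLM_L n V \<rho> lam =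
    {w \<in> carrier (power_space n V). \<forall>j\<in>{1..n}. long_moody n V \<rho> lam (gen_x n j) w = w}"

definition KLM_sub :: "nat \<Rightarrow> ('k::field, 'v, 'm) module_scheme \<Rightarrow> 'v free_braid_rep \<Rightarrow> 'k \<Rightarrow> (nat \<Rightarrow> 'v) set" where
  "KLM_sub n V \<rho> lam = KLM_K n V \<rho> <+>\<^bsub>power_space n V\<^esub> KLM_L n V \<rho> lam"

definition KLM_space ::
  "nat \<Rightarrow> ('k::field, 'v, 'm) module_scheme \<Rightarrow> 'v free_braid_rep \<Rightarrow> 'k \<Rightarrow> ('k, (nat \<Rightarrow> 'v) set) module" where
  "KLM_space n V \<rho> lam = quotient_space (power_space n V) (KLM_sub n V \<rho> lam)"

definition katz_long_moody ::
  "nat \<Rightarrow> ('k::field, 'v, 'm) module_scheme \<Rightarrow> 'v free_braid_rep \<Rightarrow> 'k \<Rightarrow> (nat \<Rightarrow> 'v) set free_braid_rep" where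
  "katz_long_moody n V \<rho> lam p =
    quotient_map (power_space n V) (KLM_sub n V \<rho> lam) (long_moody n V \<rho> lam p)"

end

theory Submission
  imports Defs
begin

text \<open>Put \<open>s = s\<^sub>i\<close>, \<open>t = s\<^sub>i g\<^sub>i\<close>. The operator \<open>\<rho>\<^sup>L\<^sup>M(\<sigma>\<^sub>i)\<close> preserves the sum of the blocks
  \<open>i, i + 1\<close> and acts on each remaining block as \<open>s\<close>. On the two distinguished blocks write a vector as
  \<open>(u + t b, s b)\<close>. Since \<open>g\<^sub>i\<^sub>+\<^sub>1 s = s g\<^sub>i\<close>, the operator becomes \<open>(u, b) \<mapsto> (- t u, u + s b)\<close> in the
  coordinates \<open>u, b\<close>: it is block triangular with diagonal blocks \<open>- t\<close> and \<open>s\<close> and with the identity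
  as off-diagonal block (lemma \<open>S_adapted\<close>).

  When \<open>s\<close> and \<open>- t\<close> are diagonalizable, such an operator is diagonalizable exactly if
  every eigenvector of \<open>- t\<close> lifts to an eigenvector of the same eigenvalue: for \<open>- t u = \<nu> u\<close> there must be
  some \<open>b\<close> with \<open>u + (s - \<nu>) b = 0\<close>, that is, \<open>u\<close> must lie in the image of \<open>s - \<nu>\<close>. If all these
  equations are solvable, the resulting eigenvectors together with those of \<open>s\<close> span (lemma \<open>diagonalizable_S\<close>).
  Otherwise a \<open>u\<close> with nonzero component \<open>p\<close> in \<open>Ker (s - \<nu>)\<close> yields a Jordan block \<open>(u, b) \<mapsto> (0, p) \<mapsto> 0\<close> of
  \<open>\<rho>\<^sup>L\<^sup>M(\<sigma>\<^sub>i) - \<nu>\<close>, which a semisimple operator does not have (lemma \<open>semisimple_S_imp_solvable\<close>).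
  For diagonalizable \<open>s\<close> the image of \<open>s - \<nu>\<close> is the kernel of \<open>\<Pi>\<^sup>s\<^sub>\<nu>\<close>, so solvability for all \<open>\<nu>\<close> is the vanishing of
  the products of spectral projections (lemma \<open>spectral_proj_product_zero_iff\<close>).

  The eigenspaces of a diagonalizable operator span every quotient by an invariant subspace as well, which gives
  the statement on \<open>\<rho>\<^sup>K\<^sup>L\<^sup>M\<close>. What remains is that the objects are what they should be: a semisimple operator
  with split minimal polynomial is diagonalizable; the blocks satisfy the relations of \<open>F\<^sub>n \<rtimes> B\<^sub>n\<close>, so that
  \<open>\<rho>\<^sup>L\<^sup>M\<close> exists; and \<open>K + L\<close> is an invariant subspace.\<close>

section \<open>Linear operators and diagonalizability\<close>

text \<open>The eigenspaces span the whole space. Quantifying over the subspaces that contain them, in place of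
  forming a span, makes transport along linear maps immediate: it suffices to pull a subspace back.\<close>

definition diagonalizable_op :: "('k::field, 'v, 'm) module_scheme \<Rightarrow> ('v \<Rightarrow> 'v) \<Rightarrow> bool" where
  "diagonalizable_op V A \<longleftrightarrow>
    (\<forall>E. subspace class_ring E V \<and> (\<forall>\<nu>. eigenspace V A \<nu> \<subseteq> E) \<longrightarrow> E = carrier V)"

text \<open>The scalars form a type of class \<open>field\<close>. The rewrite rules of the interpretation replace the operations of
  the record \<open>class_ring\<close> by those of the type.\<close>

locale class_vectorspace =
  fixes V :: "('k::field, 'v, 'm) module_scheme" (structure)
  assumes is_vectorspace: "vectorspace class_ring V"
begin

sublocale vectorspace "class_ring :: 'k ring" V
  rewrites "carrier (class_ring :: 'k ring) = UNIV"
    and "monoid.mult (class_ring :: 'k ring) = (*)"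
    and "add (class_ring :: 'k ring) = (+)"
    and "one (class_ring :: 'k ring) = 1"
    and "zero (class_ring :: 'k ring) = 0"
    and "a_inv (class_ring :: 'k ring) = uminus"
    and "a_minus (class_ring :: 'k ring) = (-)"
    and "\<And>x :: 'k. x \<in> UNIV \<equiv> True"
    and "\<And>X :: 'k set. X \<subseteq> UNIV \<equiv> True"
    and "\<And>(a :: 'v \<Rightarrow> 'k) A. a \<in> A \<rightarrow> UNIV \<equiv> True"
    and "\<And>P. P \<and> True \<equiv> P"
    and "\<And>P. (True \<Longrightarrow> P) \<equiv> Trueprop P"
  using is_vectorspace by (simp_all add: class_ring_simps)

abbreviation lin :: "('v \<Rightarrow> 'v) \<Rightarrow> bool" where
  "lin A \<equiv> A \<in> LinearCombinations.module_hom class_ring V V"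

lemma linI:
  assumes "\<And>v. v \<in> carrier V \<Longrightarrow> A v \<in> carrier V"
    and "\<And>v w. v \<in> carrier V \<Longrightarrow> w \<in> carrier V \<Longrightarrow> A (v \<oplus> w) = A v \<oplus> A w"
    and "\<And>c v. v \<in> carrier V \<Longrightarrow> A (c \<odot> v) = c \<odot> A v"
  shows "lin A"
  using assms by (auto simp: LinearCombinations.module_hom_def)

lemma
  assumes "lin A"
  shows lin_closed: "v \<in> carrier V \<Longrightarrow> A v \<in> carrier V"
    and lin_add: "v \<in> carrier V \<Longrightarrow> w \<in> carrier V \<Longrightarrow> A (v \<oplus> w) = A v \<oplus> A w"
    and lin_smult: "v \<in> carrier V \<Longrightarrow> A (c \<odot> v) = c \<odot> A v"
  using assms by (auto simp: LinearCombinations.module_hom_def)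

lemma lin_zero: "lin A \<Longrightarrow> A \<zero> = \<zero>"
  using lin_smult[of A "\<zero>" 0] lin_closed[of A "\<zero>"] by simp

lemma neg_eq_smult: "v \<in> carrier V \<Longrightarrow> \<ominus> v = (- 1) \<odot> v"
  using smult_minus_1 by simp

lemma lin_neg: "lin A \<Longrightarrow> v \<in> carrier V \<Longrightarrow> A (\<ominus> v) = \<ominus> A v"
  by (simp add: neg_eq_smult lin_smult lin_closed)

lemma lin_minus: "lin A \<Longrightarrow> v \<in> carrier V \<Longrightarrow> w \<in> carrier V \<Longrightarrow> A (v \<ominus> w) = A v \<ominus> A w"
  by (simp add: M.minus_eq lin_add lin_neg)

lemmas lin_simps = lin_closed lin_add lin_smult lin_zero lin_neg lin_minus

lemma subspace_iff:
  "subspace class_ring W V \<longleftrightarrow> W \<subseteq> carrier V \<and> \<zero> \<in> W \<and>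
    (\<forall>v\<in>W. \<forall>w\<in>W. v \<oplus> w \<in> W) \<and> (\<forall>c. \<forall>v\<in>W. c \<odot> v \<in> W)"
proof -
  have "module class_ring V" by (rule vectorspace.axioms(1)[OF is_vectorspace])
  then show ?thesis
    using is_vectorspace by (auto simp: VectorSpace.subspace_def submodule_def)
qed

lemma subspaceI:
  assumes "W \<subseteq> carrier V" "\<zero> \<in> W"
    and "\<And>v w. v \<in> W \<Longrightarrow> w \<in> W \<Longrightarrow> v \<oplus> w \<in> W" "\<And>c v. v \<in> W \<Longrightarrow> c \<odot> v \<in> W"
  shows "subspace class_ring W V"
  using assms by (auto simp: subspace_iff)

lemma
  assumes "subspace class_ring W V"
  shows sub_carrier: "v \<in> W \<Longrightarrow> v \<in> carrier V"
    and sub_zero: "\<zero> \<in> W"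
    and sub_add: "v \<in> W \<Longrightarrow> w \<in> W \<Longrightarrow> v \<oplus> w \<in> W"
    and sub_smult: "v \<in> W \<Longrightarrow> c \<odot> v \<in> W"
    and sub_neg: "v \<in> W \<Longrightarrow> \<ominus> v \<in> W"
    and sub_minus: "v \<in> W \<Longrightarrow> w \<in> W \<Longrightarrow> v \<ominus> w \<in> W"
  using assms by (auto simp: subspace_iff M.minus_eq neg_eq_smult subset_iff)

lemma smult_cancel: "c \<noteq> 0 \<Longrightarrow> v \<in> carrier V \<Longrightarrow> inverse c \<odot> (c \<odot> v) = v"
  using smult_assoc1[of v "inverse c" c] by simp

lemma smult_minus_l: "v \<in> carrier V \<Longrightarrow> (a - b) \<odot> v = a \<odot> v \<ominus> b \<odot> v"
  using smult_l_distr[of v a "- b"] smult_assoc1[of v "- 1" b] by (simp add: M.minus_eq neg_eq_smult)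

lemma smult_minus_r: "v \<in> carrier V \<Longrightarrow> w \<in> carrier V \<Longrightarrow> a \<odot> (v \<ominus> w) = a \<odot> v \<ominus> a \<odot> w"
  by (simp add: M.minus_eq smult_r_distr neg_eq_smult flip: smult_assoc1)

lemma minus_eq_iff:
  "x \<in> carrier V \<Longrightarrow> y \<in> carrier V \<Longrightarrow> z \<in> carrier V \<Longrightarrow> x \<ominus> y = z \<longleftrightarrow> x = z \<oplus> y"
  by (metis M.minus_eq M.a_assoc M.l_neg M.r_zero M.r_neg M.a_inv_closed)

lemma eq_minus_iff:
  "x \<in> carrier V \<Longrightarrow> y \<in> carrier V \<Longrightarrow> z \<in> carrier V \<Longrightarrow> z = x \<ominus> y \<longleftrightarrow> z \<oplus> y = x"
  using minus_eq_iff[of x y z] by auto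

lemma minus_zero_right: "x \<in> carrier V \<Longrightarrow> x \<ominus> \<zero> = x"
  by (simp add: M.minus_eq)

lemma minus_self: "x \<in> carrier V \<Longrightarrow> x \<ominus> x = \<zero>"
  by (simp add: M.minus_eq M.r_neg)

lemma add_minus_assoc:
  "x \<in> carrier V \<Longrightarrow> y \<in> carrier V \<Longrightarrow> z \<in> carrier V \<Longrightarrow> x \<oplus> (y \<ominus> z) = (x \<oplus> y) \<ominus> z"
  by (simp add: M.minus_eq M.a_assoc)

lemma minus_add_swap:
  "x \<in> carrier V \<Longrightarrow> y \<in> carrier V \<Longrightarrow> z \<in> carrier V \<Longrightarrow> (x \<ominus> y) \<oplus> z = (x \<oplus> z) \<ominus> y"
  by (simp add: M.minus_eq M.a_ac)

lemma minus_minus_left: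
  "x \<in> carrier V \<Longrightarrow> y \<in> carrier V \<Longrightarrow> z \<in> carrier V \<Longrightarrow> (x \<ominus> y) \<ominus> z = x \<ominus> (y \<oplus> z)"
  by (simp add: M.minus_eq M.a_ac M.minus_add)

lemma minus_minus_right:
  "x \<in> carrier V \<Longrightarrow> y \<in> carrier V \<Longrightarrow> z \<in> carrier V \<Longrightarrow> x \<ominus> (y \<ominus> z) = (x \<oplus> z) \<ominus> y"
  by (simp add: M.minus_eq M.a_ac M.minus_add)

text \<open>Moves all subtractions of an equation to its outside and clears them, after which associativity and
  commutativity decide identities between sums of atoms.\<close>

lemmas minus_simps = minus_eq_iff eq_minus_iff add_minus_assoc minus_add_swap
  minus_minus_left minus_minus_right M.a_ac

lemma set_add_memI: "u \<in> U \<Longrightarrow> w \<in> W \<Longrightarrow> u \<oplus> w \<in> U <+>\<^bsub>V\<^esub> W"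
  by (auto simp: set_add_def')

lemma set_add_memE:
  assumes "x \<in> U <+>\<^bsub>V\<^esub> W" obtains u w where "u \<in> U" "w \<in> W" "x = u \<oplus> w"
  using assms by (auto simp: set_add_def')

lemma sum_subspace:
  assumes U: "subspace class_ring U V" and W: "subspace class_ring W V"
  shows "subspace class_ring (U <+>\<^bsub>V\<^esub> W) V" "U \<subseteq> U <+>\<^bsub>V\<^esub> W" "W \<subseteq> U <+>\<^bsub>V\<^esub> W"
proof -
  note c = sub_carrier[OF U] sub_carrier[OF W]
  show "subspace class_ring (U <+>\<^bsub>V\<^esub> W) V"
  proof (rule subspaceI)
    show "U <+>\<^bsub>V\<^esub> W \<subseteq> carrier V" using c by (auto simp: set_add_def')
    show "\<zero> \<in> U <+>\<^bsub>V\<^esub> W" using sub_zero[OF U] sub_zero[OF W] by (force simp: set_add_def')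
    fix v w assume "v \<in> U <+>\<^bsub>V\<^esub> W" "w \<in> U <+>\<^bsub>V\<^esub> W"
    then obtain a b a' b' where *: "v = a \<oplus> b" "w = a' \<oplus> b'" "a \<in> U" "a' \<in> U" "b \<in> W" "b' \<in> W"
      by (auto simp: set_add_def')
    then have "v \<oplus> w = (a \<oplus> a') \<oplus> (b \<oplus> b')" using c by (simp add: M.a_ac)
    then show "v \<oplus> w \<in> U <+>\<^bsub>V\<^esub> W"
      using * sub_add[OF U] sub_add[OF W] by (simp add: set_add_memI)
  next
    fix k v assume "v \<in> U <+>\<^bsub>V\<^esub> W"
    then obtain a b where *: "v = a \<oplus> b" "a \<in> U" "b \<in> W" by (auto simp: set_add_def')
    then have "k \<odot> v = k \<odot> a \<oplus> k \<odot> b" using c by (simp add: smult_r_distr)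
    then show "k \<odot> v \<in> U <+>\<^bsub>V\<^esub> W"
      using * sub_smult[OF U] sub_smult[OF W] by (simp add: set_add_memI)
  qed
  show "U \<subseteq> U <+>\<^bsub>V\<^esub> W"
  proof
    fix u assume "u \<in> U"
    then have "u = u \<oplus> \<zero>" using c by simp
    then show "u \<in> U <+>\<^bsub>V\<^esub> W" using \<open>u \<in> U\<close> sub_zero[OF W] by (auto simp: set_add_def')
  qed
  show "W \<subseteq> U <+>\<^bsub>V\<^esub> W"
  proof
    fix w assume "w \<in> W"
    then have "w = \<zero> \<oplus> w" using c by simp
    then show "w \<in> U <+>\<^bsub>V\<^esub> W" using \<open>w \<in> W\<close> sub_zero[OF U] by (auto simp: set_add_def')
  qed
qed

lemma line_subspace:
  assumes "v \<in> carrier V" shows "subspace class_ring (range (\<lambda>c. c \<odot> v)) V"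
proof (rule subspaceI)
  show "\<zero> \<in> range (\<lambda>c. c \<odot> v)" using assms by (intro range_eqI[of _ _ 0]) simp
  show "x \<oplus> y \<in> range (\<lambda>c. c \<odot> v)" if "x \<in> range (\<lambda>c. c \<odot> v)" "y \<in> range (\<lambda>c. c \<odot> v)" for x y
    using that assms by (auto simp flip: smult_l_distr)
  show "k \<odot> x \<in> range (\<lambda>c. c \<odot> v)" if "x \<in> range (\<lambda>c. c \<odot> v)" for k x
    using that assms by (auto simp flip: smult_assoc1)
qed (use assms in auto)

lemma eigenspace_subspace:
  assumes "lin A" shows "subspace class_ring (eigenspace V A \<nu>) V"
  by (rule subspaceI)
    (auto simp: eigenspace_def lin_simps[OF assms] smult_r_distr mult.commute simp flip: smult_assoc1)

text \<open>A complement of \<open>U\<close> is an invariant subspace \<open>W\<close> that is maximal subject to \<open>U \<inter> W = 0\<close>. If \<open>U + W\<close> were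
  not everything, it would miss an eigenvector, and adjoining that eigenvector to \<open>W\<close> would contradict
  maximality. Zorn's lemma replaces a count of dimensions, so that no basis of the quotient spaces is needed later.\<close>

lemma diagonalizable_imp_semisimple:
  assumes A: "lin A" and "diagonalizable_op V A"
  shows "semisimple_op V A"
  unfolding semisimple_op_def
proof (intro allI impI, elim conjE)
  fix U assume U: "subspace class_ring U V" and AU: "A ` U \<subseteq> U"
  define S where "S = {W. subspace class_ring W V \<and> A ` W \<subseteq> W \<and> U \<inter> W = {\<zero>}}"
  have "subspace class_ring {\<zero>} V" by (rule subspaceI) auto
  then have "{\<zero>} \<in> S" using lin_zero[OF A] sub_zero[OF U] by (auto simp: S_def)
  then have "S \<noteq> {}" by blast
  moreover have "\<Union>C \<in> S" if C: "C \<noteq> {}" "subset.chain S C" for C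
  proof -
    have CS: "C \<subseteq> S" and tot: "\<And>X Y. X \<in> C \<Longrightarrow> Y \<in> C \<Longrightarrow> X \<subseteq> Y \<or> Y \<subseteq> X"
      using C(2) by (auto simp: subset.chain_def subset_chain_def)
    have CW: "subspace class_ring W V" "A ` W \<subseteq> W" "U \<inter> W = {\<zero>}" if "W \<in> C" for W
      using CS that by (auto simp: S_def)
    have "subspace class_ring (\<Union>C) V"
    proof (rule subspaceI)
      show "\<Union>C \<subseteq> carrier V" using CW(1) sub_carrier by blast
      show "\<zero> \<in> \<Union>C" using C(1) CW(1) sub_zero by blast
      show "v \<oplus> w \<in> \<Union>C" if vw: "v \<in> \<Union>C" "w \<in> \<Union>C" for v w
      proof -
        from vw obtain X Y where XY: "X \<in> C" "Y \<in> C" "v \<in> X" "w \<in> Y" by auto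
        from tot[OF XY(1,2)] obtain Z where "Z \<in> C" "v \<in> Z" "w \<in> Z" using XY by blast
        then show ?thesis using CW(1) sub_add by blast
      qed
      show "c \<odot> v \<in> \<Union>C" if "v \<in> \<Union>C" for c v using that CW(1) sub_smult by blast
    qed
    moreover have "U \<inter> \<Union>C = {\<zero>}" using CW(3) C(1) by blast
    moreover have "A ` \<Union>C \<subseteq> \<Union>C" using CW(2) by blast
    ultimately show ?thesis by (simp add: S_def)
  qed
  ultimately obtain W where W: "W \<in> S" and max: "\<And>X. X \<in> S \<Longrightarrow> W \<subseteq> X \<Longrightarrow> X = W"
    using subset_Zorn_nonempty[of S] by blast
  have Ws: "subspace class_ring W V" "A ` W \<subseteq> W" "U \<inter> W = {\<zero>}" using W by (auto simp: S_def)
  note sum = sum_subspace[OF U Ws(1)]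
  have "eigenspace V A \<nu> \<subseteq> U <+>\<^bsub>V\<^esub> W" for \<nu>
  proof (rule ccontr)
    assume "\<not> eigenspace V A \<nu> \<subseteq> U <+>\<^bsub>V\<^esub> W"
    then obtain v where v: "v \<in> carrier V" "A v = \<nu> \<odot> v" "v \<notin> U <+>\<^bsub>V\<^esub> W"
      by (auto simp: eigenspace_def)
    let ?X = "W <+>\<^bsub>V\<^esub> range (\<lambda>c. c \<odot> v)"
    note X = sum_subspace[OF Ws(1) line_subspace[OF v(1)]]
    have elem: "\<exists>w\<in>W. \<exists>c. x = w \<oplus> c \<odot> v" if "x \<in> ?X" for x
      using that by (auto simp: set_add_def')
    have "A ` ?X \<subseteq> ?X"
    proof
      fix y assume "y \<in> A ` ?X"
      then obtain w c where wc: "w \<in> W" "y = A (w \<oplus> c \<odot> v)" using elem by blast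
      then have "y = A w \<oplus> (c * \<nu>) \<odot> v"
        using v(1,2) sub_carrier[OF Ws(1)] by (simp add: lin_simps[OF A] smult_assoc1)
      then show "y \<in> ?X" using Ws(2) wc(1) by (auto simp: set_add_def')
    qed
    moreover have "U \<inter> ?X \<subseteq> {\<zero>}"
    proof
      fix x assume x: "x \<in> U \<inter> ?X"
      then obtain w c where wc: "w \<in> W" "x = w \<oplus> c \<odot> v" using elem by blast
      note wV = sub_carrier[OF Ws(1) wc(1)]
      have "c = 0"
      proof (rule ccontr)
        assume "c \<noteq> 0"
        have "c \<odot> v = x \<ominus> w" using wV v(1) by (simp add: wc(2) minus_simps)
        moreover have "x \<ominus> w \<in> U <+>\<^bsub>V\<^esub> W" using x wc(1) sum by (intro sub_minus) auto
        ultimately have "inverse c \<odot> (c \<odot> v) \<in> U <+>\<^bsub>V\<^esub> W" using sub_smult[OF sum(1)] by simp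
        then show False using v \<open>c \<noteq> 0\<close> by (simp add: smult_cancel)
      qed
      then have "x = w" using wc(2) v(1) wV by simp
      then show "x \<in> {\<zero>}" using x wc(1) Ws(3) by blast
    qed
    ultimately have "?X \<in> S" using X(1) sub_zero[OF U] sub_zero[OF X(1)] by (auto simp: S_def)
    then have "?X = W" using max X(2) by blast
    moreover have "1 \<odot> v \<in> ?X" using X(3) by blast
    ultimately show False using v sum(3) by auto
  qed
  then have "U <+>\<^bsub>V\<^esub> W = carrier V"
    using assms(2) sum(1) by (auto simp: diagonalizable_op_def)
  then show "\<exists>W. subspace class_ring W V \<and> A ` W \<subseteq> W \<and> U \<inter> W = {\<zero>} \<and> U <+>\<^bsub>V\<^esub> W = carrier V"
    using Ws by blast
qed

text \<open>If \<open>W\<close> is an invariant complement of \<open>Ker (A - \<nu>)\<close> and \<open>w = u + x\<close> accordingly, then \<open>(A - \<nu>) w = (A - \<nu>) x\<close>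
  lies in \<open>W\<close>; being also in the kernel, it vanishes. Thus a semisimple operator has no Jordan blocks.\<close>

lemma semisimple_kernel_square:
  assumes A: "lin A" and ss: "semisimple_op V A" and w: "w \<in> carrier V"
    and e: "A w \<ominus> \<nu> \<odot> w \<in> eigenspace V A \<nu>"
  shows "w \<in> eigenspace V A \<nu>"
proof -
  let ?U = "eigenspace V A \<nu>"
  note U = eigenspace_subspace[OF A, of \<nu>]
  have "A ` ?U \<subseteq> ?U" using sub_smult[OF U] by (auto simp: eigenspace_def)
  then obtain W where W: "subspace class_ring W V" "A ` W \<subseteq> W" "?U \<inter> W = {\<zero>}" "?U <+>\<^bsub>V\<^esub> W = carrier V"
    using ss U unfolding semisimple_op_def by blast
  from w obtain u x where ux: "u \<in> ?U" "x \<in> W" "w = u \<oplus> x" unfolding W(4)[symmetric] by (auto simp: set_add_def')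
  have c: "u \<in> carrier V" "x \<in> carrier V" "A x \<in> carrier V" using ux sub_carrier[OF W(1)] lin_closed[OF A] by (auto simp: eigenspace_def)
  have u: "A u = \<nu> \<odot> u" using ux(1) by (simp add: eigenspace_def)
  have "A w \<ominus> \<nu> \<odot> w = A x \<ominus> \<nu> \<odot> x"
    using c by (simp add: ux(3) u lin_simps[OF A] smult_r_distr minus_simps)
  moreover have "A x \<ominus> \<nu> \<odot> x \<in> W" using ux(2) W(1,2) by (intro sub_minus sub_smult) auto
  ultimately have "A x \<ominus> \<nu> \<odot> x \<in> {\<zero>}" using e W(3) by auto
  then have "x \<in> ?U" using c by (simp add: minus_eq_iff eigenspace_def)
  then show ?thesis using ux sub_add[OF U] by simp
qed

end


section \<open>Spectral projections\<close>

context class_vectorspace begin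

definition other_eigenspaces_span :: "('v \<Rightarrow> 'v) \<Rightarrow> 'k \<Rightarrow> 'v set" where
  "other_eigenspaces_span A \<nu> = span (\<Union>\<mu>\<in>spec V A - {\<nu>}. eigenspace V A \<mu>)"

lemma span_subsetI:
  assumes "S \<subseteq> E" "subspace class_ring E V" shows "span S \<subseteq> E"
  using span_is_subset[of S E] assms by (simp add: VectorSpace.subspace_def)

lemma other_eigenspaces_carrier: "(\<Union>\<mu>\<in>spec V A - {\<nu>}. eigenspace V A \<mu>) \<subseteq> carrier V"
  by (auto simp: eigenspace_def)

lemma other_eigenspaces_span_subspace: "subspace class_ring (other_eigenspaces_span A \<nu>) V"
  unfolding other_eigenspaces_span_def by (rule span_is_subspace[OF other_eigenspaces_carrier])

lemma eigenspace_trivial: "\<mu> \<notin> spec V A \<Longrightarrow> eigenspace V A \<mu> \<subseteq> {\<zero>}"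
  by (auto simp: spec_def eigenspace_def)

lemma eigenspace_subset_other_eigenspaces_span: "\<mu> \<noteq> \<nu> \<Longrightarrow> eigenspace V A \<mu> \<subseteq> other_eigenspaces_span A \<nu>"
proof (cases "\<mu> \<in> spec V A")
  case True
  assume "\<mu> \<noteq> \<nu>"
  then have "eigenspace V A \<mu> \<subseteq> (\<Union>\<mu>\<in>spec V A - {\<nu>}. eigenspace V A \<mu>)" using True by blast
  then show ?thesis unfolding other_eigenspaces_span_def using in_own_span[OF other_eigenspaces_carrier] by blast
next
  case False
  then show ?thesis using eigenspace_trivial sub_zero[OF other_eigenspaces_span_subspace] by blast
qed

lemma other_eigenspaces_span_subsetI:
  assumes "subspace class_ring E V" "\<And>\<mu>. \<mu> \<noteq> \<nu> \<Longrightarrow> eigenspace V A \<mu> \<subseteq> E"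
  shows "other_eigenspaces_span A \<nu> \<subseteq> E"
  unfolding other_eigenspaces_span_def using assms by (intro span_subsetI) auto

lemma shifted_image_subspace:
  assumes A: "lin A"
  shows "subspace class_ring ((\<lambda>b. A b \<ominus> \<nu> \<odot> b) ` carrier V) V"
proof (rule subspaceI)
  let ?I = "(\<lambda>b. A b \<ominus> \<nu> \<odot> b) ` carrier V"
  show "?I \<subseteq> carrier V" by (auto simp: lin_simps[OF A])
  show "\<zero> \<in> ?I" by (rule image_eqI[of _ _ \<zero>]) (simp_all add: lin_simps[OF A] minus_simps)
  show "x \<oplus> y \<in> ?I" if xy: "x \<in> ?I" "y \<in> ?I" for x y
  proof -
    from xy obtain b c where bc: "b \<in> carrier V" "c \<in> carrier V" "x = A b \<ominus> \<nu> \<odot> b" "y = A c \<ominus> \<nu> \<odot> c" by blast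
    show ?thesis
      by (rule image_eqI[of _ _ "b \<oplus> c"])
        (use bc in \<open>simp_all add: lin_simps[OF A] smult_r_distr minus_simps\<close>)
  qed
  show "k \<odot> x \<in> ?I" if x: "x \<in> ?I" for k x
  proof -
    from x obtain b where b: "b \<in> carrier V" "x = A b \<ominus> \<nu> \<odot> b" by blast
    show ?thesis
      by (rule image_eqI[of _ _ "k \<odot> b"])
        (use b in \<open>simp_all add: lin_simps[OF A] smult_minus_r mult.commute flip: smult_assoc1\<close>)
  qed
qed

text \<open>On \<open>Ker (A - \<mu>)\<close> the operator \<open>A - \<nu>\<close> is the nonzero scalar \<open>\<mu> - \<nu>\<close>.\<close>

lemma other_eigenspaces_span_subset_image:
  assumes A: "lin A"
  shows "other_eigenspaces_span A \<nu> \<subseteq> (\<lambda>b. A b \<ominus> \<nu> \<odot> b) ` carrier V"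
proof (rule other_eigenspaces_span_subsetI[OF shifted_image_subspace[OF A]], rule subsetI)
  fix \<mu> x assume "\<mu> \<noteq> \<nu>" "x \<in> eigenspace V A \<mu>"
  then have x: "x \<in> carrier V" "A x = \<mu> \<odot> x" "\<mu> - \<nu> \<noteq> 0" by (auto simp: eigenspace_def)
  have "A (inverse (\<mu> - \<nu>) \<odot> x) \<ominus> \<nu> \<odot> (inverse (\<mu> - \<nu>) \<odot> x) = inverse (\<mu> - \<nu>) \<odot> ((\<mu> - \<nu>) \<odot> x)"
    using x by (simp add: lin_simps[OF A] smult_minus_l smult_minus_r mult.commute flip: smult_assoc1)
  also have "\<dots> = x" using x by (intro smult_cancel)
  finally show "x \<in> (\<lambda>b. A b \<ominus> \<nu> \<odot> b) ` carrier V"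
    using x by (intro image_eqI[of _ _ "inverse (\<mu> - \<nu>) \<odot> x"]) auto
qed

text \<open>Uniqueness: the difference of two candidates lies in \<open>Ker (A - \<nu>)\<close> and in the image of \<open>A - \<nu>\<close>, and
  these meet trivially because \<open>A\<close> has no Jordan blocks.\<close>

lemma spectral_proj_eqI:
  assumes A: "lin A" and ss: "semisimple_op V A" and v: "v \<in> carrier V"
    and p: "p \<in> eigenspace V A \<nu>" "v \<ominus> p \<in> other_eigenspaces_span A \<nu>"
  shows "spectral_proj V A \<nu> v = p"
  unfolding spectral_proj_def other_eigenspaces_span_def[symmetric]
proof (rule the_equality)
  show "p \<in> eigenspace V A \<nu> \<and> v \<ominus> p \<in> other_eigenspaces_span A \<nu>" using p by simp
  fix q assume q: "q \<in> eigenspace V A \<nu> \<and> v \<ominus> q \<in> other_eigenspaces_span A \<nu>"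
  note E = eigenspace_subspace[OF A, of \<nu>]
  have c: "p \<in> carrier V" "q \<in> carrier V" using p q by (auto simp: eigenspace_def)
  have "q \<ominus> p = (v \<ominus> p) \<ominus> (v \<ominus> q)" using c v by (simp add: minus_simps)
  also have "\<dots> \<in> other_eigenspaces_span A \<nu>" using p q by (intro sub_minus[OF other_eigenspaces_span_subspace, of "v \<ominus> p" _ _ "v \<ominus> q"]) auto
  finally obtain x where x: "x \<in> carrier V" "q \<ominus> p = A x \<ominus> \<nu> \<odot> x"
    using other_eigenspaces_span_subset_image[OF A] by blast
  have "q \<ominus> p \<in> eigenspace V A \<nu>" using p q by (intro sub_minus[OF E]) auto
  then have "A x \<ominus> \<nu> \<odot> x \<in> eigenspace V A \<nu>" unfolding x(2) .
  then have "x \<in> eigenspace V A \<nu>" by (rule semisimple_kernel_square[OF A ss x(1)])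
  then have "A x = \<nu> \<odot> x" by (simp add: eigenspace_def)
  then have "q \<ominus> p = \<zero>" unfolding x(2) using x(1) by (simp add: minus_self)
  then show "q = p" using c by (simp add: minus_eq_iff)
qed

lemma spectral_decomposition:
  assumes A: "lin A" and d: "diagonalizable_op V A" and v: "v \<in> carrier V"
  obtains p where "p \<in> eigenspace V A \<nu>" "v \<ominus> p \<in> other_eigenspaces_span A \<nu>"
proof -
  note E = eigenspace_subspace[OF A, of \<nu>] and F = other_eigenspaces_span_subspace[of A \<nu>]
  note S = sum_subspace[OF E F]
  have "eigenspace V A \<mu> \<subseteq> eigenspace V A \<nu> <+>\<^bsub>V\<^esub> other_eigenspaces_span A \<nu>" for \<mu>
    using eigenspace_subset_other_eigenspaces_span[of \<mu> \<nu> A] S by (cases "\<mu> = \<nu>") auto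
  then have "v \<in> eigenspace V A \<nu> <+>\<^bsub>V\<^esub> other_eigenspaces_span A \<nu>"
    using d S(1) v by (auto simp: diagonalizable_op_def)
  then obtain p f where pf: "p \<in> eigenspace V A \<nu>" "f \<in> other_eigenspaces_span A \<nu>" "v = p \<oplus> f" by (rule set_add_memE)
  have "v \<ominus> p = f" using pf sub_carrier[OF E] sub_carrier[OF F] by (simp add: minus_simps)
  then show ?thesis using that pf by simp
qed

lemma spectral_proj_in_eigenspace:
  assumes A: "lin A" "semisimple_op V A" "diagonalizable_op V A" and v: "v \<in> carrier V"
  shows "spectral_proj V A \<nu> v \<in> eigenspace V A \<nu>"
proof -
  obtain p where p: "p \<in> eigenspace V A \<nu>" "v \<ominus> p \<in> other_eigenspaces_span A \<nu>"
    using spectral_decomposition[OF A(1,3) v] .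
  show ?thesis unfolding spectral_proj_eqI[OF A(1,2) v p] by (rule p(1))
qed

lemma spectral_proj_fixes_eigenspace:
  assumes A: "lin A" "semisimple_op V A" and v: "v \<in> eigenspace V A \<nu>"
  shows "spectral_proj V A \<nu> v = v"
proof -
  have "v \<in> carrier V" using v by (simp add: eigenspace_def)
  then show ?thesis
    using v sub_zero[OF other_eigenspaces_span_subspace] by (intro spectral_proj_eqI A) (simp_all add: minus_self)
qed

lemma spectral_proj_eq_zero_iff:
  assumes A: "lin A" "semisimple_op V A" "diagonalizable_op V A" and u: "u \<in> carrier V"
  shows "spectral_proj V A \<nu> u = \<zero> \<longleftrightarrow> u \<in> (\<lambda>b. A b \<ominus> \<nu> \<odot> b) ` carrier V"
proof
  assume "spectral_proj V A \<nu> u = \<zero>"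
  moreover obtain p where p: "p \<in> eigenspace V A \<nu>" "u \<ominus> p \<in> other_eigenspaces_span A \<nu>"
    using spectral_decomposition[OF A(1,3) u] .
  ultimately have "u \<ominus> \<zero> \<in> other_eigenspaces_span A \<nu>" using spectral_proj_eqI[OF A(1,2) u p] by simp
  then show "u \<in> (\<lambda>b. A b \<ominus> \<nu> \<odot> b) ` carrier V"
    unfolding minus_zero_right[OF u] by (rule subsetD[OF other_eigenspaces_span_subset_image[OF A(1)]])
next
  assume "u \<in> (\<lambda>b. A b \<ominus> \<nu> \<odot> b) ` carrier V"
  then obtain b where b: "b \<in> carrier V" "u = A b \<ominus> \<nu> \<odot> b" by blast
  obtain p where p: "p \<in> eigenspace V A \<nu>" "b \<ominus> p \<in> other_eigenspaces_span A \<nu>"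
    using spectral_decomposition[OF A(1,3) b(1)] .
  let ?F = "other_eigenspaces_span A \<nu>"
  note F = other_eigenspaces_span_subspace[of A \<nu>]
  have "subspace class_ring {x \<in> ?F. A x \<in> ?F} V"
    using sub_add[OF F] sub_smult[OF F] sub_zero[OF F] sub_carrier[OF F]
    by (intro subspaceI) (auto simp: lin_simps[OF A(1)])
  then have "?F \<subseteq> {x \<in> ?F. A x \<in> ?F}"
  proof (rule other_eigenspaces_span_subsetI, intro subsetI)
    fix \<mu> x assume "\<mu> \<noteq> \<nu>" "x \<in> eigenspace V A \<mu>"
    moreover then have "x \<in> ?F" "A x = \<mu> \<odot> x" using eigenspace_subset_other_eigenspaces_span[of \<mu> \<nu> A] by (auto simp: eigenspace_def)
    ultimately show "x \<in> {x \<in> ?F. A x \<in> ?F}" using sub_smult[OF F] by simp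
  qed
  then have AF: "A x \<in> ?F" if "x \<in> ?F" for x using that by blast
  have pc: "p \<in> carrier V" "A p = \<nu> \<odot> p" using p by (auto simp: eigenspace_def)
  have "u \<ominus> \<zero> = A (b \<ominus> p) \<ominus> \<nu> \<odot> (b \<ominus> p)"
    using b pc by (simp add: lin_simps[OF A(1)] smult_minus_r minus_simps)
  also have "\<dots> \<in> ?F" using AF[OF p(2)] sub_smult[OF F p(2)] by (intro sub_minus[OF F])
  finally show "spectral_proj V A \<nu> u = \<zero>"
    using sub_zero[OF eigenspace_subspace[OF A(1)]] u by (intro spectral_proj_eqI A)
qed

text \<open>The products of spectral projections vanish precisely if the equations \<open>(A - \<nu>) b = u\<close> are solvable for
  all eigenvectors \<open>u\<close> of \<open>B\<close> with eigenvalue \<open>\<nu>\<close>. Values \<open>\<nu>\<close> outside the common spectrum impose no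
  condition: either \<open>u = 0\<close>, or \<open>A - \<nu>\<close> is onto.\<close>

lemma spectral_proj_product_zero_iff:
  assumes A: "lin A" "semisimple_op V A" "diagonalizable_op V A"
    and B: "lin B" "semisimple_op V B" "diagonalizable_op V B"
  shows "(\<forall>\<nu>\<in>spec V A \<inter> spec V B. \<forall>v\<in>carrier V. spectral_proj V A \<nu> (spectral_proj V B \<nu> v) = \<zero>) \<longleftrightarrow>
    (\<forall>\<nu>. eigenspace V B \<nu> \<subseteq> (\<lambda>b. A b \<ominus> \<nu> \<odot> b) ` carrier V)"
    (is "?C \<longleftrightarrow> (\<forall>\<nu>. _ \<subseteq> ?I \<nu>)")
proof
  assume C: ?C
  show "\<forall>\<nu>. eigenspace V B \<nu> \<subseteq> ?I \<nu>"
  proof (intro allI subsetI)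
    fix \<nu> u assume u: "u \<in> eigenspace V B \<nu>"
    then have uc: "u \<in> carrier V" by (simp add: eigenspace_def)
    show "u \<in> ?I \<nu>"
    proof (cases "\<nu> \<in> spec V A \<inter> spec V B")
      case True
      then have "spectral_proj V A \<nu> u = \<zero>"
        using C uc spectral_proj_fixes_eigenspace[OF B(1,2) u] by metis
      then show ?thesis using spectral_proj_eq_zero_iff[OF A uc] by simp
    next
      case False
      then consider "\<nu> \<notin> spec V A" | "\<nu> \<notin> spec V B" by blast
      then show ?thesis
      proof cases
        case 1
        then have "spectral_proj V A \<nu> u = \<zero>"
          using eigenspace_trivial spectral_proj_in_eigenspace[OF A uc] by blast
        then show ?thesis using spectral_proj_eq_zero_iff[OF A uc] by simp
      next
        case 2
        then have "u = \<zero>" using eigenspace_trivial u by blast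
        then show ?thesis using sub_zero[OF shifted_image_subspace[OF A(1)]] by simp
      qed
    qed
  qed
next
  assume I: "\<forall>\<nu>. eigenspace V B \<nu> \<subseteq> ?I \<nu>"
  show ?C
  proof (intro ballI)
    fix \<nu> v assume v: "v \<in> carrier V"
    note e = spectral_proj_in_eigenspace[OF B v, of \<nu>]
    then have "spectral_proj V B \<nu> v \<in> carrier V" by (simp add: eigenspace_def)
    then show "spectral_proj V A \<nu> (spectral_proj V B \<nu> v) = \<zero>"
      using spectral_proj_eq_zero_iff[OF A] I e by blast
  qed
qed

end

context class_vectorspace begin

lemma add_diff_add_uminus:
  assumes "a \<in> carrier V" "c \<in> carrier V" "d \<in> carrier V"
  shows "a \<oplus> (c \<ominus> d) \<oplus> \<ominus> c = a \<oplus> \<ominus> d"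
proof -
  have "a \<oplus> (c \<ominus> d) \<ominus> c = a \<ominus> d" using assms by (simp add: minus_simps)
  then show ?thesis by (simp only: M.minus_eq)
qed

lemma uminus_zero: "\<ominus> \<zero> = \<zero>"
  by (simp add: neg_eq_smult)

lemma smult_uminus: "v \<in> carrier V \<Longrightarrow> c \<odot> (\<ominus> v) = \<ominus> (c \<odot> v)"
  by (simp add: neg_eq_smult mult.commute flip: smult_assoc1)

lemma eigenspace_uminus:
  assumes A: "lin A" shows "eigenspace V (\<lambda>v. \<ominus> A v) \<nu> = eigenspace V A (- \<nu>)"
proof -
  have "\<ominus> A v = \<nu> \<odot> v \<longleftrightarrow> A v = (- \<nu>) \<odot> v" if v: "v \<in> carrier V" for v
  proof -
    have "(- \<nu>) \<odot> v = \<ominus> (\<nu> \<odot> v)" using v by (simp add: neg_eq_smult flip: smult_assoc1)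
    moreover have "\<ominus> x = y \<longleftrightarrow> x = \<ominus> y" if "x \<in> carrier V" "y \<in> carrier V" for x y
      using that by auto
    ultimately show ?thesis using v lin_closed[OF A v] by simp
  qed
  then show ?thesis by (auto simp: eigenspace_def)
qed

lemma spec_uminus:
  assumes A: "lin A" shows "spec V (\<lambda>v. \<ominus> A v) = uminus ` spec V A"
proof -
  have *: "\<nu> \<in> spec V B \<longleftrightarrow> (\<exists>v\<in>eigenspace V B \<nu>. v \<noteq> \<zero>)" for B \<nu>
    by (auto simp: spec_def eigenspace_def)
  have iff: "\<nu> \<in> spec V (\<lambda>v. \<ominus> A v) \<longleftrightarrow> - \<nu> \<in> spec V A" for \<nu>
    unfolding * eigenspace_uminus[OF A] ..
  show ?thesis
  proof (rule equalityI; rule subsetI)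
    fix \<nu> assume "\<nu> \<in> spec V (\<lambda>v. \<ominus> A v)"
    then show "\<nu> \<in> uminus ` spec V A" unfolding iff by (intro image_eqI[of _ _ "- \<nu>"]) simp_all
  next
    fix \<nu> assume "\<nu> \<in> uminus ` spec V A"
    then show "\<nu> \<in> spec V (\<lambda>v. \<ominus> A v)" unfolding iff by (elim imageE) simp
  qed
qed

lemma lin_uminus: "lin A \<Longrightarrow> lin (\<lambda>v. \<ominus> A v)"
  by (rule linI) (simp_all add: lin_simps neg_eq_smult smult_r_distr mult.commute flip: smult_assoc1)

lemma diagonalizable_uminus:
  assumes A: "lin A" and d: "diagonalizable_op V A"
  shows "diagonalizable_op V (\<lambda>v. \<ominus> A v)"
  unfolding diagonalizable_op_def eigenspace_uminus[OF A]
proof (intro allI impI, elim conjE)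
  fix E assume E: "subspace class_ring E V" "\<forall>\<nu>. eigenspace V A (- \<nu>) \<subseteq> E"
  have "eigenspace V A \<nu> \<subseteq> E" for \<nu> using spec[OF E(2), of "- \<nu>"] by simp
  then show "E = carrier V" using d E(1) by (simp add: diagonalizable_op_def)
qed

end

lemma (in class_vectorspace) semisimple_uminus:
  assumes A: "lin A" and ss: "semisimple_op V A"
  shows "semisimple_op V (\<lambda>v. \<ominus> A v)"
proof -
  have "(\<lambda>v. \<ominus> A v) ` U \<subseteq> U \<longleftrightarrow> A ` U \<subseteq> U" if U: "subspace class_ring U V" for U
  proof -
    have "\<ominus> A v \<in> U \<longleftrightarrow> A v \<in> U" if "v \<in> U" for v
      using sub_neg[OF U, of "A v"] sub_neg[OF U, of "\<ominus> A v"] lin_closed[OF A sub_carrier[OF U that]] by auto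
    then show ?thesis by auto
  qed
  then show ?thesis using ss unfolding semisimple_op_def by (simp cong: conj_cong)
qed


section \<open>Operators with split minimal polynomial\<close>

context class_vectorspace begin

lemma funpow_closed: "lin A \<Longrightarrow> v \<in> carrier V \<Longrightarrow> (A ^^ i) v \<in> carrier V"
  by (induction i) (auto simp: lin_closed)

lemma poly_op_eq_sum:
  assumes A: "lin A" and v: "v \<in> carrier V" and m: "degree p \<le> m"
  shows "poly_op V p A v = (\<Oplus>i\<in>{..m}. coeff p i \<odot> (A ^^ i) v)"
  unfolding poly_op_def
  by (rule M.add.finprod_mono_neutral_cong_left)
    (use m v in \<open>auto simp: coeff_eq_0 funpow_closed[OF A]\<close>)

lemma poly_op_closed: "lin A \<Longrightarrow> v \<in> carrier V \<Longrightarrow> poly_op V p A v \<in> carrier V"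
  unfolding poly_op_def by (intro M.finsum_closed) (auto simp: funpow_closed)

lemma poly_op_0 [simp]: "v \<in> carrier V \<Longrightarrow> poly_op V 0 A v = \<zero>"
  by (simp add: poly_op_def)

text \<open>Horner's rule, through which all properties of \<open>poly_op\<close> follow by induction on the polynomial.\<close>

lemma poly_op_pCons:
  assumes A: "lin A" and v: "v \<in> carrier V"
  shows "poly_op V (pCons a p) A v = a \<odot> v \<oplus> poly_op V p A (A v)"
proof -
  have "poly_op V (pCons a p) A v = (\<Oplus>i\<in>{..Suc (degree p)}. coeff (pCons a p) i \<odot> (A ^^ i) v)"
    by (rule poly_op_eq_sum[OF A v]) (simp add: degree_pCons_le)
  also have "\<dots> = (\<Oplus>i\<in>{..degree p}. coeff (pCons a p) (Suc i) \<odot> (A ^^ Suc i) v) \<oplus> coeff (pCons a p) 0 \<odot> (A ^^ 0) v"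
    using funpow_closed[OF A v] by (intro M.finsum_Suc2) auto
  also have "(\<Oplus>i\<in>{..degree p}. coeff (pCons a p) (Suc i) \<odot> (A ^^ Suc i) v) = poly_op V p A (A v)"
    by (simp add: poly_op_def funpow_swap1)
  finally show ?thesis using v poly_op_closed[OF A] lin_closed[OF A] by (simp add: M.a_comm)
qed

lemma poly_op_1: "lin A \<Longrightarrow> v \<in> carrier V \<Longrightarrow> poly_op V 1 A v = v"
  by (simp add: one_pCons poly_op_pCons lin_closed)

lemma poly_op_lin: "lin A \<Longrightarrow> lin (poly_op V p A)"
proof (induction p)
  case 0
  show ?case by (rule linI) simp_all
next
  case (pCons a p)
  note A = pCons.prems and IH = pCons.IH[OF pCons.prems]
  show ?case
    by (rule linI)
      (simp_all add: poly_op_pCons[OF A] lin_simps[OF A] lin_simps[OF IH] smult_r_distr M.a_ac mult.commute flip: smult_assoc1)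
qed

lemma poly_op_add:
  "lin A \<Longrightarrow> v \<in> carrier V \<Longrightarrow> poly_op V (p + q) A v = poly_op V p A v \<oplus> poly_op V q A v"
proof (induction p q arbitrary: v rule: poly_induct2)
  case (pCons a p b q)
  then show ?case
    by (simp add: poly_op_pCons poly_op_closed lin_closed smult_l_distr M.a_ac)
qed simp

lemma poly_op_smult:
  "lin A \<Longrightarrow> v \<in> carrier V \<Longrightarrow> poly_op V (Polynomial.smult c p) A v = c \<odot> poly_op V p A v"
proof (induction p arbitrary: v)
  case (pCons a p)
  then show ?case
    by (simp add: poly_op_pCons poly_op_closed lin_closed smult_r_distr smult_assoc1)
qed simp

lemma poly_op_diff:
  "lin A \<Longrightarrow> v \<in> carrier V \<Longrightarrow> poly_op V (p - q) A v = poly_op V p A v \<ominus> poly_op V q A v"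
proof -
  assume *: "lin A" "v \<in> carrier V"
  have "p - q = p + Polynomial.smult (- 1) q" by simp
  then have "poly_op V (p - q) A v = poly_op V p A v \<oplus> (- 1) \<odot> poly_op V q A v"
    using * by (simp only: poly_op_add poly_op_smult)
  then show ?thesis using * by (simp add: neg_eq_smult M.minus_eq poly_op_closed)
qed

lemma poly_op_commute:
  "lin A \<Longrightarrow> v \<in> carrier V \<Longrightarrow> A (poly_op V p A v) = poly_op V p A (A v)"
  by (induction p arbitrary: v) (simp_all add: poly_op_pCons poly_op_closed lin_simps)

lemma poly_op_mult:
  "lin A \<Longrightarrow> v \<in> carrier V \<Longrightarrow> poly_op V (p * q) A v = poly_op V p A (poly_op V q A v)"
proof (induction p arbitrary: v)
  case (pCons a p)
  then show ?case
    by (simp add: poly_op_pCons poly_op_closed lin_closed poly_op_add poly_op_smult poly_op_commute)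
qed (simp add: poly_op_closed)

lemma poly_op_monom_sum:
  assumes A: "lin A" and v: "v \<in> carrier V"
  shows "poly_op V (\<Sum>i\<le>m. monom (a i) i) A v = (\<Oplus>i\<in>{..m}. a i \<odot> (A ^^ i) v)"
proof -
  have "coeff (\<Sum>i\<le>m. monom (a i) i) j = (if j \<le> m then a j else 0)" for j
    by (simp add: coeff_sum)
  moreover have "degree (\<Sum>i\<le>m. monom (a i) i) \<le> m"
    by (intro degree_sum_le) (auto intro: order.trans[OF degree_monom_le])
  ultimately show ?thesis
    using funpow_closed[OF A v]
    by (subst poly_op_eq_sum[OF A v]) (auto intro!: M.finsum_cong')
qed

text \<open>The \<open>dim + 1\<close> vectors \<open>v, A v, \<dots>, A\<^bsup>dim\<^esup> v\<close> satisfy a linear relation; if two of them coincide, the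
  difference of two monomials already annihilates \<open>v\<close>.\<close>

lemma vector_annihilator_exists:
  assumes A: "lin A" and v: "v \<in> carrier V" and fd: fin_dim
  shows "\<exists>p. p \<noteq> 0 \<and> poly_op V p A v = \<zero>"
proof -
  define f where "f i = (A ^^ i) v" for i
  have f: "f i \<in> carrier V" for i unfolding f_def by (rule funpow_closed[OF A v])
  show ?thesis
  proof (cases "inj_on f {..dim}")
    case True
    let ?S = "f ` {..dim}"
    have S: "finite ?S" "?S \<subseteq> carrier V" using f by auto
    have "card ?S = Suc dim" using True by (simp add: card_image)
    then have "lin_dep ?S" using li_le_dim(2)[OF fd S(2)] by force
    then obtain a w where a: "lincomb a ?S = \<zero>" "w \<in> ?S" "a w \<noteq> 0"
      using finite_lin_dep[OF S(1) _ S(2)] by auto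
    define p where "p = (\<Sum>i\<le>dim. monom (a (f i)) i)"
    obtain j where j: "j \<le> dim" "w = f j" using a(2) by auto
    have "coeff p j = a (f j)" using j by (simp add: p_def coeff_sum)
    then have "p \<noteq> 0" using a(3) j by auto
    moreover have "poly_op V p A v = (\<Oplus>i\<in>{..dim}. a (f i) \<odot> f i)"
      unfolding p_def poly_op_monom_sum[OF A v] f_def ..
    moreover have "(\<Oplus>i\<in>{..dim}. a (f i) \<odot> f i) = lincomb a ?S"
      unfolding lincomb_def using f by (intro M.finsum_reindex[symmetric] True) auto
    ultimately show ?thesis using a(1) by auto
  next
    case False
    then obtain i j where ij: "i \<noteq> j" "f i = f j" by (auto simp: inj_on_def)
    define p :: "'k poly" where "p = monom 1 i - monom 1 j"
    have mon: "poly_op V (monom 1 i) A v = f i" for i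
    proof -
      have "poly_op V (monom 1 i) A w = (A ^^ i) w" if "w \<in> carrier V" for w
        using that
        by (induction i arbitrary: w)
          (simp_all add: monom_Suc poly_op_pCons[OF A] poly_op_1[OF A] lin_closed[OF A]
            funpow_closed[OF A] funpow_swap1 monom_0)
      then show ?thesis using v by (simp add: f_def)
    qed
    have "coeff p i = 1" using ij by (simp add: p_def)
    then have "p \<noteq> 0" by auto
    moreover have "poly_op V p A v = \<zero>"
      unfolding p_def using f by (simp add: poly_op_diff[OF A v] mon ij(2) minus_eq_iff)
    ultimately show ?thesis by blast
  qed
qed

text \<open>Multiply the annihilators of the vectors of a finite generating set.\<close>

lemma annihilator_exists:
  assumes A: "lin A" and fd: fin_dim
  shows "\<exists>p. p \<noteq> 0 \<and> annihilates V p A"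
proof -
  obtain S where S: "finite S" "S \<subseteq> carrier V" "span S = carrier V" using fd by (auto simp: fin_dim_def)
  have "\<exists>p. p \<noteq> 0 \<and> (\<forall>v\<in>S. poly_op V p A v = \<zero>)" using S(1,2)
  proof (induction S)
    case empty
    show ?case by (rule exI[of _ 1]) simp
  next
    case (insert v S)
    then obtain p where p: "p \<noteq> 0" "\<forall>v\<in>S. poly_op V p A v = \<zero>" by auto
    obtain q where q: "q \<noteq> 0" "poly_op V q A v = \<zero>"
      using vector_annihilator_exists[OF A _ fd] insert.prems by auto
    have "poly_op V (q * p) A w = \<zero>" if "w \<in> insert v S" for w
    proof (cases "w = v")
      case True
      then show ?thesis
        using q insert.prems lin_zero[OF poly_op_lin[OF A]]
        by (subst mult.commute) (simp add: poly_op_mult[OF A])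
    next
      case False
      then show ?thesis
        using p that insert.prems lin_zero[OF poly_op_lin[OF A]] by (auto simp: poly_op_mult[OF A])
    qed
    then show ?case using p(1) q(1) by (intro exI[of _ "q * p"]) simp
  qed
  then obtain p where p: "p \<noteq> 0" "\<forall>v\<in>S. poly_op V p A v = \<zero>" by blast
  note L = poly_op_lin[OF A, of p]
  have "subspace class_ring {v \<in> carrier V. poly_op V p A v = \<zero>} V"
    by (rule subspaceI) (auto simp: lin_simps[OF L])
  then have "span S \<subseteq> {v \<in> carrier V. poly_op V p A v = \<zero>}"
    using p(2) S(2) by (intro span_subsetI) auto
  then show ?thesis using p(1) S(3) by (auto simp: annihilates_def)
qed

text \<open>\<open>min_poly\<close> is a definite description, so existence and uniqueness have to be shown before anything can be
  said about it. The difference of two monic annihilators of the same minimal degree has smaller degree.\<close>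

lemma min_poly_properties:
  assumes A: "lin A" and fd: fin_dim
  shows "lead_coeff (min_poly V A) = 1" "annihilates V (min_poly V A) A"
proof -
  let ?P = "\<lambda>p. lead_coeff p = 1 \<and> annihilates V p A \<and>
    (\<forall>q. q \<noteq> 0 \<and> annihilates V q A \<longrightarrow> degree p \<le> degree q)"
  \<comment> \<open>Some nonzero annihilator of least degree, made monic below.\<close>
  let ?p = "ARG_MIN degree p. p \<noteq> 0 \<and> annihilates V p A"
  obtain p where p: "p \<noteq> 0" "annihilates V p A"
    and min: "\<And>q. q \<noteq> 0 \<Longrightarrow> annihilates V q A \<Longrightarrow> degree p \<le> degree q"
    using that[of ?p] annihilator_exists[OF A fd]
      arg_min_nat_lemma[of "\<lambda>p. p \<noteq> 0 \<and> annihilates V p A" _ degree] by blast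
  let ?m = "Polynomial.smult (inverse (lead_coeff p)) p"
  have m: "?P ?m" using p min by (auto simp: annihilates_def poly_op_smult[OF A])
  have uniq: "q = r" if "?P q" "?P r" for q r
  proof (rule ccontr)
    assume "q \<noteq> r"
    have "q \<noteq> 0" "r \<noteq> 0" using that by auto
    then have deg: "degree q = degree r" using that by (intro antisym) blast+
    have "annihilates V (q - r) A" using that by (auto simp: annihilates_def poly_op_diff[OF A] minus_eq_iff)
    then have "degree q \<le> degree (q - r)" using that(1) \<open>q \<noteq> r\<close> by auto
    moreover have "degree (q - r) \<le> degree q" using deg by (intro degree_diff_le) auto
    ultimately have "lead_coeff (q - r) = 0" using that deg by simp
    then have "q - r = 0" by (simp only: leading_coeff_0_iff)
    then show False using \<open>q \<noteq> r\<close> by simp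
  qed
  have "\<exists>!p. ?P p"
    by (rule ex1I[of ?P, OF m], rule uniq, assumption, rule m)
  from theI'[OF this] show "lead_coeff (min_poly V A) = 1" "annihilates V (min_poly V A) A"
    unfolding min_poly_def by blast+
qed

text \<open>Apply the factors \<open>A - a\<close> to \<open>w\<close> one after the other: the last vector before zero is an eigenvector.\<close>

lemma eigenvector_exists:
  assumes A: "lin A" and W: "subspace class_ring W V" "A ` W \<subseteq> W"
    and w: "w \<in> W" "w \<noteq> \<zero>" "poly_op V (\<Prod>a\<leftarrow>as. [:- a, 1:]) A w = \<zero>"
  shows "\<exists>a. \<exists>x\<in>W. x \<noteq> \<zero> \<and> A x = a \<odot> x"
  using w
proof (induction as arbitrary: w)
  case Nil
  then show ?case using poly_op_1[OF A] sub_carrier[OF W(1)] by simp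
next
  case (Cons a as)
  let ?p = "\<Prod>a\<leftarrow>as. [:- a, 1:]" and ?x = "A w \<ominus> a \<odot> w"
  have wc: "w \<in> carrier V" "A w \<in> carrier V" using Cons.prems sub_carrier[OF W(1)] lin_closed[OF A] by auto
  have "poly_op V [:- a, 1:] A w = ?x"
    using wc by (simp add: poly_op_pCons[OF A] lin_closed[OF A] M.minus_eq neg_eq_smult M.a_comm flip: smult_assoc1)
  then have "poly_op V ?p A ?x = poly_op V (?p * [:- a, 1:]) A w" using wc by (simp only: poly_op_mult[OF A])
  also have "\<dots> = \<zero>" using Cons.prems(3) by (simp only: list.map prod_list.Cons mult.commute)
  finally have x: "poly_op V ?p A ?x = \<zero>" .
  have xW: "?x \<in> W" using W Cons.prems(1) by (intro sub_minus sub_smult) auto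
  show ?case
  proof (cases "?x = \<zero>")
    case True
    then show ?thesis using Cons.prems wc by (auto simp: minus_eq_iff)
  next
    case False
    then show ?thesis using Cons.IH xW x by blast
  qed
qed

text \<open>The span of all eigenvectors is invariant, and an invariant complement would contain a further eigenvector
  unless it is zero.\<close>

lemma semisimple_split_imp_diagonalizable:
  assumes A: "lin A" and fd: fin_dim and ss: "semisimple_op V A" and sp: "splits (min_poly V A)"
  shows "diagonalizable_op V A"
proof -
  obtain as where as: "min_poly V A = (\<Prod>a\<leftarrow>as. [:- a, 1:])"
    using sp min_poly_properties(1)[OF A fd] by (auto simp: splits_def)
  let ?S = "\<Union>\<mu>. eigenspace V A \<mu>"
  have S: "?S \<subseteq> carrier V" by (auto simp: eigenspace_def)
  note U = span_is_subspace[OF S] and SU = in_own_span[OF S]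
  have "subspace class_ring {x \<in> span ?S. A x \<in> span ?S} V"
    using sub_add[OF U] sub_smult[OF U] sub_zero[OF U] sub_carrier[OF U]
    by (intro subspaceI) (auto simp: lin_simps[OF A])
  then have "span ?S \<subseteq> {x \<in> span ?S. A x \<in> span ?S}"
  proof (rule span_subsetI[rotated], intro subsetI)
    fix x assume x: "x \<in> ?S"
    then obtain \<mu> where "A x = \<mu> \<odot> x" by (auto simp: eigenspace_def)
    then show "x \<in> {x \<in> span ?S. A x \<in> span ?S}" using x SU sub_smult[OF U] by auto
  qed
  then have "A ` span ?S \<subseteq> span ?S" by blast
  then obtain W where W: "subspace class_ring W V" "A ` W \<subseteq> W" "span ?S \<inter> W = {\<zero>}"
    "span ?S <+>\<^bsub>V\<^esub> W = carrier V"
    using ss U unfolding semisimple_op_def by blast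
  have "W = {\<zero>}"
  proof (rule ccontr)
    assume "W \<noteq> {\<zero>}"
    then obtain w where w: "w \<in> W" "w \<noteq> \<zero>" using sub_zero[OF W(1)] by blast
    then have "poly_op V (\<Prod>a\<leftarrow>as. [:- a, 1:]) A w = \<zero>"
      using min_poly_properties(2)[OF A fd] sub_carrier[OF W(1)] by (simp add: as annihilates_def)
    from eigenvector_exists[OF A W(1,2) w this] obtain a x where x: "x \<in> W" "x \<noteq> \<zero>" "A x = a \<odot> x" by blast
    then have "x \<in> ?S" using sub_carrier[OF W(1)] by (auto simp: eigenspace_def)
    then show False using W(3) x SU by blast
  qed
  then have "carrier V \<subseteq> span ?S" using W(4) sub_carrier[OF U] by (auto simp: set_add_def')
  then show ?thesis
    using span_subsetI[of ?S] unfolding diagonalizable_op_def by (blast dest: sub_carrier)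
qed

end


section \<open>Powers and quotients of vector spaces\<close>

lemma power_space_simps:
  "carrier (power_space n V) = {1..n} \<rightarrow>\<^sub>E carrier V"
  "v \<oplus>\<^bsub>power_space n V\<^esub> w = (\<lambda>j\<in>{1..n}. v j \<oplus>\<^bsub>V\<^esub> w j)"
  "\<zero>\<^bsub>power_space n V\<^esub> = (\<lambda>j\<in>{1..n}. \<zero>\<^bsub>V\<^esub>)"
  "c \<odot>\<^bsub>power_space n V\<^esub> w = (\<lambda>j\<in>{1..n}. c \<odot>\<^bsub>V\<^esub> w j)"
  by (simp_all add: power_space_def)

context class_vectorspace begin

lemma power_ext:
  assumes "v \<in> carrier (power_space n V)" "w \<in> carrier (power_space n V)"
    and "\<And>j. j \<in> {1..n} \<Longrightarrow> v j = w j"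
  shows "v = w"
  using assms by (intro extensionalityI[of _ "{1..n}"]) (auto simp: power_space_simps PiE_def)

lemma power_apply: "v \<in> carrier (power_space n V) \<Longrightarrow> j \<in> {1..n} \<Longrightarrow> v j \<in> carrier V"
  by (auto simp: power_space_simps PiE_def)

lemma power_space_vectorspace: "class_vectorspace (power_space n V)"
proof (rule class_vectorspace.intro)
  show "vectorspace class_ring (power_space n V)"
  proof (rule vs_criteria)
    show "field (class_ring :: 'k ring)" by (rule class_field)
    show "\<forall>v\<in>carrier (power_space n V). \<exists>neg_v\<in>carrier (power_space n V).
        v \<oplus>\<^bsub>power_space n V\<^esub> neg_v = \<zero>\<^bsub>power_space n V\<^esub>"
    proof
      fix v assume v: "v \<in> carrier (power_space n V)"
      show "\<exists>neg_v\<in>carrier (power_space n V). v \<oplus>\<^bsub>power_space n V\<^esub> neg_v = \<zero>\<^bsub>power_space n V\<^esub>"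
        by (rule bexI[of _ "\<lambda>j\<in>{1..n}. \<ominus> v j"])
          (use power_apply[OF v] in \<open>auto simp: power_space_simps M.r_neg intro!: restrict_ext\<close>)
    qed
  qed (auto simp: power_space_simps PiE_mem smult_l_distr smult_r_distr smult_assoc1 M.a_ac
      PiE_def extensional_def fun_eq_iff Pi_iff)
qed

lemma subspace_abelian_subgroup:
  assumes "subspace class_ring U V" shows "abelian_subgroup U V"
proof (rule abelian_subgroupI3)
  show "additive_subgroup U V"
    by (rule additive_subgroupI, rule M.add.subgroupI)
      (use assms sub_zero sub_carrier sub_neg sub_add in \<open>auto simp: a_inv_def\<close>)
qed (rule M.abelian_group_axioms)

lemma coset_mem_iff:
  assumes U: "subspace class_ring U V" and v: "v \<in> carrier V"
  shows "x \<in> U +>\<^bsub>V\<^esub> v \<longleftrightarrow> x \<in> carrier V \<and> x \<ominus> v \<in> U"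
proof
  assume "x \<in> U +>\<^bsub>V\<^esub> v"
  then obtain u where "u \<in> U" "x = u \<oplus> v" by (auto simp: a_r_coset_def')
  then show "x \<in> carrier V \<and> x \<ominus> v \<in> U" using v sub_carrier[OF U] by (simp add: M.minus_eq M.a_assoc M.r_neg)
next
  assume x: "x \<in> carrier V \<and> x \<ominus> v \<in> U"
  then have "x = (x \<ominus> v) \<oplus> v" using v by (simp add: M.minus_eq M.a_assoc M.l_neg)
  then show "x \<in> U +>\<^bsub>V\<^esub> v" using x by (auto simp: a_r_coset_def')
qed

lemma coset_eq_iff:
  assumes U: "subspace class_ring U V" and "v \<in> carrier V" "w \<in> carrier V"
  shows "U +>\<^bsub>V\<^esub> v = U +>\<^bsub>V\<^esub> w \<longleftrightarrow> v \<ominus> w \<in> U"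
proof -
  interpret U: abelian_subgroup U V by (rule subspace_abelian_subgroup[OF U])
  have "v \<ominus> w \<in> U \<longleftrightarrow> v \<in> U +>\<^bsub>V\<^esub> w" using assms by (simp add: coset_mem_iff)
  then show ?thesis
    using assms(2,3) U.a_repr_independence' U.a_rcos_self by metis
qed

text \<open>Both the scalar multiplication and the induced operators of a quotient space are defined as unions of cosets
  over all representatives; the union collapses because every representative gives the same coset.\<close>

lemma coset_union:
  assumes U: "subspace class_ring U V" and v: "v \<in> carrier V"
    and F: "\<And>x. x \<in> carrier V \<Longrightarrow> F x \<in> carrier V"
    and FU: "\<And>x. x \<in> carrier V \<Longrightarrow> x \<ominus> v \<in> U \<Longrightarrow> F x \<ominus> F v \<in> U"
  shows "(\<Union>x\<in>U +>\<^bsub>V\<^esub> v. U +>\<^bsub>V\<^esub> F x) = U +>\<^bsub>V\<^esub> F v"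
proof -
  have "U +>\<^bsub>V\<^esub> F x = U +>\<^bsub>V\<^esub> F v" if "x \<in> U +>\<^bsub>V\<^esub> v" for x
    using that v by (simp add: coset_mem_iff[OF U] coset_eq_iff[OF U] F FU)
  moreover have "v \<in> U +>\<^bsub>V\<^esub> v"
    using v sub_zero[OF U] by (simp add: coset_mem_iff[OF U] minus_self)
  ultimately show ?thesis by blast
qed

lemma coset_smult:
  assumes U: "subspace class_ring U V" and v: "v \<in> carrier V"
  shows "c \<odot>\<^bsub>quotient_space V U\<^esub> (U +>\<^bsub>V\<^esub> v) = U +>\<^bsub>V\<^esub> (c \<odot> v)"
  using coset_union[OF U v, of "\<lambda>x. c \<odot> x"] v sub_smult[OF U]
  by (simp add: quotient_space_def flip: smult_minus_r)

lemma coset_add: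
  assumes U: "subspace class_ring U V" and v: "v \<in> carrier V" and w: "w \<in> carrier V"
  shows "(U +>\<^bsub>V\<^esub> v) \<oplus>\<^bsub>quotient_space V U\<^esub> (U +>\<^bsub>V\<^esub> w) = U +>\<^bsub>V\<^esub> (v \<oplus> w)"
  using abelian_subgroup.a_rcos_sum[OF subspace_abelian_subgroup[OF U] v w] by (simp add: quotient_space_def)

lemma quotient_carrier: "carrier (quotient_space V U) = (\<lambda>v. U +>\<^bsub>V\<^esub> v) ` carrier V"
  by (auto simp: quotient_space_def A_RCOSETS_def')

lemma coset_zero:
  assumes U: "subspace class_ring U V"
  shows "\<zero>\<^bsub>quotient_space V U\<^esub> = U +>\<^bsub>V\<^esub> \<zero>"
  using sub_carrier[OF U] by (simp add: quotient_space_def subset_iff)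

lemma quotient_space_vectorspace:
  assumes U: "subspace class_ring U V"
  shows "class_vectorspace (quotient_space V U)"
proof (rule class_vectorspace.intro)
  note c = coset_add[OF U] coset_smult[OF U] coset_zero[OF U]
  show "vectorspace class_ring (quotient_space V U)"
  proof (rule vs_criteria)
    show "field (class_ring :: 'k ring)" by (rule class_field)
    show "\<forall>v\<in>carrier (quotient_space V U). \<exists>neg_v\<in>carrier (quotient_space V U).
        v \<oplus>\<^bsub>quotient_space V U\<^esub> neg_v = \<zero>\<^bsub>quotient_space V U\<^esub>"
    proof
      fix X assume "X \<in> carrier (quotient_space V U)"
      then obtain v where v: "v \<in> carrier V" "X = U +>\<^bsub>V\<^esub> v" by (auto simp: quotient_carrier)
      show "\<exists>neg_v\<in>carrier (quotient_space V U). X \<oplus>\<^bsub>quotient_space V U\<^esub> neg_v = \<zero>\<^bsub>quotient_space V U\<^esub>"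
        by (rule bexI[of _ "U +>\<^bsub>V\<^esub> (\<ominus> v)"])
          (use v in \<open>simp_all add: c quotient_carrier M.r_neg\<close>)
    qed
  qed (auto simp: quotient_carrier c smult_l_distr smult_r_distr smult_assoc1 M.a_ac)
qed

lemma quotient_map_coset:
  assumes U: "subspace class_ring U V" and A: "lin A" "A ` U \<subseteq> U" and v: "v \<in> carrier V"
  shows "quotient_map V U A (U +>\<^bsub>V\<^esub> v) = U +>\<^bsub>V\<^esub> A v"
proof -
  have "U +>\<^bsub>V\<^esub> v \<in> a_rcosets\<^bsub>V\<^esub> U" using v by (auto simp: A_RCOSETS_def')
  moreover have "A x \<ominus> A v \<in> U" if "x \<in> carrier V" "x \<ominus> v \<in> U" for x
    using that v A(2) lin_minus[OF A(1), of x v] by (metis image_subset_iff)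
  ultimately show ?thesis
    using coset_union[OF U v, of A] lin_closed[OF A(1)] by (simp add: quotient_map_def)
qed

text \<open>The image of an eigenvector in the quotient is an eigenvector or zero, so the preimage of a subspace that
  contains the eigenspaces of the quotient contains those of \<open>V\<close>.\<close>

lemma diagonalizable_quotient:
  assumes U: "subspace class_ring U V" and A: "lin A" "A ` U \<subseteq> U" and d: "diagonalizable_op V A"
  shows "diagonalizable_op (quotient_space V U) (quotient_map V U A)"
  unfolding diagonalizable_op_def
proof (intro allI impI, elim conjE)
  interpret Q: class_vectorspace "quotient_space V U" by (rule quotient_space_vectorspace[OF U])
  note c = coset_add[OF U] coset_smult[OF U] coset_zero[OF U]
  fix E assume E: "subspace class_ring E (quotient_space V U)"
    and sub: "\<forall>\<nu>. eigenspace (quotient_space V U) (quotient_map V U A) \<nu> \<subseteq> E"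
  let ?E = "{v \<in> carrier V. U +>\<^bsub>V\<^esub> v \<in> E}"
  have "subspace class_ring ?E V"
    using Q.sub_zero[OF E] Q.sub_add[OF E] Q.sub_smult[OF E]
    by (intro subspaceI) (auto simp flip: c)
  moreover have "eigenspace V A \<nu> \<subseteq> ?E" for \<nu>
  proof
    fix v assume "v \<in> eigenspace V A \<nu>"
    then have v: "v \<in> carrier V" "A v = \<nu> \<odot> v" by (auto simp: eigenspace_def)
    then have "U +>\<^bsub>V\<^esub> v \<in> eigenspace (quotient_space V U) (quotient_map V U A) \<nu>"
      by (simp add: eigenspace_def quotient_carrier quotient_map_coset[OF U A] c)
    then show "v \<in> ?E" using sub v by blast
  qed
  ultimately have "?E = carrier V" using d by (auto simp: diagonalizable_op_def)
  then show "E = carrier (quotient_space V U)"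
    using Q.sub_carrier[OF E] by (auto simp: quotient_carrier)
qed

lemma quotient_map_lin:
  assumes U: "subspace class_ring U V" and A: "lin A" "A ` U \<subseteq> U"
  shows "class_vectorspace.lin (quotient_space V U) (quotient_map V U A)"
  by (rule class_vectorspace.linI[OF quotient_space_vectorspace[OF U]])
    (auto simp: quotient_carrier quotient_map_coset[OF U A] coset_add[OF U] coset_smult[OF U] lin_simps[OF A(1)])

lemma semisimple_quotient:
  assumes U: "subspace class_ring U V" and A: "lin A" "A ` U \<subseteq> U" and d: "diagonalizable_op V A"
  shows "semisimple_op (quotient_space V U) (quotient_map V U A)"
  by (rule class_vectorspace.diagonalizable_imp_semisimple[OF quotient_space_vectorspace[OF U]
        quotient_map_lin[OF U A] diagonalizable_quotient[OF U A d]])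

end


section \<open>The general linear group\<close>

context class_vectorspace begin

lemma GL_mem_iff:
  "f \<in> carrier (GL V) \<longleftrightarrow> f \<in> extensional (carrier V) \<and> bij_betw f (carrier V) (carrier V) \<and> lin f"
  by (auto simp: GL_def Bij_def)

text \<open>Membership in the general linear group by a kernel computation and by solving equations, which avoids
  writing down inverse operators.\<close>

lemma GL_I:
  assumes f: "lin f" "f \<in> extensional (carrier V)"
    and inj: "\<And>v. v \<in> carrier V \<Longrightarrow> f v = \<zero> \<Longrightarrow> v = \<zero>"
    and surj: "\<And>y. y \<in> carrier V \<Longrightarrow> \<exists>v\<in>carrier V. f v = y"
  shows "f \<in> carrier (GL V)"
proof -
  have "inj_on f (carrier V)"
  proof (rule inj_onI)
    fix v w assume vw: "v \<in> carrier V" "w \<in> carrier V" "f v = f w"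
    then have "v \<ominus> w = \<zero>" by (intro inj[of "v \<ominus> w"]) (simp_all add: lin_simps[OF f(1)] minus_self)
    then show "v = w" using vw by (simp add: minus_eq_iff)
  qed
  moreover have "f ` carrier V = carrier V" using lin_closed[OF f(1)] surj by blast
  ultimately show ?thesis using f by (simp add: GL_mem_iff bij_betw_def)
qed

lemma GL_eqI:
  assumes "f \<in> carrier (GL V)" "g \<in> carrier (GL V)" "\<And>v. v \<in> carrier V \<Longrightarrow> f v = g v"
  shows "f = g"
  using assms by (intro extensionalityI[of _ "carrier V"]) (auto simp: GL_mem_iff)

lemma GL_mult_apply:
  "f \<in> carrier (GL V) \<Longrightarrow> g \<in> carrier (GL V) \<Longrightarrow> v \<in> carrier V \<Longrightarrow> (f \<otimes>\<^bsub>GL V\<^esub> g) v = f (g v)"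
  by (auto simp: GL_def BijGroup_def compose_def)

lemma group_GL: "group (GL V)"
proof -
  let ?H = "{f \<in> Bij (carrier V). lin f}"
  interpret B: group "BijGroup (carrier V)" by (rule group_BijGroup)
  have "subgroup ?H (BijGroup (carrier V))"
  proof (rule B.subgroupI)
    show "?H \<subseteq> carrier (BijGroup (carrier V))" by (auto simp: BijGroup_def)
    have "(\<lambda>x\<in>carrier V. x) \<in> ?H" by (auto simp: id_Bij intro!: linI)
    then show "?H \<noteq> {}" by blast
    fix f assume f: "f \<in> ?H"
    then have fB: "f \<in> Bij (carrier V)" and fl: "lin f" by auto
    have im: "f ` carrier V = carrier V" and inj: "inj_on f (carrier V)"
      using fB by (auto simp: Bij_def bij_betw_def)
    let ?g = "\<lambda>v\<in>carrier V. inv_into (carrier V) f v"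
    have g: "inv\<^bsub>BijGroup (carrier V)\<^esub> f = ?g" using fB by (rule inv_BijGroup)
    have "lin ?g"
    proof (rule linI)
      fix v assume v: "v \<in> carrier V"
      then show "?g v \<in> carrier V" using Bij_inv_into_mem[OF fB] by simp
      then have gv: "inv_into (carrier V) f v \<in> carrier V" using v by simp
      have fg: "f (inv_into (carrier V) f w) = w" if "w \<in> carrier V" for w
        using that im by (intro f_inv_into_f) simp
      show "?g (c \<odot> v) = c \<odot> ?g v" for c
        using v gv fg by (auto simp: lin_simps[OF fl] intro!: inv_into_f_eq inj)
      fix w assume w: "w \<in> carrier V"
      then have gw: "inv_into (carrier V) f w \<in> carrier V" using Bij_inv_into_mem[OF fB] by simp
      show "?g (v \<oplus> w) = ?g v \<oplus> ?g w"
        using v w gv gw fg by (auto simp: lin_simps[OF fl] intro!: inv_into_f_eq inj)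
    qed
    then show "inv\<^bsub>BijGroup (carrier V)\<^esub> f \<in> ?H"
      unfolding g using restrict_inv_into_Bij[OF fB] by simp
    fix h assume h: "h \<in> ?H"
    then have "compose (carrier V) f h \<in> Bij (carrier V)" using fB by (intro compose_Bij) auto
    moreover have "lin (compose (carrier V) f h)"
      using h by (intro linI) (auto simp: compose_def lin_simps[OF fl] lin_simps)
    ultimately show "f \<otimes>\<^bsub>BijGroup (carrier V)\<^esub> h \<in> ?H"
      using fB h by (simp add: BijGroup_def)
  qed
  from subgroup.subgroup_is_group[OF this B.is_group] show ?thesis unfolding GL_def .
qed

lemma lin_finsum:
  assumes A: "lin A" and f: "f \<in> C \<rightarrow> carrier V"
  shows "A (\<Oplus>c\<in>C. f c) = (\<Oplus>c\<in>C. A (f c))"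
  using f
proof (induction C rule: infinite_finite_induct)
  case (insert c C)
  then have "f \<in> C \<rightarrow> carrier V" "f c \<in> carrier V" "(\<lambda>c. A (f c)) \<in> C \<rightarrow> carrier V" "A (f c) \<in> carrier V"
    using lin_closed[OF A] by auto
  then show ?case using insert by (simp add: lin_add[OF A])
qed (simp_all add: lin_zero[OF A])

end

context class_vectorspace begin

lemma block_op_apply:
  "w \<in> carrier (power_space n V) \<Longrightarrow> r \<in> {1..n} \<Longrightarrow> block_op n V M w r = (\<Oplus>c\<in>{1..n}. M r c (w c))"
  by (simp add: block_op_def)

lemma block_op_lin:
  assumes M: "\<And>r c. r \<in> {1..n} \<Longrightarrow> c \<in> {1..n} \<Longrightarrow> lin (M r c)"
  shows "class_vectorspace.lin (power_space n V) (block_op n V M)"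
proof -
  interpret P: class_vectorspace "power_space n V" by (rule power_space_vectorspace)
  have cl: "M r c (w c) \<in> carrier V"
    if "r \<in> {1..n}" "c \<in> {1..n}" "w \<in> carrier (power_space n V)" for r c w
    using lin_closed[OF M[OF that(1,2)] power_apply[OF that(3,2)]] .
  have c: "block_op n V M w \<in> carrier (power_space n V)" if w: "w \<in> carrier (power_space n V)" for w
    using w by (auto simp: power_space_simps block_op_def intro!: M.finsum_closed cl)
  show ?thesis
  proof (rule P.linI)
    fix v w assume v: "v \<in> carrier (power_space n V)" and w: "w \<in> carrier (power_space n V)"
    show "block_op n V M (v \<oplus>\<^bsub>power_space n V\<^esub> w)
        = block_op n V M v \<oplus>\<^bsub>power_space n V\<^esub> block_op n V M w"
    proof (rule power_ext[where n = n])
      fix r assume r: "r \<in> {1..n}"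
      have "block_op n V M (v \<oplus>\<^bsub>power_space n V\<^esub> w) r = (\<Oplus>c\<in>{1..n}. M r c (v c) \<oplus> M r c (w c))"
        unfolding block_op_apply[OF P.M.a_closed[OF v w] r]
        by (rule M.finsum_cong')
          (use cl[OF r] v w in \<open>auto simp: power_space_simps(2) lin_add[OF M[OF r]] power_apply\<close>)
      also have "\<dots> = block_op n V M v r \<oplus> block_op n V M w r"
        unfolding block_op_apply[OF v r] block_op_apply[OF w r]
        by (rule M.finsum_addf) (use cl[OF r] v w in auto)
      finally show "block_op n V M (v \<oplus>\<^bsub>power_space n V\<^esub> w) r
          = (block_op n V M v \<oplus>\<^bsub>power_space n V\<^esub> block_op n V M w) r"
        using r by (simp add: power_space_simps(2))
    qed (use v w c in simp_all)
  next
    fix k w assume w: "w \<in> carrier (power_space n V)"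
    show "block_op n V M (k \<odot>\<^bsub>power_space n V\<^esub> w) = k \<odot>\<^bsub>power_space n V\<^esub> block_op n V M w"
    proof (rule power_ext[where n = n])
      fix r assume r: "r \<in> {1..n}"
      have "block_op n V M (k \<odot>\<^bsub>power_space n V\<^esub> w) r = (\<Oplus>c\<in>{1..n}. k \<odot> M r c (w c))"
        unfolding block_op_apply[OF P.smult_closed[OF TrueI w] r]
        by (rule M.finsum_cong')
          (use cl[OF r] w in \<open>auto simp: power_space_simps(4) lin_smult[OF M[OF r]] power_apply\<close>)
      also have "\<dots> = k \<odot> (\<Oplus>c\<in>{1..n}. M r c (w c))"
        by (rule lin_finsum[symmetric]) (use cl[OF r] w in \<open>auto intro!: linI simp: smult_r_distr mult.commute simp flip: smult_assoc1\<close>)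
      finally show "block_op n V M (k \<odot>\<^bsub>power_space n V\<^esub> w) r = (k \<odot>\<^bsub>power_space n V\<^esub> block_op n V M w) r"
        using r w by (simp add: power_space_simps(4) block_op_apply)
    qed (use w c in simp_all)
  qed (rule c)
qed

lemma block_op_closed:
  assumes "\<And>r c. r \<in> {1..n} \<Longrightarrow> c \<in> {1..n} \<Longrightarrow> lin (M r c)" "w \<in> carrier (power_space n V)"
  shows "block_op n V M w \<in> carrier (power_space n V)"
  by (rule class_vectorspace.lin_closed[OF power_space_vectorspace block_op_lin]) (use assms in auto)

lemma finsum_support:
  assumes "finite C" "K \<subseteq> C" "\<And>c. c \<in> K \<Longrightarrow> f c \<in> carrier V" "\<And>c. c \<in> C - K \<Longrightarrow> f c = \<zero>"
  shows "(\<Oplus>c\<in>C. f c) = (\<Oplus>c\<in>K. f c)"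
proof -
  have "f c \<in> carrier V" if "c \<in> C" for c using that assms(3,4) by (cases "c \<in> K") auto
  then show ?thesis using assms by (intro M.add.finprod_mono_neutral_cong_right) auto
qed

lemma lin_id: "lin (\<lambda>v. v)" by (rule linI) auto

lemma lin_const_zero: "lin (\<lambda>v. \<zero>)" by (rule linI) auto

lemma lin_scaled: "lin A \<Longrightarrow> lin (\<lambda>v. k \<odot> A v)"
  by (rule linI) (simp_all add: lin_simps smult_r_distr mult.commute flip: smult_assoc1)

lemma lin_diff: "lin A \<Longrightarrow> lin B \<Longrightarrow> lin (\<lambda>v. A v \<ominus> B v)"
  by (rule linI) (simp_all add: lin_simps smult_minus_r minus_simps)

end


section \<open>Relations in the semidirect product\<close>

lemma free_braid_gen_closed:
  "j \<in> {1..n} \<Longrightarrow> gen_x n j \<in> carrier (free_braid_group n)"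
  "i \<in> {1..<n} \<Longrightarrow> gen_\<sigma> n i \<in> carrier (free_braid_group n)"
proof -
  interpret F: group "free_group n" by (rule group_free_group)
  interpret B: group "braid_group n" by (rule group_braid_group)
  show "j \<in> {1..n} \<Longrightarrow> gen_x n j \<in> carrier (free_braid_group n)"
    "i \<in> {1..<n} \<Longrightarrow> gen_\<sigma> n i \<in> carrier (free_braid_group n)"
    by (simp_all add: gen_x_def gen_\<sigma>_def free_braid_group_def semidirect_product_def
        free_gen_closed braid_gen_closed)
qed

lemma braid_gen_mult:
  assumes "i \<in> {1..<n}" "j \<in> {1..<n}"
  shows "braid_gen n i \<otimes>\<^bsub>braid_group n\<^esub> braid_gen n j
      = pres_rel {1..<n} (braid_relations n) `` {[(i, True), (j, True)]}"
  unfolding braid_gen_def pres_gen_def braid_group_def using assms by (subst pres_mult) auto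

lemma braid_gen_mult3:
  assumes "i \<in> {1..<n}" "j \<in> {1..<n}" "l \<in> {1..<n}"
  shows "braid_gen n i \<otimes>\<^bsub>braid_group n\<^esub> (braid_gen n j \<otimes>\<^bsub>braid_group n\<^esub> braid_gen n l)
      = pres_rel {1..<n} (braid_relations n) `` {[(i, True), (j, True), (l, True)]}"
  unfolding braid_gen_mult[OF assms(2,3)] unfolding braid_gen_def pres_gen_def braid_group_def
  using assms by (subst pres_mult) auto

lemma braid_gen_braid:
  assumes "1 \<le> i" "Suc i < n"
  shows "braid_gen n i \<otimes>\<^bsub>braid_group n\<^esub> (braid_gen n (Suc i) \<otimes>\<^bsub>braid_group n\<^esub> braid_gen n i)
    = braid_gen n (Suc i) \<otimes>\<^bsub>braid_group n\<^esub> (braid_gen n i \<otimes>\<^bsub>braid_group n\<^esub> braid_gen n (Suc i))"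
proof -
  let ?l = "[(i, True), (Suc i, True), (i, True)]" and ?r = "[(Suc i, True), (i, True), (Suc i, True)]"
  have "pres_cong {1..<n} (braid_relations n) ([] @ ?l @ []) ([] @ ?r @ [])"
    using assms by (intro pres_cong.relation) (auto simp: braid_relations_def)
  then have *: "pres_rel {1..<n} (braid_relations n) `` {?l} = pres_rel {1..<n} (braid_relations n) `` {?r}"
    using assms by (subst pres_class_eq_iff) auto
  have "i \<in> {1..<n}" "Suc i \<in> {1..<n}" using assms by auto
  then show ?thesis using * by (simp only: braid_gen_mult3)
qed

lemma braid_gen_commute:
  assumes "1 \<le> i" "Suc i < j" "j < n"
  shows "braid_gen n i \<otimes>\<^bsub>braid_group n\<^esub> braid_gen n j = braid_gen n j \<otimes>\<^bsub>braid_group n\<^esub> braid_gen n i"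
proof -
  let ?l = "[(i, True), (j, True)]" and ?r = "[(j, True), (i, True)]"
  have "pres_cong {1..<n} (braid_relations n) ([] @ ?l @ []) ([] @ ?r @ [])"
    using assms by (intro pres_cong.relation) (auto simp: braid_relations_def)
  then have *: "pres_rel {1..<n} (braid_relations n) `` {?l} = pres_rel {1..<n} (braid_relations n) `` {?r}"
    using assms by (subst pres_class_eq_iff) auto
  have i: "i \<in> {1..<n}" "j \<in> {1..<n}" using assms by auto
  show ?thesis unfolding braid_gen_mult[OF i] braid_gen_mult[OF i(2,1)] by (rule *)
qed

lemma
  assumes i: "i \<in> {1..<n}"
  shows free_braid_\<sigma>_x: "gen_\<sigma> n i \<otimes>\<^bsub>free_braid_group n\<^esub> gen_x n i
      = gen_x n (Suc i) \<otimes>\<^bsub>free_braid_group n\<^esub> gen_\<sigma> n i"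
    and free_braid_x_\<sigma>_x: "gen_x n (Suc i) \<otimes>\<^bsub>free_braid_group n\<^esub> (gen_\<sigma> n i \<otimes>\<^bsub>free_braid_group n\<^esub> gen_x n (Suc i))
      = gen_x n i \<otimes>\<^bsub>free_braid_group n\<^esub> (gen_x n (Suc i) \<otimes>\<^bsub>free_braid_group n\<^esub> gen_\<sigma> n i)"
    and free_braid_\<sigma>_x_other: "\<And>j. j \<in> {1..n} \<Longrightarrow> j \<noteq> i \<Longrightarrow> j \<noteq> Suc i \<Longrightarrow>
      gen_\<sigma> n i \<otimes>\<^bsub>free_braid_group n\<^esub> gen_x n j = gen_x n j \<otimes>\<^bsub>free_braid_group n\<^esub> gen_\<sigma> n i"
    and free_braid_\<sigma>_\<sigma>: "\<And>b. b \<in> carrier (braid_group n) \<Longrightarrow>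
      gen_\<sigma> n i \<otimes>\<^bsub>free_braid_group n\<^esub> (\<one>\<^bsub>free_group n\<^esub>, b)
        = (\<one>\<^bsub>free_group n\<^esub>, braid_gen n i \<otimes>\<^bsub>braid_group n\<^esub> b)"
proof -
  let ?F = "free_group n" and ?B = "braid_group n" and ?\<theta> = "artin_action n"
  interpret F: group ?F by (rule group_free_group)
  interpret B: group ?B by (rule group_braid_group)
  interpret A: group "AutoGroup ?F" by (rule F.AutoGroup)
  interpret \<theta>: group_hom ?B "AutoGroup ?F" ?\<theta> by standard (rule artin_action)
  note \<theta>.hom_inv [simp del] \<theta>.hom_mult [simp del] \<theta>.hom_one [simp del]
  have one: "?\<theta> \<one>\<^bsub>?B\<^esub> a = a" if "a \<in> carrier ?F" for a
    using that \<theta>.hom_one by (simp add: AutoGroup_def BijGroup_def)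
  have bi: "braid_gen n i \<in> carrier ?B" by (rule braid_gen_closed[OF i])
  have one': "?\<theta> (braid_gen n i) \<one>\<^bsub>?F\<^esub> = \<one>\<^bsub>?F\<^esub>"
  proof -
    interpret group_hom ?F ?F "?\<theta> (braid_gen n i)"
      by standard (use \<theta>.hom_closed[OF bi] in \<open>simp add: AutoGroup_carrier auto_def\<close>)
    show ?thesis by (rule hom_one)
  qed
  have j: "i \<in> {1..n}" "Suc i \<in> {1..n}" using i by auto
  note x = free_gen_closed[OF j(1)] free_gen_closed[OF j(2)]
  note defs = gen_x_def gen_\<sigma>_def free_braid_group_def semidirect_product_def
  show "gen_\<sigma> n i \<otimes>\<^bsub>free_braid_group n\<^esub> gen_x n i = gen_x n (Suc i) \<otimes>\<^bsub>free_braid_group n\<^esub> gen_\<sigma> n i"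
    using x bi by (simp add: defs artin_action(2)[OF i j(1)] artin_image_def one)
  show "gen_x n (Suc i) \<otimes>\<^bsub>free_braid_group n\<^esub> (gen_\<sigma> n i \<otimes>\<^bsub>free_braid_group n\<^esub> gen_x n (Suc i))
      = gen_x n i \<otimes>\<^bsub>free_braid_group n\<^esub> (gen_x n (Suc i) \<otimes>\<^bsub>free_braid_group n\<^esub> gen_\<sigma> n i)"
    using x bi by (simp add: defs artin_action(2)[OF i j(2)] artin_image_def one F.m_assoc F.inv_cancel_assoc)
  show "gen_\<sigma> n i \<otimes>\<^bsub>free_braid_group n\<^esub> gen_x n j = gen_x n j \<otimes>\<^bsub>free_braid_group n\<^esub> gen_\<sigma> n i"
    if "j \<in> {1..n}" "j \<noteq> i" "j \<noteq> Suc i" for j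
    using that bi free_gen_closed[OF that(1)] by (simp add: defs artin_action(2)[OF i that(1)] artin_image_def one)
  show "gen_\<sigma> n i \<otimes>\<^bsub>free_braid_group n\<^esub> (\<one>\<^bsub>?F\<^esub>, b) = (\<one>\<^bsub>?F\<^esub>, braid_gen n i \<otimes>\<^bsub>?B\<^esub> b)"
    if "b \<in> carrier ?B" for b
    using that by (simp add: defs one')
qed

locale free_braid_module = class_vectorspace V for V :: "('k::field, 'v, 'm) module_scheme" (structure) +
  fixes n :: nat and \<rho> :: "'v free_braid_rep"
  assumes rho: "\<rho> \<in> hom (free_braid_group n) (GL V)"
begin

abbreviation g :: "nat \<Rightarrow> 'v \<Rightarrow> 'v" where "g j \<equiv> \<rho> (gen_x n j)"
abbreviation s :: "nat \<Rightarrow> 'v \<Rightarrow> 'v" where "s i \<equiv> \<rho> (gen_\<sigma> n i)"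
abbreviation P :: "('k, nat \<Rightarrow> 'v) module" where "P \<equiv> power_space n V"

sublocale P: class_vectorspace P by (rule power_space_vectorspace)

lemma rho_GL: "p \<in> carrier (free_braid_group n) \<Longrightarrow> \<rho> p \<in> carrier (GL V)"
  using rho by (auto simp: hom_def)

lemma rho_mult:
  assumes "p \<in> carrier (free_braid_group n)" "q \<in> carrier (free_braid_group n)" "v \<in> carrier V"
  shows "\<rho> (p \<otimes>\<^bsub>free_braid_group n\<^esub> q) v = \<rho> p (\<rho> q v)"
  using hom_mult[OF rho assms(1,2)] GL_mult_apply[OF rho_GL[OF assms(1)] rho_GL[OF assms(2)] assms(3)] by simp

lemma g_lin: "j \<in> {1..n} \<Longrightarrow> lin (g j)"
  and s_lin: "i \<in> {1..<n} \<Longrightarrow> lin (s i)"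
  using rho_GL free_braid_gen_closed by (simp_all add: GL_mem_iff del: atLeastAtMost_iff atLeastLessThan_iff)

lemma g_bij: "j \<in> {1..n} \<Longrightarrow> bij_betw (g j) (carrier V) (carrier V)"
  and s_bij: "i \<in> {1..<n} \<Longrightarrow> bij_betw (s i) (carrier V) (carrier V)"
  using rho_GL free_braid_gen_closed by (simp_all add: GL_mem_iff del: atLeastAtMost_iff atLeastLessThan_iff)

lemma g_eq_iff: "j \<in> {1..n} \<Longrightarrow> v \<in> carrier V \<Longrightarrow> w \<in> carrier V \<Longrightarrow> g j v = g j w \<longleftrightarrow> v = w"
  and s_eq_iff: "i \<in> {1..<n} \<Longrightarrow> v \<in> carrier V \<Longrightarrow> w \<in> carrier V \<Longrightarrow> s i v = s i w \<longleftrightarrow> v = w"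
  using bij_betw_imp_inj_on[OF g_bij] bij_betw_imp_inj_on[OF s_bij] by (meson inj_on_eq_iff)+

lemma g_surj: "j \<in> {1..n} \<Longrightarrow> y \<in> carrier V \<Longrightarrow> \<exists>v\<in>carrier V. g j v = y"
  and s_surj: "i \<in> {1..<n} \<Longrightarrow> y \<in> carrier V \<Longrightarrow> \<exists>v\<in>carrier V. s i v = y"
  using bij_betw_imp_surj_on[OF g_bij] bij_betw_imp_surj_on[OF s_bij] by (metis imageE)+

lemma s_g:
  assumes "i \<in> {1..<n}" "v \<in> carrier V"
  shows "s i (g i v) = g (Suc i) (s i v)"
  using arg_cong[OF free_braid_\<sigma>_x[OF assms(1)], of "\<lambda>p. \<rho> p v"] assms
  by (simp add: rho_mult free_braid_gen_closed)

lemma s_g_other: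
  assumes "i \<in> {1..<n}" "j \<in> {1..n}" "j \<noteq> i" "j \<noteq> Suc i" "v \<in> carrier V"
  shows "s i (g j v) = g j (s i v)"
  using arg_cong[OF free_braid_\<sigma>_x_other[OF assms(1-4)], of "\<lambda>p. \<rho> p v"] assms
  by (simp add: rho_mult free_braid_gen_closed)

lemma g_s_g:
  assumes i: "i \<in> {1..<n}" and v: "v \<in> carrier V"
  shows "g (Suc i) (s i (g (Suc i) v)) = g i (g (Suc i) (s i v))"
proof -
  interpret G: group "free_braid_group n" by (rule group_free_braid_group)
  have j: "i \<in> {1..n}" "Suc i \<in> {1..n}" using i by auto
  note c = free_braid_gen_closed(1)[OF j(1)] free_braid_gen_closed(1)[OF j(2)] free_braid_gen_closed(2)[OF i]
  show ?thesis
    using arg_cong[OF free_braid_x_\<sigma>_x[OF i], of "\<lambda>p. \<rho> p v"] c v by (simp add: rho_mult)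
qed

lemma s_s:
  assumes "i \<in> {1..<n}" "j \<in> {1..<n}" "v \<in> carrier V"
  shows "s i (s j v) = \<rho> (\<one>\<^bsub>free_group n\<^esub>, braid_gen n i \<otimes>\<^bsub>braid_group n\<^esub> braid_gen n j) v"
  using rho_mult[OF free_braid_gen_closed(2)[OF assms(1)] free_braid_gen_closed(2)[OF assms(2)] assms(3)]
    free_braid_\<sigma>_\<sigma>[OF assms(1) braid_gen_closed[OF assms(2)]]
  by (simp flip: gen_\<sigma>_def)

lemma s_commute:
  assumes "1 \<le> i" "Suc i < j" "j < n" "v \<in> carrier V"
  shows "s i (s j v) = s j (s i v)"
  using s_s[of i j v] s_s[of j i v] braid_gen_commute[OF assms(1-3)] assms by simp

lemma s_braid:
  assumes "1 \<le> i" "Suc i < n" "v \<in> carrier V"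
  shows "s i (s (Suc i) (s i v)) = s (Suc i) (s i (s (Suc i) v))"
proof -
  interpret B: group "braid_group n" by (rule group_braid_group)
  have *: "s i (s j (s i v)) = \<rho> (\<one>\<^bsub>free_group n\<^esub>,
      braid_gen n i \<otimes>\<^bsub>braid_group n\<^esub> (braid_gen n j \<otimes>\<^bsub>braid_group n\<^esub> braid_gen n i)) v"
    if ij: "i \<in> {1..<n}" "j \<in> {1..<n}" for i j
  proof -
    have b: "braid_gen n j \<otimes>\<^bsub>braid_group n\<^esub> braid_gen n i \<in> carrier (braid_group n)"
      using ij by (intro B.m_closed braid_gen_closed)
    have "(\<one>\<^bsub>free_group n\<^esub>, braid_gen n j \<otimes>\<^bsub>braid_group n\<^esub> braid_gen n i)
        = gen_\<sigma> n j \<otimes>\<^bsub>free_braid_group n\<^esub> gen_\<sigma> n i"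
      using free_braid_\<sigma>_\<sigma>[OF ij(2) braid_gen_closed[OF ij(1)]] by (simp flip: gen_\<sigma>_def)
    then have "(\<one>\<^bsub>free_group n\<^esub>, braid_gen n j \<otimes>\<^bsub>braid_group n\<^esub> braid_gen n i) \<in> carrier (free_braid_group n)"
      using group.is_monoid[OF group_free_braid_group] ij by (simp add: free_braid_gen_closed monoid.m_closed)
    then show ?thesis
      using s_s[OF ij(2,1) assms(3)] rho_mult[OF free_braid_gen_closed(2)[OF ij(1)] _ assms(3)]
        free_braid_\<sigma>_\<sigma>[OF ij(1) b] by metis
  qed
  show ?thesis using *[of i "Suc i"] *[of "Suc i" i] braid_gen_braid[OF assms(1,2)] assms by simp
qed

end


section \<open>The Long-Moody blocks satisfy the defining relations\<close>

lemma (in class_vectorspace) lin_if: "lin A \<Longrightarrow> lin B \<Longrightarrow> lin (\<lambda>v. if b then A v else B v)"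
  by (cases b) simp_all

context free_braid_module begin

abbreviation X :: "'k \<Rightarrow> nat \<Rightarrow> (nat \<Rightarrow> 'v) \<Rightarrow> nat \<Rightarrow> 'v" where "X \<equiv> LM_x n V \<rho>"
abbreviation S :: "nat \<Rightarrow> (nat \<Rightarrow> 'v) \<Rightarrow> nat \<Rightarrow> 'v" where "S \<equiv> LM_\<sigma> n V \<rho>"

text \<open>The partial sums of \<open>\<Sum>\<^sub>c (g\<^sub>c - 1) w\<^sub>c\<close>, which occur in the nontrivial row of \<open>\<rho>\<^sup>L\<^sup>M(x\<^sub>i)\<close>.\<close>

definition diff_sum :: "nat set \<Rightarrow> (nat \<Rightarrow> 'v) \<Rightarrow> 'v" where
  "diff_sum C w = (\<Oplus>c\<in>C. g c (w c) \<ominus> w c)"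

lemma g_closed: "j \<in> {1..n} \<Longrightarrow> v \<in> carrier V \<Longrightarrow> g j v \<in> carrier V"
  and s_closed: "i \<in> {1..<n} \<Longrightarrow> v \<in> carrier V \<Longrightarrow> s i v \<in> carrier V"
  using lin_closed g_lin s_lin by blast+

lemma d_closed: "w \<in> carrier P \<Longrightarrow> c \<in> {1..n} \<Longrightarrow> g c (w c) \<ominus> w c \<in> carrier V"
  by (simp add: g_closed power_apply del: atLeastAtMost_iff)

lemma diff_sum_closed: "w \<in> carrier P \<Longrightarrow> C \<subseteq> {1..n} \<Longrightarrow> diff_sum C w \<in> carrier V"
  unfolding diff_sum_def using d_closed by (intro M.finsum_closed) auto

lemma diff_sum_cong:
  assumes "w \<in> carrier P" "C \<subseteq> {1..n}" "\<And>c. c \<in> C \<Longrightarrow> w' c = w c"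
  shows "diff_sum C w' = diff_sum C w"
  unfolding diff_sum_def using assms d_closed by (intro M.finsum_cong') auto

lemma diff_sum_insert:
  assumes "w \<in> carrier P" "insert c C \<subseteq> {1..n}" "c \<notin> C"
  shows "diff_sum (insert c C) w = (g c (w c) \<ominus> w c) \<oplus> diff_sum C w"
  unfolding diff_sum_def
  using assms d_closed[OF assms(1)] by (intro M.finsum_insert) (auto intro: finite_subset)

lemma X_lin: "i \<in> {1..n} \<Longrightarrow> P.lin (X lam i)"
  unfolding LM_x_def Let_def
  by (rule block_op_lin, intro lin_if lin_scaled lin_diff g_lin lin_id lin_const_zero; assumption)

lemma X_closed: "i \<in> {1..n} \<Longrightarrow> w \<in> carrier P \<Longrightarrow> X lam i w \<in> carrier P"
  using P.lin_closed X_lin by blast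

lemma X_apply_other:
  assumes "i \<in> {1..n}" "r \<in> {1..n}" "r \<noteq> i" "w \<in> carrier P"
  shows "X lam i w r = w r"
proof -
  have "X lam i w r = (\<Oplus>c\<in>{1..n}. if r = c then w c else \<zero>)"
    unfolding LM_x_def Let_def block_op_apply[OF assms(4,2)]
    using assms(3) power_apply[OF assms(4)] by (intro M.finsum_cong') auto
  also have "\<dots> = w r" using assms power_apply[OF assms(4)] by (intro M.finsum_singleton) auto
  finally show ?thesis .
qed

lemma X_apply_same:
  assumes i: "i \<in> {1..n}" and w: "w \<in> carrier P"
  shows "X lam i w i = lam \<odot> diff_sum {1..<i} w \<oplus> (lam \<odot> g i (w i) \<oplus> diff_sum {Suc i..n} w)"
proof -
  let ?f = "\<lambda>c. if c < i then lam \<odot> (g c (w c) \<ominus> w c) else if c = i then lam \<odot> g i (w i) else g c (w c) \<ominus> w c"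
  have f: "?f c \<in> carrier V" if "c \<in> {1..n}" for c
    using d_closed[OF w that] g_closed[OF i power_apply[OF w i]] by auto
  have "X lam i w i = (\<Oplus>c\<in>{1..n}. ?f c)"
    unfolding LM_x_def Let_def block_op_apply[OF w i] using f
    by (intro M.finsum_cong') (auto simp del: atLeastAtMost_iff)
  also have "{1..n} = {1..<i} \<union> insert i {Suc i..n}" using i by auto
  also have "(\<Oplus>c\<in>{1..<i} \<union> insert i {Suc i..n}. ?f c) = (\<Oplus>c\<in>{1..<i}. ?f c) \<oplus> (\<Oplus>c\<in>insert i {Suc i..n}. ?f c)"
  proof (rule M.finsum_Un_disjoint)
    show "?f \<in> {1..<i} \<rightarrow> carrier V" "?f \<in> insert i {Suc i..n} \<rightarrow> carrier V"
      by (intro Pi_I f; use i in auto)+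
  qed auto
  also have "(\<Oplus>c\<in>{1..<i}. ?f c) = (\<Oplus>c\<in>{1..<i}. lam \<odot> (g c (w c) \<ominus> w c))"
    using i d_closed[OF w] by (intro M.finsum_cong') auto
  also have "\<dots> = lam \<odot> diff_sum {1..<i} w"
    unfolding diff_sum_def using i d_closed[OF w]
    by (intro lin_finsum[symmetric] lin_scaled lin_id) auto
  also have "(\<Oplus>c\<in>insert i {Suc i..n}. ?f c) = ?f i \<oplus> (\<Oplus>c\<in>{Suc i..n}. ?f c)"
  proof (rule M.finsum_insert)
    show "?f \<in> {Suc i..n} \<rightarrow> carrier V" by (intro Pi_I f) (use i in auto)
    show "?f i \<in> carrier V" by (rule f[OF i])
  qed simp_all
  also have "(\<Oplus>c\<in>{Suc i..n}. ?f c) = diff_sum {Suc i..n} w"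
    unfolding diff_sum_def using i d_closed[OF w] by (intro M.finsum_cong') auto
  finally show ?thesis by simp
qed

lemma S_lin: "i \<in> {1..<n} \<Longrightarrow> P.lin (S i)"
proof -
  assume i: "i \<in> {1..<n}"
  have j: "i \<in> {1..n}" "Suc i \<in> {1..n}" using i by auto
  let ?M1 = "\<lambda>r c v. if r = c then s i v else \<zero>" and
    ?M2 = "\<lambda>r c v. if r = i \<and> c = i then \<zero> else if r = i \<and> c = i + 1 then g i v
      else if r = i + 1 \<and> c = i then v else if r = i + 1 \<and> c = i + 1 then v \<ominus> g (i + 1) v
      else if r = c then v else \<zero>"
  have 1: "P.lin (block_op n V ?M1)"
    by (rule block_op_lin) (intro lin_if s_lin i lin_const_zero)
  have 2: "P.lin (block_op n V ?M2)"
    unfolding Suc_eq_plus1[symmetric]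
    by (rule block_op_lin) (intro lin_if lin_diff g_lin j lin_id lin_const_zero)
  show "P.lin (S i)"
    unfolding LM_\<sigma>_def Let_def
    by (rule P.linI) (simp_all add: compose_def P.lin_simps[OF 1] P.lin_simps[OF 2])
qed

lemma S_closed: "i \<in> {1..<n} \<Longrightarrow> w \<in> carrier P \<Longrightarrow> S i w \<in> carrier P"
  using P.lin_closed S_lin by blast

lemma S_apply:
  assumes i: "i \<in> {1..<n}" and w: "w \<in> carrier P" and r: "r \<in> {1..n}"
  shows "S i w r = (if r = i then s i (g i (w (Suc i)))
    else if r = Suc i then s i (w i \<oplus> (w (Suc i) \<ominus> g (Suc i) (w (Suc i)))) else s i (w r))"
proof -
  have j: "i \<in> {1..n}" "Suc i \<in> {1..n}" using i by auto
  let ?M2 = "\<lambda>r c v. if r = i \<and> c = i then \<zero> else if r = i \<and> c = i + 1 then g i v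
      else if r = i + 1 \<and> c = i then v else if r = i + 1 \<and> c = i + 1 then v \<ominus> g (i + 1) v
      else if r = c then v else \<zero>"
  let ?u = "block_op n V ?M2 w"
  note ws = power_apply[OF w j(1)] power_apply[OF w j(2)] power_apply[OF w r]
    g_closed[OF j(1) power_apply[OF w j(2)]] g_closed[OF j(2) power_apply[OF w j(2)]]
  have u: "?u \<in> carrier P"
    unfolding Suc_eq_plus1[symmetric]
    by (rule block_op_closed[OF _ w]) (intro lin_if lin_diff g_lin j lin_id lin_const_zero)
  have "S i w r = (\<Oplus>c\<in>{1..n}. if r = c then s i (?u c) else \<zero>)"
    unfolding LM_\<sigma>_def Let_def using w by (simp only: compose_def restrict_apply' block_op_apply[OF u r])
  also have "\<dots> = s i (?u r)" using r s_closed[OF i power_apply[OF u]] by (intro M.finsum_singleton) auto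
  also have "?u r = (if r = i then g i (w (Suc i)) else if r = Suc i then w i \<oplus> (w (Suc i) \<ominus> g (Suc i) (w (Suc i))) else w r)"
  proof -
    have "?u r = (\<Oplus>c\<in>{1..n}. ?M2 r c (w c))" by (rule block_op_apply[OF w r])
    also have "\<dots> = (\<Oplus>c\<in>(if r = i then {Suc i} else if r = Suc i then {i, Suc i} else {r}). ?M2 r c (w c))"
      by (rule finsum_support) (use j r ws in \<open>auto split: if_splits\<close>)
    also have "\<dots> = (if r = i then g i (w (Suc i)) else if r = Suc i then w i \<oplus> (w (Suc i) \<ominus> g (Suc i) (w (Suc i))) else w r)"
      using ws by simp
    finally show ?thesis .
  qed
  finally show ?thesis by (simp only: if_distrib[of "s i"])
qed

text \<open>The sum over the two blocks \<open>i, i + 1\<close> is compatible with \<open>\<sigma>\<^sub>i\<close> although its summands are not; hence the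
  index set has to contain both blocks or neither. For all other blocks \<open>g\<^sub>c\<close> commutes with \<open>s\<^sub>i\<close>.\<close>

lemma diff_sum_S:
  assumes i: "i \<in> {1..<n}" and w: "w \<in> carrier P" and C: "C \<subseteq> {1..n}" and iC: "i \<in> C \<longleftrightarrow> Suc i \<in> C"
  shows "diff_sum C (S i w) = s i (diff_sum C w)"
proof -
  have other: "diff_sum C (S i w) = s i (diff_sum C w)" if C: "C \<subseteq> {1..n}" "i \<notin> C" "Suc i \<notin> C" for C
  proof -
    have "diff_sum C (S i w) = (\<Oplus>c\<in>C. s i (g c (w c) \<ominus> w c))"
      unfolding diff_sum_def
    proof (rule M.finsum_cong')
      fix c assume c: "c \<in> C"
      then have c': "c \<in> {1..n}" "c \<noteq> i" "c \<noteq> Suc i" using C by auto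
      note wc = power_apply[OF w c'(1)]
      show "g c (S i w c) \<ominus> S i w c = s i (g c (w c) \<ominus> w c)"
        using wc g_closed[OF c'(1) wc] s_g_other[OF i c' wc]
        by (simp add: S_apply[OF i w c'(1)] c'(2,3) lin_simps[OF s_lin[OF i]])
    qed (use C s_closed[OF i d_closed[OF w]] in auto)
    then show ?thesis unfolding diff_sum_def using C d_closed[OF w] by (subst lin_finsum[OF s_lin[OF i]]) auto
  qed
  show ?thesis
  proof (cases "i \<in> C")
    case False
    then show ?thesis using other C iC by simp
  next
    case True
    define C' where "C' = C - {i, Suc i}"
    have CC: "C = insert i (insert (Suc i) C')" using True iC by (auto simp: C'_def)
    have C': "C' \<subseteq> {1..n}" "i \<notin> C'" "Suc i \<notin> C'" using C by (auto simp: C'_def)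
    have j: "i \<in> {1..n}" "Suc i \<in> {1..n}" using i by auto
    have ins: "diff_sum C v = (g i (v i) \<ominus> v i) \<oplus> ((g (Suc i) (v (Suc i)) \<ominus> v (Suc i)) \<oplus> diff_sum C' v)"
      if "v \<in> carrier P" for v
      using that C' j unfolding CC by (simp add: diff_sum_insert del: atLeastAtMost_iff)
    note gs = g_lin[OF j(1)] g_lin[OF j(2)] and ss = s_lin[OF i]
    show ?thesis
      unfolding ins[OF w] ins[OF S_closed[OF i w]] other[OF C'] S_apply[OF i w j(1)] S_apply[OF i w j(2)]
      using power_apply[OF w j(1)] power_apply[OF w j(2)] diff_sum_closed[OF w C'(1)]
      by (simp add: lin_simps[OF gs(1)] lin_simps[OF gs(2)] lin_simps[OF ss] s_g[OF i] g_s_g[OF i] minus_simps)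
  qed
qed

lemma s_eq_zero_iff: "i \<in> {1..<n} \<Longrightarrow> v \<in> carrier V \<Longrightarrow> s i v = \<zero> \<longleftrightarrow> v = \<zero>"
  using s_eq_iff[of i v "\<zero>"] lin_zero[OF s_lin] by simp

lemma g_eq_zero_iff: "j \<in> {1..n} \<Longrightarrow> v \<in> carrier V \<Longrightarrow> g j v = \<zero> \<longleftrightarrow> v = \<zero>"
  using g_eq_iff[of j v "\<zero>"] lin_zero[OF g_lin] by simp

lemma S_GL:
  assumes i: "i \<in> {1..<n}" shows "S i \<in> carrier (GL P)"
proof (rule P.GL_I[OF S_lin[OF i]])
  have j: "i \<in> {1..n}" "Suc i \<in> {1..n}" using i by auto
  note gs = g_lin[OF j(1)] g_lin[OF j(2)] and ss = s_lin[OF i]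
  show "S i \<in> extensional (carrier P)" by (simp add: LM_\<sigma>_def Let_def)
  show "w = \<zero>\<^bsub>P\<^esub>" if w: "w \<in> carrier P" "S i w = \<zero>\<^bsub>P\<^esub>" for w
  proof (rule power_ext[OF w(1) P.M.zero_closed])
    have 0: "S i w r = \<zero>" if "r \<in> {1..n}" for r using w(2) that by (simp add: power_space_simps(3))
    have b: "w (Suc i) = \<zero>"
      using 0[OF j(1)] power_apply[OF w(1) j(2)] g_closed[OF j(1)]
      by (simp add: S_apply[OF i w(1) j(1)] s_eq_zero_iff[OF i] g_eq_zero_iff[OF j(1)])
    have a: "w i = \<zero>"
      using 0[OF j(2)] power_apply[OF w(1) j(1)]
      by (simp add: S_apply[OF i w(1) j(2)] b lin_zero[OF gs(2)] minus_self s_eq_zero_iff[OF i])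
    fix r assume r: "r \<in> {1..n}"
    show "w r = \<zero>\<^bsub>P\<^esub> r"
      using 0[OF r] power_apply[OF w(1) r] r a b
      by (auto simp: S_apply[OF i w(1) r] power_space_simps(3) s_eq_zero_iff[OF i] split: if_splits)
  qed
  show "\<exists>w\<in>carrier P. S i w = y" if y: "y \<in> carrier P" for y
  proof -
    obtain b0 where b0: "b0 \<in> carrier V" "s i b0 = y i" using s_surj[OF i power_apply[OF y j(1)]] by blast
    obtain b where b: "b \<in> carrier V" "g i b = b0" using g_surj[OF j(1) b0(1)] by blast
    have "\<forall>r\<in>{1..n}. \<exists>v\<in>carrier V. s i v = y r" using s_surj[OF i power_apply[OF y]] by blast
    then obtain f where f: "\<And>r. r \<in> {1..n} \<Longrightarrow> f r \<in> carrier V" "\<And>r. r \<in> {1..n} \<Longrightarrow> s i (f r) = y r"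
      by metis
    define w where "w = (\<lambda>r\<in>{1..n}. if r = i then f (Suc i) \<ominus> (b \<ominus> g (Suc i) b) else if r = Suc i then b else f r)"
    have w: "w \<in> carrier P"
      using f(1) b(1) g_closed[OF j(2)] j(2) by (auto simp: w_def power_space_simps)
    have "S i w = y"
    proof (rule power_ext[OF S_closed[OF i w] y])
      fix r assume r: "r \<in> {1..n}"
      have ab: "w i = f (Suc i) \<ominus> (b \<ominus> g (Suc i) b)" "w (Suc i) = b" "r \<noteq> i \<Longrightarrow> r \<noteq> Suc i \<Longrightarrow> w r = f r"
        using i r by (simp_all add: w_def)
      have "f (Suc i) \<ominus> (b \<ominus> g (Suc i) b) \<oplus> (b \<ominus> g (Suc i) b) = f (Suc i)"
        using f(1)[OF j(2)] b(1) g_closed[OF j(2) b(1)] by (simp add: M.minus_eq M.a_assoc M.l_neg)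
      then show "S i w r = y r"
        using b0 b f(2)[OF j(2)] f(2)[OF r] by (simp add: S_apply[OF i w r] ab)
    qed
    then show ?thesis using w by blast
  qed
qed

lemma X_GL:
  assumes i: "i \<in> {1..n}" and lam: "lam \<noteq> 0" shows "X lam i \<in> carrier (GL P)"
proof (rule P.GL_I[OF X_lin[OF i]])
  have C: "{1..<i} \<subseteq> {1..n}" "{Suc i..n} \<subseteq> {1..n}" using i by auto
  show "X lam i \<in> extensional (carrier P)" by (simp add: LM_x_def Let_def block_op_def)
  show "w = \<zero>\<^bsub>P\<^esub>" if w: "w \<in> carrier P" "X lam i w = \<zero>\<^bsub>P\<^esub>" for w
  proof (rule power_ext[OF w(1) P.M.zero_closed])
    have 0: "X lam i w r = \<zero>" if "r \<in> {1..n}" for r using w(2) that by (simp add: power_space_simps(3))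
    have w0: "w r = \<zero>" if "r \<in> {1..n}" "r \<noteq> i" for r
      using X_apply_other[OF i that w(1)] 0[OF that(1)] by simp
    have d0: "diff_sum C w = \<zero>" if "C \<subseteq> {1..n}" "i \<notin> C" for C
    proof -
      have "diff_sum C w = (\<Oplus>c\<in>C. \<zero>)"
        unfolding diff_sum_def
      proof (rule M.finsum_cong')
        fix c assume "c \<in> C"
        then have "c \<in> {1..n}" "c \<noteq> i" using that by auto
        then show "g c (w c) \<ominus> w c = \<zero>" by (simp add: w0 lin_zero[OF g_lin] minus_self del: atLeastAtMost_iff)
      qed auto
      then show ?thesis by simp
    qed
    note wi = power_apply[OF w(1) i]
    have "lam \<odot> g i (w i) = \<zero>"
      using 0[OF i] d0[OF C(1)] d0[OF C(2)] g_closed[OF i wi] by (simp add: X_apply_same[OF i w(1)])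
    then have "inverse lam \<odot> (lam \<odot> g i (w i)) = \<zero>" by simp
    then have "g i (w i) = \<zero>" using lam g_closed[OF i wi] by (simp add: smult_cancel)
    then have "w i = \<zero>" using g_eq_zero_iff[OF i wi] by simp
    then show "w r = \<zero>\<^bsub>P\<^esub> r" if "r \<in> {1..n}" for r using w0[OF that] that by (cases "r = i") (simp_all add: power_space_simps(3))
  qed
  show "\<exists>w\<in>carrier P. X lam i w = y" if y: "y \<in> carrier P" for y
  proof -
    let ?L = "lam \<odot> diff_sum {1..<i} y" and ?H = "diff_sum {Suc i..n} y"
    note c = diff_sum_closed[OF y C(1)] diff_sum_closed[OF y C(2)] power_apply[OF y i]
    obtain v where v: "v \<in> carrier V" "g i v = inverse lam \<odot> (y i \<ominus> (?L \<oplus> ?H))"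
      using g_surj[OF i] c by (metis M.a_closed M.minus_closed smult_closed)
    let ?w = "y(i := v)"
    have w: "?w \<in> carrier P" using y v(1) i by (auto simp: power_space_simps PiE_def extensional_def)
    have d: "diff_sum {1..<i} ?w = diff_sum {1..<i} y" "diff_sum {Suc i..n} ?w = diff_sum {Suc i..n} y"
      using C by (auto intro!: diff_sum_cong[OF y])
    have "lam \<odot> (inverse lam \<odot> (y i \<ominus> (?L \<oplus> ?H))) = y i \<ominus> (?L \<oplus> ?H)"
      using smult_cancel[of "inverse lam" "y i \<ominus> (?L \<oplus> ?H)"] lam c by simp
    then have "?L \<oplus> (lam \<odot> g i v \<oplus> ?H) = y i"
      using c by (simp add: v(2) minus_simps)
    then have "X lam i ?w = y"
      using X_apply_other[OF i _ _ w] X_apply_same[OF i w] d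
      by (intro power_ext[OF X_closed[OF i w] y], rename_tac r, case_tac "r = i") simp_all
    then show ?thesis using w by blast
  qed
qed

end

context free_braid_module begin

lemma diff_sum_below_Suc:
  assumes "i \<in> {1..n}" "v \<in> carrier P"
  shows "diff_sum {1..<Suc i} v = (g i (v i) \<ominus> v i) \<oplus> diff_sum {1..<i} v"
proof -
  have "{1..<Suc i} = insert i {1..<i}" using assms(1) by auto
  then show ?thesis using diff_sum_insert[OF assms(2), of i "{1..<i}"] assms(1) by fastforce
qed

lemma diff_sum_from:
  assumes "i \<in> {1..n}" "v \<in> carrier P"
  shows "diff_sum {i..n} v = (g i (v i) \<ominus> v i) \<oplus> diff_sum {Suc i..n} v"
proof -
  have "{i..n} = insert i {Suc i..n}" using assms(1) by auto
  then show ?thesis using diff_sum_insert[OF assms(2), of i "{Suc i..n}"] assms(1) by fastforce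
qed

text \<open>The relations between the generators are checked in each block. The \<open>diff_sum\<close> terms away from the blocks
  \<open>i, i + 1\<close> are carried along by \<open>s\<^sub>i\<close>, and the rest is an identity in \<open>V\<close> that follows from the relations
  between \<open>g\<^sub>i\<close>, \<open>g\<^sub>i\<^sub>+\<^sub>1\<close> and \<open>s\<^sub>i\<close>, used as rewrite rules \<open>s g \<rightarrow> h s\<close> and \<open>h s h \<rightarrow> g h s\<close>
  for \<open>g = g\<^sub>i\<close>, \<open>h = g\<^sub>i\<^sub>+\<^sub>1\<close>.\<close>

lemma S_X:
  assumes i: "i \<in> {1..<n}" and w: "w \<in> carrier P"
  shows "S i (X lam i w) = X lam (Suc i) (S i w)"
proof -
  have j: "i \<in> {1..n}" "Suc i \<in> {1..n}" using i by auto
  note lin = lin_simps[OF g_lin[OF j(1)]] lin_simps[OF g_lin[OF j(2)]] lin_simps[OF s_lin[OF i]]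
  note Xw = X_closed[OF j(1) w] and Sw = S_closed[OF i w]
  have C: "{1..<i} \<subseteq> {1..n}" "{Suc (Suc i)..n} \<subseteq> {1..n}" using i by auto
  note lo = diff_sum_below_Suc[OF j(1)] and hi = diff_sum_from[OF j(2) w]
  note dS = diff_sum_S[OF i w C(1)] diff_sum_S[OF i w C(2)]
  note cl = power_apply[OF w j(1)] power_apply[OF w j(2)] diff_sum_closed[OF w C(1)] diff_sum_closed[OF w C(2)]
  show ?thesis
  proof (rule power_ext[OF S_closed[OF i Xw] X_closed[OF j(2) Sw]])
    fix r assume r: "r \<in> {1..n}"
    have Xa: "X lam i w i = lam \<odot> diff_sum {1..<i} w \<oplus> (lam \<odot> g i (w i) \<oplus> diff_sum {Suc i..n} w)"
      "X lam i w (Suc i) = w (Suc i)"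
      using X_apply_same[OF j(1) w] X_apply_other[OF j(1) j(2) _ w] by simp_all
    show "S i (X lam i w) r = X lam (Suc i) (S i w) r"
    proof (cases "r = Suc i")
      case True
      show ?thesis
        unfolding True S_apply[OF i Xw j(2)] X_apply_same[OF j(2) Sw] lo[OF Sw]
        using cl by (simp add: Xa hi dS S_apply[OF i w j(1)] S_apply[OF i w j(2)] lin s_g[OF i] g_s_g[OF i]
            smult_r_distr smult_minus_r minus_simps del: One_nat_def)
    next
      case False
      show ?thesis
        unfolding S_apply[OF i Xw r] X_apply_other[OF j(2) r False Sw] S_apply[OF i w r]
        using False r X_apply_other[OF j(1) r _ w] by (simp add: Xa(2))
    qed
  qed
qed

lemma X_S_X:
  assumes i: "i \<in> {1..<n}" and w: "w \<in> carrier P"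
  shows "X lam (Suc i) (S i (X lam (Suc i) w)) = X lam i (X lam (Suc i) (S i w))"
proof -
  have j: "i \<in> {1..n}" "Suc i \<in> {1..n}" using i by auto
  note lin = lin_simps[OF g_lin[OF j(1)]] lin_simps[OF g_lin[OF j(2)]] lin_simps[OF s_lin[OF i]]
  let ?v = "X lam (Suc i) w" and ?u = "X lam (Suc i) (S i w)"
  note v = X_closed[OF j(2) w, of lam] and Sw = S_closed[OF i w]
  note Sv = S_closed[OF i v] and u = X_closed[OF j(2) Sw, of lam]
  have C: "{1..<i} \<subseteq> {1..n}" "{Suc (Suc i)..n} \<subseteq> {1..n}" using i by auto
  note lo = diff_sum_below_Suc[OF j(1)] and hi = diff_sum_from[OF j(2)]
  have dX: "diff_sum {1..<i} (X lam (Suc i) v) = diff_sum {1..<i} v"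
    "diff_sum {Suc (Suc i)..n} (X lam (Suc i) v) = diff_sum {Suc (Suc i)..n} v" if "v \<in> carrier P" for v
    using C X_apply_other[OF j(2) _ _ that] by (auto intro!: diff_sum_cong[OF that])
  have dS: "diff_sum {1..<i} (S i v) = s i (diff_sum {1..<i} v)"
    "diff_sum {Suc (Suc i)..n} (S i v) = s i (diff_sum {Suc (Suc i)..n} v)" if "v \<in> carrier P" for v
    using diff_sum_S[OF i that C(1)] diff_sum_S[OF i that C(2)] by simp_all
  note cl = power_apply[OF w j(1)] power_apply[OF w j(2)] diff_sum_closed[OF w C(1)] diff_sum_closed[OF w C(2)]
  have X1: "X lam (Suc i) y (Suc i) = lam \<odot> diff_sum {1..<Suc i} y \<oplus> (lam \<odot> g (Suc i) (y (Suc i)) \<oplus> diff_sum {Suc (Suc i)..n} y)"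
    "X lam (Suc i) y i = y i" if "y \<in> carrier P" for y
    using X_apply_same[OF j(2) that] X_apply_other[OF j(2) j(1) _ that] by simp_all
  have S1: "S i y i = s i (g i (y (Suc i)))"
    "S i y (Suc i) = s i (y i \<oplus> (y (Suc i) \<ominus> g (Suc i) (y (Suc i))))" if "y \<in> carrier P" for y
    using S_apply[OF i that j(1)] S_apply[OF i that j(2)] by simp_all
  note ev = X1[OF w] X1[OF Sw] X1[OF Sv] S1[OF w] S1[OF v] lo[OF w] lo[OF Sw] lo[OF Sv]
    hi[OF u] dX[OF w] dX[OF Sw] dS[OF w] dS[OF v]
  show ?thesis
  proof (rule power_ext[OF X_closed[OF j(2) Sv] X_closed[OF j(1) u]])
    fix r assume r: "r \<in> {1..n}"
    consider "r = i" | "r = Suc i" | "r \<noteq> i" "r \<noteq> Suc i" by blast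
    then show "X lam (Suc i) (S i ?v) r = X lam i ?u r"
    proof cases
      case 1
      show ?thesis
        unfolding 1 X_apply_same[OF j(1) u] using cl
        by (simp add: ev lin s_g[OF i] g_s_g[OF i] smult_r_distr smult_minus_r minus_simps del: One_nat_def)
    next
      case 2
      show ?thesis
        unfolding 2 X_apply_other[OF j(1) j(2) _ u, OF n_not_Suc_n[THEN not_sym]] using cl
        by (simp add: ev lin s_g[OF i] g_s_g[OF i] smult_r_distr smult_minus_r minus_simps del: One_nat_def)
    next
      case 3
      show ?thesis
        unfolding X_apply_other[OF j(2) r 3(2) Sv] X_apply_other[OF j(1) r 3(1) u] X_apply_other[OF j(2) r 3(2) Sw]
          S_apply[OF i v r] S_apply[OF i w r]
        using 3 X_apply_other[OF j(2) r 3(2) w] by simp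
    qed
  qed
qed

lemma S_X_other:
  assumes i: "i \<in> {1..<n}" and j: "j \<in> {1..n}" "j \<noteq> i" "j \<noteq> Suc i" and w: "w \<in> carrier P"
  shows "S i (X lam j w) = X lam j (S i w)"
proof -
  have i': "i \<in> {1..n}" "Suc i \<in> {1..n}" using i by auto
  note Xw = X_closed[OF j(1) w, of lam] and Sw = S_closed[OF i w]
  have C: "{1..<j} \<subseteq> {1..n}" "{Suc j..n} \<subseteq> {1..n}" using j by auto
  have C': "i \<in> {1..<j} \<longleftrightarrow> Suc i \<in> {1..<j}" "i \<in> {Suc j..n} \<longleftrightarrow> Suc i \<in> {Suc j..n}" using i j by auto
  have Xo: "X lam j w i = w i" "X lam j w (Suc i) = w (Suc i)"
    using X_apply_other[OF j(1) i'(1) _ w] X_apply_other[OF j(1) i'(2) _ w] j by simp_all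
  show ?thesis
  proof (rule power_ext[OF S_closed[OF i Xw] X_closed[OF j(1) Sw]])
    fix r assume r: "r \<in> {1..n}"
    show "S i (X lam j w) r = X lam j (S i w) r"
    proof (cases "r = j")
      case True
      have "S i (X lam j w) j = s i (lam \<odot> diff_sum {1..<j} w \<oplus> (lam \<odot> g j (w j) \<oplus> diff_sum {Suc j..n} w))"
        using j by (simp add: S_apply[OF i Xw j(1)] X_apply_same[OF j(1) w])
      also have "\<dots> = X lam j (S i w) j"
        unfolding X_apply_same[OF j(1) Sw] diff_sum_S[OF i w C(1) C'(1)] diff_sum_S[OF i w C(2) C'(2)] S_apply[OF i w j(1)]
        using j diff_sum_closed[OF w C(1)] diff_sum_closed[OF w C(2)] g_closed[OF j(1)] power_apply[OF w j(1)]
        by (simp add: lin_simps[OF s_lin[OF i]] s_g_other[OF i j])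
      finally show ?thesis using True by simp
    next
      case False
      show ?thesis
        unfolding X_apply_other[OF j(1) r False Sw] S_apply[OF i w r] S_apply[OF i Xw r] Xo
          X_apply_other[OF j(1) r False w] ..
    qed
  qed
qed

text \<open>The blocks involved are disjoint; rewriting moves the operators of the index \<open>i\<close> to the left of those of the
  index \<open>j\<close>.\<close>

lemma S_commute:
  assumes ij: "1 \<le> i" "Suc i < j" "j < n" and w: "w \<in> carrier P"
  shows "S i (S j w) = S j (S i w)"
proof -
  have i: "i \<in> {1..<n}" "j \<in> {1..<n}" using ij by auto
  have m: "i \<in> {1..n}" "Suc i \<in> {1..n}" "j \<in> {1..n}" "Suc j \<in> {1..n}" using ij by auto
  have ne: "i \<noteq> j" "i \<noteq> Suc j" "j \<noteq> Suc i" "j \<noteq> i" "Suc i \<noteq> Suc j" "Suc j \<noteq> i" using ij by auto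
  note lin = lin_simps[OF s_lin[OF i(1)]] lin_simps[OF s_lin[OF i(2)]]
    lin_simps[OF g_lin[OF m(1)]] lin_simps[OF g_lin[OF m(2)]] lin_simps[OF g_lin[OF m(3)]] lin_simps[OF g_lin[OF m(4)]]
  have rel: "s j (s i v) = s i (s j v)" "s j (g i v) = g i (s j v)" "s j (g (Suc i) v) = g (Suc i) (s j v)"
    "g j (s i v) = s i (g j v)" "g (Suc j) (s i v) = s i (g (Suc j) v)" if "v \<in> carrier V" for v
    using that s_commute[OF ij that] s_g_other[OF i(2) m(1) _ _ that] s_g_other[OF i(2) m(2) _ _ that]
      s_g_other[OF i(1) m(3) _ _ that] s_g_other[OF i(1) m(4) _ _ that] ne by simp_all
  note Si = S_closed[OF i(1) w] and Sj = S_closed[OF i(2) w]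
  show ?thesis
  proof (rule power_ext[OF S_closed[OF i(1) Sj] S_closed[OF i(2) Si]])
    fix r assume r: "r \<in> {1..n}"
    note cl = power_apply[OF w r] power_apply[OF w m(1)] power_apply[OF w m(2)] power_apply[OF w m(3)] power_apply[OF w m(4)]
    note ev = S_apply[OF i(1) Sj] S_apply[OF i(2) Si] S_apply[OF i(1) w] S_apply[OF i(2) w]
    consider "r = i" | "r = Suc i" | "r = j" | "r = Suc j" | "r \<noteq> i" "r \<noteq> Suc i" "r \<noteq> j" "r \<noteq> Suc j" by blast
    then show "S i (S j w) r = S j (S i w) r"
      using cl r m ne by cases (simp_all add: ev lin rel del: atLeastAtMost_iff)
  qed
qed

text \<open>With \<open>s = s\<^sub>i\<close>, \<open>t = s\<^sub>i\<^sub>+\<^sub>1\<close> and \<open>g, h, k\<close> the images of \<open>x\<^sub>i, x\<^sub>i\<^sub>+\<^sub>1, x\<^sub>i\<^sub>+\<^sub>2\<close>, the relations are oriented as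
  \<open>s g \<rightarrow> h s\<close>, \<open>t h \<rightarrow> k t\<close>, \<open>h s h \<rightarrow> g h s\<close>, \<open>k t k \<rightarrow> h k t\<close>, \<open>s k \<rightarrow> k s\<close>, \<open>t g \<rightarrow> g t\<close>,
  \<open>s t s \<rightarrow> t s t\<close>. The two further rules \<open>s t k s \<rightarrow> t s t k\<close> and \<open>s h k t \<rightarrow> k s t k\<close> resolve critical pairs;
  without them the two sides of the braid relation have different normal forms.\<close>

lemma S_braid:
  assumes i: "1 \<le> i" "Suc i < n" and w: "w \<in> carrier P"
  shows "S i (S (Suc i) (S i w)) = S (Suc i) (S i (S (Suc i) w))"
proof -
  let ?s = "s i" and ?t = "s (Suc i)" and ?g = "g i" and ?h = "g (Suc i)" and ?k = "g (Suc (Suc i))"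
  have j: "i \<in> {1..<n}" "Suc i \<in> {1..<n}" using i by auto
  have m: "i \<in> {1..n}" "Suc i \<in> {1..n}" "Suc (Suc i) \<in> {1..n}" using i by auto
  note cl = g_closed[OF m(1)] g_closed[OF m(2)] g_closed[OF m(3)] s_closed[OF j(1)] s_closed[OF j(2)]
  note lin = lin_simps[OF s_lin[OF j(1)]] lin_simps[OF s_lin[OF j(2)]]
    lin_simps[OF g_lin[OF m(1)]] lin_simps[OF g_lin[OF m(2)]] lin_simps[OF g_lin[OF m(3)]]
  have sk: "?s (?k v) = ?k (?s v)" if "v \<in> carrier V" for v using s_g_other[OF j(1) m(3) _ _ that] by simp
  have tg: "?t (?g v) = ?g (?t v)" if "v \<in> carrier V" for v using s_g_other[OF j(2) m(1) _ _ that] by simp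
  note rel = s_g[OF j(1)] s_g[OF j(2)] g_s_g[OF j(1)] g_s_g[OF j(2)] sk tg s_braid[OF i]
  \<comment> \<open>Rewrite \<open>s t s k\<close> and \<open>s k t k\<close> in two ways each.\<close>
  have stks: "?s (?t (?k (?s v))) = ?t (?s (?t (?k v)))" if v: "v \<in> carrier V" for v
    using s_braid[OF i, of "?k v"] sk[OF v] v cl by simp
  have shkt: "?s (?h (?k (?t v))) = ?k (?s (?t (?k v)))" if v: "v \<in> carrier V" for v
    using g_s_g[OF j(2) v] sk[of "?t (?k v)"] v cl by simp
  note Sw = S_closed[OF j(1) w] S_closed[OF j(2) w]
  note SSw = S_closed[OF j(2) Sw(1)] S_closed[OF j(1) Sw(2)]
  show ?thesis
  proof (rule power_ext[OF S_closed[OF j(1) SSw(1)] S_closed[OF j(2) SSw(2)]])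
    fix r assume r: "r \<in> {1..n}"
    note wc = power_apply[OF w r] power_apply[OF w m(1)] power_apply[OF w m(2)] power_apply[OF w m(3)]
    note ev = S_apply[OF j(1) SSw(1)] S_apply[OF j(2) SSw(2)] S_apply[OF j(2) Sw(1)] S_apply[OF j(1) Sw(2)]
      S_apply[OF j(1) w] S_apply[OF j(2) w]
    consider "r = i" | "r = Suc i" | "r = Suc (Suc i)" | "r \<noteq> i" "r \<noteq> Suc i" "r \<noteq> Suc (Suc i)" by blast
    then show "S i (S (Suc i) (S i w)) r = S (Suc i) (S i (S (Suc i) w)) r"
      using wc r m by cases (simp_all add: ev lin rel stks shkt minus_simps del: atLeastAtMost_iff)
  qed
qed

text \<open>\<open>long_moody\<close> is a definite description; the universal property of \<open>F\<^sub>n \<rtimes> B\<^sub>n\<close> shows that it denotes.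
  For \<open>\<lambda> = 0\<close> it would not: the operator of \<open>x\<^sub>j\<close> would kill the block \<open>j\<close>.\<close>

lemma long_moody_ex1:
  assumes lam: "lam \<noteq> 0"
  shows "\<exists>!R. R \<in> hom (free_braid_group n) (GL P) \<and> R \<in> extensional (carrier (free_braid_group n)) \<and>
     (\<forall>j\<in>{1..n}. R (gen_x n j) = X lam j) \<and> (\<forall>i\<in>{1..<n}. R (gen_\<sigma> n i) = S i)"
proof -
  interpret H: group "GL P" by (rule P.group_GL)
  note ap = P.GL_mult_apply
  have X: "X lam j \<in> carrier (GL P)" if "j \<in> {1..n}" for j using that lam by (rule X_GL)
  have "\<exists>R \<in> hom (free_braid_group n) (GL P).
    (\<forall>j\<in>{1..n}. R (gen_x n j) = X lam j) \<and> (\<forall>i\<in>{1..<n}. R (gen_\<sigma> n i) = S i)"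
  proof (rule free_braid_hom_exists)
    fix i assume i: "1 \<le> i" "Suc i < n"
    then have j: "i \<in> {1..<n}" "Suc i \<in> {1..<n}" by auto
    note G = S_GL[OF j(1)] S_GL[OF j(2)]
    show "S i \<otimes>\<^bsub>GL P\<^esub> (S (Suc i) \<otimes>\<^bsub>GL P\<^esub> S i) = S (Suc i) \<otimes>\<^bsub>GL P\<^esub> (S i \<otimes>\<^bsub>GL P\<^esub> S (Suc i))"
      using G by (intro P.GL_eqI H.m_closed) (simp_all add: ap S_closed[OF j(1)] S_closed[OF j(2)] S_braid[OF i])
  next
    fix i j assume ij: "1 \<le> i" "Suc i < j" "j < n"
    then have j: "i \<in> {1..<n}" "j \<in> {1..<n}" by auto
    note G = S_GL[OF j(1)] S_GL[OF j(2)]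
    show "S i \<otimes>\<^bsub>GL P\<^esub> S j = S j \<otimes>\<^bsub>GL P\<^esub> S i"
      using G by (intro P.GL_eqI H.m_closed) (simp_all add: ap S_commute[OF ij])
  next
    fix i assume i: "i \<in> {1..<n}"
    then have j: "i \<in> {1..n}" "Suc i \<in> {1..n}" by auto
    note G = S_GL[OF i] X[OF j(1)] X[OF j(2)]
    show "S i \<otimes>\<^bsub>GL P\<^esub> X lam i = X lam (Suc i) \<otimes>\<^bsub>GL P\<^esub> S i"
      using G by (intro P.GL_eqI H.m_closed) (simp_all add: ap S_X[OF i])
    show "X lam (Suc i) \<otimes>\<^bsub>GL P\<^esub> (S i \<otimes>\<^bsub>GL P\<^esub> X lam (Suc i)) = X lam i \<otimes>\<^bsub>GL P\<^esub> (X lam (Suc i) \<otimes>\<^bsub>GL P\<^esub> S i)"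
      using G by (intro P.GL_eqI H.m_closed)
        (simp_all add: ap S_closed[OF i] X_closed[OF j(1)] X_closed[OF j(2)] X_S_X[OF i])
  next
    fix i j assume i: "i \<in> {1..<n}" and j: "j \<in> {1..n}" "j \<noteq> i" "j \<noteq> Suc i"
    show "S i \<otimes>\<^bsub>GL P\<^esub> X lam j = X lam j \<otimes>\<^bsub>GL P\<^esub> S i"
      using S_GL[OF i] X[OF j(1)] by (intro P.GL_eqI H.m_closed) (simp_all add: ap S_X_other[OF i j])
  qed (use X S_GL H.is_group in auto)
  then obtain R where R: "R \<in> hom (free_braid_group n) (GL P)" "\<And>j. j \<in> {1..n} \<Longrightarrow> R (gen_x n j) = X lam j"
    "\<And>i. i \<in> {1..<n} \<Longrightarrow> R (gen_\<sigma> n i) = S i" by blast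
  interpret G: group "free_braid_group n" by (rule group_free_braid_group)
  show ?thesis
  proof (rule ex1I[of _ "restrict R (carrier (free_braid_group n))"], intro conjI)
    show "restrict R (carrier (free_braid_group n)) \<in> hom (free_braid_group n) (GL P)"
      using R(1) by (auto simp: hom_def)
    show "\<forall>j\<in>{1..n}. restrict R (carrier (free_braid_group n)) (gen_x n j) = X lam j"
      "\<forall>i\<in>{1..<n}. restrict R (carrier (free_braid_group n)) (gen_\<sigma> n i) = S i"
      using R(2,3) free_braid_gen_closed by auto
  next
    fix T assume T: "T \<in> hom (free_braid_group n) (GL P) \<and> T \<in> extensional (carrier (free_braid_group n)) \<and>
      (\<forall>j\<in>{1..n}. T (gen_x n j) = X lam j) \<and> (\<forall>i\<in>{1..<n}. T (gen_\<sigma> n i) = S i)"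
    have "T p = R p" if "p \<in> carrier (free_braid_group n)" for p
      using T by (intro free_braid_hom_unique[OF H.is_group _ R(1) _ _ that]) (auto simp: R(2,3))
    then show "T = restrict R (carrier (free_braid_group n))"
      using T by (intro extensionalityI[of _ "carrier (free_braid_group n)"]) auto
  qed simp
qed

lemma long_moody_gen:
  assumes "lam \<noteq> 0"
  shows "j \<in> {1..n} \<Longrightarrow> long_moody n V \<rho> lam (gen_x n j) = X lam j"
    and "i \<in> {1..<n} \<Longrightarrow> long_moody n V \<rho> lam (gen_\<sigma> n i) = S i"
  using theI'[OF long_moody_ex1[OF assms]] unfolding long_moody_def by blast+

end


section \<open>The Katz-Long-Moody subspace\<close>

context free_braid_module begin

lemma P_apply:
  assumes "j \<in> {1..n}"
  shows "(v \<oplus>\<^bsub>P\<^esub> w) j = v j \<oplus> w j" "(c \<odot>\<^bsub>P\<^esub> w) j = c \<odot> w j" "\<zero>\<^bsub>P\<^esub> j = \<zero>"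
  using assms by (simp_all add: power_space_simps)

lemma KLM_K_subspace: "subspace class_ring (KLM_K n V \<rho>) P"
proof (rule P.subspaceI)
  show "\<zero>\<^bsub>P\<^esub> \<in> KLM_K n V \<rho>"
    by (simp add: KLM_K_def P_apply lin_zero[OF g_lin] del: atLeastAtMost_iff)
  show "v \<oplus>\<^bsub>P\<^esub> w \<in> KLM_K n V \<rho>" if "v \<in> KLM_K n V \<rho>" "w \<in> KLM_K n V \<rho>" for v w
    using that unfolding KLM_K_def
    by (auto simp: P_apply lin_add[OF g_lin] power_apply simp del: atLeastAtMost_iff)
  show "c \<odot>\<^bsub>P\<^esub> w \<in> KLM_K n V \<rho>" if "w \<in> KLM_K n V \<rho>" for c w
    using that unfolding KLM_K_def
    by (auto simp: P_apply lin_smult[OF g_lin] power_apply simp del: atLeastAtMost_iff)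
qed (auto simp: KLM_K_def)

text \<open>If \<open>g\<^sub>i\<close> fixes \<open>w\<^sub>i\<close> and \<open>g\<^sub>i\<^sub>+\<^sub>1\<close> fixes \<open>w\<^sub>i\<^sub>+\<^sub>1\<close>, the new blocks are \<open>s\<^sub>i g\<^sub>i w\<^sub>i\<^sub>+\<^sub>1 = g\<^sub>i\<^sub>+\<^sub>1 s\<^sub>i w\<^sub>i\<^sub>+\<^sub>1\<close> and
  \<open>s\<^sub>i w\<^sub>i\<close>, and the relations show that they are fixed by \<open>g\<^sub>i\<close> and \<open>g\<^sub>i\<^sub>+\<^sub>1\<close>.\<close>

lemma S_KLM_K:
  assumes i: "i \<in> {1..<n}" shows "S i ` KLM_K n V \<rho> \<subseteq> KLM_K n V \<rho>"
proof (intro image_subsetI)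
  have m: "i \<in> {1..n}" "Suc i \<in> {1..n}" using i by auto
  fix w assume "w \<in> KLM_K n V \<rho>"
  then have w: "w \<in> carrier P" and gw: "\<And>j. j \<in> {1..n} \<Longrightarrow> g j (w j) = w j" by (auto simp: KLM_K_def)
  note cl = power_apply[OF w m(1)] power_apply[OF w m(2)]
  have "g j (S i w j) = S i w j" if j: "j \<in> {1..n}" for j
  proof -
    consider "j = i" | "j = Suc i" | "j \<noteq> i" "j \<noteq> Suc i" by blast
    then show ?thesis
    proof cases
      case 1
      have "g i (s i (g i (w (Suc i)))) = g (Suc i) (s i (g (Suc i) (w (Suc i))))"
        using cl by (simp add: s_g[OF i] g_s_g[OF i])
      also have "\<dots> = s i (g i (w (Suc i)))" using cl by (simp add: gw[OF m(2)] s_g[OF i])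
      finally show ?thesis by (simp add: 1 S_apply[OF i w m(1)])
    next
      case 2
      have "S i w j = s i (w i)" using cl by (simp add: 2 S_apply[OF i w m(2)] gw[OF m(2)] minus_self)
      then show ?thesis using s_g[OF i cl(1)] by (simp add: 2 gw[OF m(1)])
    next
      case 3
      then show ?thesis using s_g_other[OF i j 3 power_apply[OF w j]] by (simp add: S_apply[OF i w j] gw[OF j])
    qed
  qed
  then show "S i w \<in> KLM_K n V \<rho>" using S_closed[OF i w] by (auto simp: KLM_K_def)
qed

lemma KLM_L_eq:
  assumes "lam \<noteq> 0"
  shows "KLM_L n V \<rho> lam = {w \<in> carrier P. \<forall>j\<in>{1..n}. X lam j w = w}"
  unfolding KLM_L_def using long_moody_gen(1)[OF assms] by auto

lemma KLM_L_subspace: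
  assumes "lam \<noteq> 0" shows "subspace class_ring (KLM_L n V \<rho> lam) P"
  unfolding KLM_L_eq[OF assms]
  by (rule P.subspaceI) (auto simp: P.lin_simps[OF X_lin] simp del: atLeastAtMost_iff)

text \<open>The fixed vectors of the normal subgroup \<open>F\<^sub>n\<close> form a subrepresentation.\<close>

lemma S_KLM_L:
  assumes lam: "lam \<noteq> 0" and i: "i \<in> {1..<n}"
  shows "S i ` KLM_L n V \<rho> lam \<subseteq> KLM_L n V \<rho> lam"
  unfolding KLM_L_eq[OF lam]
proof (intro image_subsetI)
  have m: "i \<in> {1..n}" "Suc i \<in> {1..n}" using i by auto
  fix w assume "w \<in> {w \<in> carrier P. \<forall>j\<in>{1..n}. X lam j w = w}"
  then have w: "w \<in> carrier P" and Xw: "\<And>j. j \<in> {1..n} \<Longrightarrow> X lam j w = w" by auto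
  have 1: "X lam (Suc i) (S i w) = S i w" using S_X[OF i w, of lam] by (simp add: Xw[OF m(1)])
  have "X lam j (S i w) = S i w" if j: "j \<in> {1..n}" for j
  proof -
    consider "j = i" | "j = Suc i" | "j \<noteq> i" "j \<noteq> Suc i" by blast
    then show ?thesis
    proof cases
      case 1
      then show ?thesis using X_S_X[OF i w, of lam] \<open>X lam (Suc i) (S i w) = S i w\<close> by (simp add: Xw[OF m(2)])
    next
      case 2
      then show ?thesis using 1 by simp
    next
      case 3
      then show ?thesis using S_X_other[OF i j 3 w, of lam] by (simp add: Xw[OF j])
    qed
  qed
  then show "S i w \<in> {w \<in> carrier P. \<forall>j\<in>{1..n}. X lam j w = w}" using S_closed[OF i w] by auto
qed

lemma KLM_sub_subspace: "lam \<noteq> 0 \<Longrightarrow> subspace class_ring (KLM_sub n V \<rho> lam) P"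
  unfolding KLM_sub_def by (intro P.sum_subspace KLM_K_subspace KLM_L_subspace)

lemma S_KLM_sub:
  assumes lam: "lam \<noteq> 0" and i: "i \<in> {1..<n}"
  shows "S i ` KLM_sub n V \<rho> lam \<subseteq> KLM_sub n V \<rho> lam"
proof (intro image_subsetI)
  fix w assume "w \<in> KLM_sub n V \<rho> lam"
  then obtain x y where xy: "x \<in> KLM_K n V \<rho>" "y \<in> KLM_L n V \<rho> lam" "w = x \<oplus>\<^bsub>P\<^esub> y"
    unfolding KLM_sub_def by (rule P.set_add_memE)
  then have "S i w = S i x \<oplus>\<^bsub>P\<^esub> S i y"
    using P.sub_carrier[OF KLM_K_subspace] P.sub_carrier[OF KLM_L_subspace[OF lam]] by (simp add: P.lin_add[OF S_lin[OF i]])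
  also have "\<dots> \<in> KLM_sub n V \<rho> lam"
    unfolding KLM_sub_def using S_KLM_K[OF i] S_KLM_L[OF lam i] xy by (intro P.set_add_memI) auto
  finally show "S i w \<in> KLM_sub n V \<rho> lam" .
qed

end


section \<open>Semisimplicity of the braid generators\<close>

context free_braid_module begin

definition single :: "nat \<Rightarrow> 'v \<Rightarrow> nat \<Rightarrow> 'v" where
  "single j b = (\<lambda>r\<in>{1..n}. if r = j then b else \<zero>)"

text \<open>The vector with coordinates \<open>(u, b)\<close> in which \<open>\<rho>\<^sup>L\<^sup>M(\<sigma>\<^sub>i)\<close> is block triangular: the subspace \<open>u = 0\<close> is a copy of
  \<open>s\<^sub>i\<close>, and the quotient by it is a copy of \<open>- s\<^sub>i g\<^sub>i\<close>.\<close>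

definition adapted :: "nat \<Rightarrow> 'v \<Rightarrow> 'v \<Rightarrow> nat \<Rightarrow> 'v" where
  "adapted i u b = (\<lambda>r\<in>{1..n}. if r = i then u \<oplus> s i (g i b) else if r = Suc i then s i b else \<zero>)"

lemma single_closed: "b \<in> carrier V \<Longrightarrow> single j b \<in> carrier P"
  by (auto simp: single_def power_space_simps)

lemma single_zero: "single j \<zero> = \<zero>\<^bsub>P\<^esub>"
  by (auto simp: single_def power_space_simps)

lemma single_add: "b \<in> carrier V \<Longrightarrow> c \<in> carrier V \<Longrightarrow> single j (b \<oplus> c) = single j b \<oplus>\<^bsub>P\<^esub> single j c"
  by (auto simp: single_def power_space_simps intro!: restrict_ext)

lemma single_smult: "single j (k \<odot> b) = k \<odot>\<^bsub>P\<^esub> single j b"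
  by (auto simp: single_def power_space_simps intro!: restrict_ext)

lemma S_single:
  assumes i: "i \<in> {1..<n}" and j: "j \<noteq> i" "j \<noteq> Suc i" and b: "b \<in> carrier V"
  shows "S i (single j b) = single j (s i b)"
proof (rule power_ext[OF S_closed[OF i single_closed[OF b]] single_closed[OF s_closed[OF i b]]])
  have m: "i \<in> {1..n}" "Suc i \<in> {1..n}" using i by auto
  fix r assume r: "r \<in> {1..n}"
  show "S i (single j b) r = single j (s i b) r"
    unfolding S_apply[OF i single_closed[OF b] r] using r i j b
    by (simp add: single_def lin_zero[OF g_lin[OF m(1)]] lin_zero[OF g_lin[OF m(2)]]
        lin_zero[OF s_lin[OF i]] minus_self)
qed

context
  fixes i assumes i: "i \<in> {1..<n}"
begin

lemma block_rows: "i \<in> {1..n}" "Suc i \<in> {1..n}" using i by auto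

lemma t_lin: "lin (\<lambda>v. s i (g i v))"
  by (rule linI) (simp_all add: lin_simps[OF s_lin[OF i]] lin_simps[OF g_lin[OF block_rows(1)]])

lemmas t_simps = lin_simps[OF t_lin] and si_simps = lin_simps[OF s_lin[OF i]]

lemma adapted_closed: "u \<in> carrier V \<Longrightarrow> b \<in> carrier V \<Longrightarrow> adapted i u b \<in> carrier P"
  by (auto simp: adapted_def power_space_simps t_simps si_simps)

lemma adapted_zero: "adapted i \<zero> \<zero> = \<zero>\<^bsub>P\<^esub>"
  by (auto simp: adapted_def power_space_simps t_simps si_simps intro!: restrict_ext)

lemma adapted_add:
  "u \<in> carrier V \<Longrightarrow> u' \<in> carrier V \<Longrightarrow> b \<in> carrier V \<Longrightarrow> b' \<in> carrier V \<Longrightarrow>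
    adapted i (u \<oplus> u') (b \<oplus> b') = adapted i u b \<oplus>\<^bsub>P\<^esub> adapted i u' b'"
  by (auto simp: adapted_def power_space_simps t_simps si_simps M.a_ac intro!: restrict_ext)

lemma adapted_smult:
  "u \<in> carrier V \<Longrightarrow> b \<in> carrier V \<Longrightarrow> adapted i (k \<odot> u) (k \<odot> b) = k \<odot>\<^bsub>P\<^esub> adapted i u b"
  by (auto simp: adapted_def power_space_simps t_simps si_simps smult_r_distr intro!: restrict_ext)

lemma adapted_eq_zero:
  assumes "u \<in> carrier V" "b \<in> carrier V" "adapted i u b = \<zero>\<^bsub>P\<^esub>"
  shows "u = \<zero>" "b = \<zero>"
proof -
  have 0: "adapted i u b r = \<zero>" if "r \<in> {1..n}" for r using assms(3) that by (simp add: power_space_simps(3))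
  show b: "b = \<zero>" using 0[OF block_rows(2)] block_rows assms s_eq_zero_iff[OF i] by (simp add: adapted_def)
  show "u = \<zero>" using 0[OF block_rows(1)] block_rows assms by (simp add: adapted_def b t_simps)
qed

lemma S_adapted:
  assumes u: "u \<in> carrier V" and b: "b \<in> carrier V"
  shows "S i (adapted i u b) = adapted i (\<ominus> s i (g i u)) (u \<oplus> s i b)"
proof (rule power_ext[OF S_closed[OF i adapted_closed[OF u b]] adapted_closed])
  fix r assume r: "r \<in> {1..n}"
  have 1: "adapted i u b i = u \<oplus> s i (g i b)" "adapted i u b (Suc i) = s i b"
    "r \<noteq> i \<Longrightarrow> r \<noteq> Suc i \<Longrightarrow> adapted i u b r = \<zero>" using block_rows r by (simp_all add: adapted_def)
  have 2: "u \<oplus> s i (g i b) \<oplus> (s i b \<ominus> s i (g i b)) = u \<oplus> s i b"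
    using u b by (simp add: t_simps si_simps minus_simps)
  have 3: "\<ominus> s i (g i u) \<oplus> (s i (g i u) \<oplus> s i (g i (s i b))) = s i (g i (s i b))"
    using u b by (simp add: t_simps si_simps M.r_neg1)
  show "S i (adapted i u b) r = adapted i (\<ominus> s i (g i u)) (u \<oplus> s i b) r"
    unfolding S_apply[OF i adapted_closed[OF u b] r] 1 s_g[OF i b, symmetric] 2
    using r u b by (simp add: 1 adapted_def t_simps si_simps 3)
qed (use u b in \<open>simp_all add: t_simps si_simps\<close>)

text \<open>Let \<open>E\<close> contain all eigenspaces. It contains the vectors with \<open>u = 0\<close> and those supported in a block other than
  \<open>i, i + 1\<close>, because \<open>s\<^sub>i\<close> is diagonalizable. A solution \<open>b\<^sub>0\<close> of \<open>u = (s\<^sub>i - \<nu>) b\<^sub>0\<close> makes \<open>(u, - b\<^sub>0)\<close> an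
  eigenvector, so \<open>E\<close> contains \<open>(u, 0)\<close> for every eigenvector \<open>u\<close> of \<open>- s\<^sub>i g\<^sub>i\<close>, hence for every \<open>u\<close>.\<close>

lemma diagonalizable_S:
  assumes d: "diagonalizable_op V (s i)" and dt: "diagonalizable_op V (\<lambda>v. \<ominus> s i (g i v))"
    and sol: "\<And>\<nu>. eigenspace V (\<lambda>v. \<ominus> s i (g i v)) \<nu> \<subseteq> (\<lambda>b. s i b \<ominus> \<nu> \<odot> b) ` carrier V"
  shows "diagonalizable_op P (S i)"
  unfolding diagonalizable_op_def
proof (intro allI impI, elim conjE)
  fix E assume E: "subspace class_ring E P" and sub: "\<forall>\<nu>. eigenspace P (S i) \<nu> \<subseteq> E"
  have all: "F = carrier V" if "diagonalizable_op V A" "subspace class_ring F V" "\<And>\<nu>. eigenspace V A \<nu> \<subseteq> F" for F A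
    using that by (auto simp: diagonalizable_op_def)
  have mem: "w \<in> E" if "w \<in> carrier P" "S i w = \<nu> \<odot>\<^bsub>P\<^esub> w" for w \<nu>
    using sub that by (auto simp: eigenspace_def)
  have other: "{b \<in> carrier V. single j b \<in> E} = carrier V" if j: "j \<noteq> i" "j \<noteq> Suc i" for j
  proof (rule all[OF d])
    show "subspace class_ring {b \<in> carrier V. single j b \<in> E} V"
      using P.sub_add[OF E] P.sub_smult[OF E] P.sub_zero[OF E]
      by (intro subspaceI) (auto simp: single_add single_smult single_zero)
    show "eigenspace V (s i) \<nu> \<subseteq> {b \<in> carrier V. single j b \<in> E}" for \<nu>
      by (auto simp: eigenspace_def S_single[OF i j] single_smult single_closed intro!: mem)
  qed
  have adapted_snd: "{b \<in> carrier V. adapted i \<zero> b \<in> E} = carrier V"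
  proof (rule all[OF d])
    show "subspace class_ring {b \<in> carrier V. adapted i \<zero> b \<in> E} V"
      using P.sub_add[OF E] P.sub_smult[OF E] P.sub_zero[OF E]
        adapted_add[of "\<zero>" "\<zero>"] adapted_smult[of "\<zero>"]
      by (intro subspaceI) (auto simp: adapted_zero)
    show "eigenspace V (s i) \<nu> \<subseteq> {b \<in> carrier V. adapted i \<zero> b \<in> E}" for \<nu>
      using adapted_smult[of "\<zero>" _ \<nu>]
      by (auto simp: eigenspace_def S_adapted t_simps adapted_closed uminus_zero intro!: mem[of _ \<nu>])
  qed
  have adapted_fst: "{u \<in> carrier V. adapted i u \<zero> \<in> E} = carrier V"
  proof (rule all[OF dt])
    show "subspace class_ring {u \<in> carrier V. adapted i u \<zero> \<in> E} V"
      using P.sub_add[OF E] P.sub_smult[OF E] P.sub_zero[OF E]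
        adapted_add[of _ _ "\<zero>" "\<zero>"] adapted_smult[of _ "\<zero>"]
      by (intro subspaceI) (auto simp: adapted_zero)
    show "eigenspace V (\<lambda>v. \<ominus> s i (g i v)) \<nu> \<subseteq> {u \<in> carrier V. adapted i u \<zero> \<in> E}" for \<nu>
    proof
      fix u assume ue: "u \<in> eigenspace V (\<lambda>v. \<ominus> s i (g i v)) \<nu>"
      then have u: "u \<in> carrier V" "\<ominus> s i (g i u) = \<nu> \<odot> u" by (auto simp: eigenspace_def)
      from ue sol[of \<nu>] obtain b0 where b0: "b0 \<in> carrier V" "u = s i b0 \<ominus> \<nu> \<odot> b0" by blast
      let ?b = "\<ominus> b0"
      have b: "?b \<in> carrier V" using b0 by simp
      have "u \<oplus> s i ?b = \<nu> \<odot> ?b"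
        using b0 add_diff_add_uminus[of "\<zero>" "s i b0" "\<nu> \<odot> b0"] by (simp add: si_simps smult_uminus)
      then have "S i (adapted i u ?b) = \<nu> \<odot>\<^bsub>P\<^esub> adapted i u ?b"
        by (simp add: S_adapted[OF u(1) b] u(2) adapted_smult[OF u(1) b])
      then have "adapted i u ?b \<in> E" by (rule mem[OF adapted_closed[OF u(1) b]])
      moreover have "adapted i \<zero> b0 \<in> E" using adapted_snd b0(1) by blast
      ultimately have "adapted i u ?b \<oplus>\<^bsub>P\<^esub> adapted i \<zero> b0 \<in> E" by (rule P.sub_add[OF E])
      then have "adapted i u \<zero> \<in> E" using adapted_add[OF u(1) M.zero_closed b b0(1)] u(1) b0(1) by (simp add: M.l_neg)
      then show "u \<in> {u \<in> carrier V. adapted i u \<zero> \<in> E}" using u by simp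
    qed
  qed
  have adapted: "adapted i u b \<in> E" if ub: "u \<in> carrier V" "b \<in> carrier V" for u b
  proof -
    have "adapted i u \<zero> \<in> E" "adapted i \<zero> b \<in> E" using adapted_fst adapted_snd ub by blast+
    then have "adapted i u \<zero> \<oplus>\<^bsub>P\<^esub> adapted i \<zero> b \<in> E" by (rule P.sub_add[OF E])
    then show ?thesis using adapted_add[OF ub(1) M.zero_closed M.zero_closed ub(2)] ub by simp
  qed
  have single: "single j b \<in> E" if b: "b \<in> carrier V" for j b
  proof -
    consider "j = i" | "j = Suc i" | "j \<noteq> i" "j \<noteq> Suc i" by blast
    then show ?thesis
    proof cases
      case 1
      have "single i b = adapted i b \<zero>" using b by (auto simp: single_def adapted_def t_simps si_simps intro!: restrict_ext)
      then show ?thesis using adapted[OF b M.zero_closed] 1 by simp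
    next
      case 2
      obtain c where c: "c \<in> carrier V" "s i c = b" using s_surj[OF i b] by blast
      \<comment> \<open>The coordinate \<open>u\<close> is chosen so that the block \<open>i\<close> of the vector cancels.\<close>
      have "single (Suc i) b = adapted i (\<ominus> s i (g i c)) c"
        using c by (auto simp: single_def adapted_def t_simps M.l_neg intro!: restrict_ext)
      then show ?thesis using adapted[of "\<ominus> s i (g i c)" c] c 2 by (simp add: t_simps)
    next
      case 3
      then show ?thesis using other[OF 3] b by blast
    qed
  qed
  have "w \<in> E" if w: "w \<in> carrier P" for w
  proof -
    \<comment> \<open>Truncations of \<open>w\<close> to its first \<open>k\<close> blocks exhaust it one block at a time.\<close>
    let ?w = "\<lambda>k. \<lambda>r\<in>{1..n}. if r \<le> k then w r else \<zero>"
    note wc = power_apply[OF w]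
    have "?w k \<in> E" if "k \<le> n" for k
      using that
    proof (induction k)
      case 0
      have "?w 0 = \<zero>\<^bsub>P\<^esub>" by (auto simp: power_space_simps intro!: restrict_ext)
      then show ?case using P.sub_zero[OF E] by simp
    next
      case (Suc k)
      then have k: "Suc k \<in> {1..n}" by simp
      have IH: "?w k \<in> E" by (rule Suc.IH) (use Suc.prems in simp)
      have "?w (Suc k) = ?w k \<oplus>\<^bsub>P\<^esub> single (Suc k) (w (Suc k))"
        using wc[OF k] wc by (auto simp: power_space_simps single_def le_Suc_eq intro!: restrict_ext)
      then show ?case using P.sub_add[OF E IH single[OF wc[OF k]]] by (simp only:)
    qed
    from this[of n] have "?w n \<in> E" by simp
    moreover have "?w n = w" using w by (intro power_ext[where n = n]) (auto simp: power_space_simps PiE_mem)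
    ultimately show ?thesis by simp
  qed
  then show "E = carrier P" using P.sub_carrier[OF E] by blast
qed

text \<open>Split \<open>u = p + (s\<^sub>i - \<nu>) b\<^sub>0\<close> with \<open>p\<close> in \<open>Ker (s\<^sub>i - \<nu>)\<close>. Then \<open>\<rho>\<^sup>L\<^sup>M(\<sigma>\<^sub>i) - \<nu>\<close> maps \<open>(u, - b\<^sub>0)\<close> to \<open>(0, p)\<close> and
  \<open>(0, p)\<close> to zero; the absence of Jordan blocks forces \<open>p = 0\<close>.\<close>

lemma semisimple_S_imp_solvable:
  assumes d: "diagonalizable_op V (s i)" and ss: "semisimple_op P (S i)"
  shows "eigenspace V (\<lambda>v. \<ominus> s i (g i v)) \<nu> \<subseteq> (\<lambda>b. s i b \<ominus> \<nu> \<odot> b) ` carrier V"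
proof
  fix u assume "u \<in> eigenspace V (\<lambda>v. \<ominus> s i (g i v)) \<nu>"
  then have u: "u \<in> carrier V" "\<ominus> s i (g i u) = \<nu> \<odot> u" by (auto simp: eigenspace_def)
  note lin = s_lin[OF i]
  obtain p where p: "p \<in> eigenspace V (s i) \<nu>" "u \<ominus> p \<in> other_eigenspaces_span (s i) \<nu>"
    using spectral_decomposition[OF lin d u(1)] .
  then obtain b0 where b0: "b0 \<in> carrier V" "u \<ominus> p = s i b0 \<ominus> \<nu> \<odot> b0"
    using other_eigenspaces_span_subset_image[OF lin, of \<nu>] by blast
  have pc: "p \<in> carrier V" "s i p = \<nu> \<odot> p" using p(1) by (auto simp: eigenspace_def)
  let ?b = "\<ominus> b0"
  have b: "?b \<in> carrier V" using b0(1) by simp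
  let ?w = "adapted i u ?b"
  have w: "?w \<in> carrier P" by (rule adapted_closed[OF u(1) b])
  have z: "adapted i \<zero> p \<in> carrier P" by (rule adapted_closed) (use pc in auto)
  have ub: "u = p \<oplus> (s i b0 \<ominus> \<nu> \<odot> b0)"
    using b0 u(1) pc(1) by (simp add: minus_eq_iff si_simps M.a_comm)
  have "u \<oplus> s i ?b = p \<oplus> \<nu> \<odot> ?b"
    using b0(1) pc(1) add_diff_add_uminus[of p "s i b0" "\<nu> \<odot> b0"]
    by (simp add: si_simps smult_uminus flip: ub)
  then have "S i ?w = \<nu> \<odot>\<^bsub>P\<^esub> ?w \<oplus>\<^bsub>P\<^esub> adapted i \<zero> p"
    using adapted_add[OF _ M.zero_closed _ pc(1), of "\<nu> \<odot> u" "\<nu> \<odot> ?b"] u b pc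
    by (simp add: S_adapted u(2) M.a_comm flip: adapted_smult)
  then have e: "S i ?w \<ominus>\<^bsub>P\<^esub> \<nu> \<odot>\<^bsub>P\<^esub> ?w = adapted i \<zero> p"
    using w z by (simp add: P.minus_eq_iff P.M.a_comm)
  have "adapted i \<zero> p \<in> eigenspace P (S i) \<nu>"
    using z pc adapted_smult[of "\<zero>" p \<nu>] by (simp add: eigenspace_def S_adapted t_simps uminus_zero)
  then have "?w \<in> eigenspace P (S i) \<nu>"
    using P.semisimple_kernel_square[OF S_lin[OF i] ss w] e by simp
  then have "adapted i \<zero> p = \<zero>\<^bsub>P\<^esub>" using e w by (simp add: eigenspace_def P.minus_self)
  then have "p = \<zero>" using adapted_eq_zero(2)[OF M.zero_closed pc(1)] by simp
  then show "u \<in> (\<lambda>b. s i b \<ominus> \<nu> \<odot> b) ` carrier V"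
    using ub b0(1) by (intro image_eqI[of _ _ b0]) (simp_all add: si_simps)
qed

end

end

theorem proposition5p8:
  fixes V :: "('k::field, 'v, 'm) module_scheme"
    and \<rho> :: "'v free_braid_rep"
    and n i :: nat
    and lam :: 'k
  assumes "vectorspace class_ring V" and "vectorspace.fin_dim class_ring V"
    and "n \<ge> 2"
    and "\<rho> \<in> hom (free_braid_group n) (GL V)"
    and "1 \<le> i" and "i \<le> n - 1"
    and "lam \<noteq> 0" and "lam \<noteq> 1"
    and "splits (min_poly V (\<rho> (gen_\<sigma> n i)))"
    and "splits (min_poly V (\<rho> (gen_\<sigma> n i) \<circ> \<rho> (gen_x n i)))"
    and "semisimple_op V (\<rho> (gen_\<sigma> n i))"
    and "semisimple_op V (\<rho> (gen_\<sigma> n i) \<circ> \<rho> (gen_x n i))"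
  shows "let s = \<rho> (gen_\<sigma> n i); g = \<rho> (gen_x n i);
             C = (\<forall>\<nu> \<in> spec V s \<inter> uminus ` spec V (s \<circ> g). \<forall>v \<in> carrier V.
                    spectral_proj V s \<nu> (spectral_proj V (\<lambda>u. \<ominus>\<^bsub>V\<^esub> s (g u)) \<nu> v) = \<zero>\<^bsub>V\<^esub>)
         in (semisimple_op (power_space n V) (long_moody n V \<rho> lam (gen_\<sigma> n i)) \<longleftrightarrow> C) \<and>
            (C \<longrightarrow> (\<forall>\<mu>. \<mu> \<noteq> 0 \<longrightarrow> \<mu> \<noteq> 1 \<longrightarrow>
               semisimple_op (KLM_space n V \<rho> \<mu>) (katz_long_moody n V \<rho> \<mu> (gen_\<sigma> n i))))"
proof -
  interpret free_braid_module V n \<rho>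
    by (rule free_braid_module.intro[OF class_vectorspace.intro[OF assms(1)] free_braid_module_axioms.intro[OF assms(4)]])
  have i: "i \<in> {1..<n}" using assms(3,5,6) by auto
  let ?t = "\<lambda>v. s i (g i v)" and ?B = "\<lambda>v. \<ominus>\<^bsub>V\<^esub> s i (g i v)"
  define C where "C = (\<forall>\<nu> \<in> spec V (s i) \<inter> uminus ` spec V ?t. \<forall>v \<in> carrier V.
    spectral_proj V (s i) \<nu> (spectral_proj V ?B \<nu> v) = \<zero>\<^bsub>V\<^esub>)"
  note sl = s_lin[OF i] and tl = t_lin[OF i] and fd = assms(2)
  have t: "splits (min_poly V ?t)" "semisimple_op V ?t" using assms(10,12) by (simp_all add: comp_def)
  note ds = semisimple_split_imp_diagonalizable[OF sl fd assms(11,9)]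
  note dt = semisimple_split_imp_diagonalizable[OF tl fd t(2,1)]
  note B = lin_uminus[OF tl] semisimple_uminus[OF tl t(2)] diagonalizable_uminus[OF tl dt]
  have C_iff: "C \<longleftrightarrow> (\<forall>\<nu>. eigenspace V ?B \<nu> \<subseteq> (\<lambda>b. s i b \<ominus>\<^bsub>V\<^esub> \<nu> \<odot>\<^bsub>V\<^esub> b) ` carrier V)"
    unfolding C_def spec_uminus[OF tl, symmetric]
    by (rule spectral_proj_product_zero_iff[OF sl assms(11) ds B])
  have dS: "diagonalizable_op P (S i)" if C
    using that unfolding C_iff by (intro diagonalizable_S[OF i ds B(3)]) blast
  have LM: "semisimple_op P (S i) \<longleftrightarrow> C"
  proof
    assume "semisimple_op P (S i)"
    then show C unfolding C_iff using semisimple_S_imp_solvable[OF i ds] by blast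
  next
    assume C
    then show "semisimple_op P (S i)" by (rule P.diagonalizable_imp_semisimple[OF S_lin[OF i] dS])
  qed
  have KLM: "semisimple_op (KLM_space n V \<rho> \<mu>) (katz_long_moody n V \<rho> \<mu> (gen_\<sigma> n i))" if C "\<mu> \<noteq> 0" for \<mu>
    unfolding KLM_space_def katz_long_moody_def long_moody_gen(2)[OF that(2) i]
    by (rule P.semisimple_quotient[OF KLM_sub_subspace[OF that(2)] S_lin[OF i] S_KLM_sub[OF that(2) i] dS[OF that(1)]])
  show ?thesis
    unfolding Let_def comp_def C_def[symmetric] long_moody_gen(2)[OF assms(7) i] using LM KLM by blast
qed

end
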